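(* Under Assumption A (see context), there is a constant $C$, independent of $N$, such that for every $N\ge1$ $$\max_{t\in[0,T],\,m\in S_d^N}\left|V^N(t,m)-V(t,m)\right|\le\frac{C}{\sqrt N},$$ where $V^N$ is the value function of the $N$-agent optimization and $V$ the value function of the mean field control problem.
   Context: **Notation.** $d\ge2$ is an integer, $T>0$, $S_d=\{m\in\mathbb{R}^d:m_i\ge0,\ \sum_im_i=1\}$, $S_d^N=S_d\cap\frac1N\mathbb{N}^d$ (with $0\in\mathbb{N}$), $|\cdot|$ is the Euclidean norm, $\delta_i$ is the $i$-th canonical basis vector of $\mathbb{R}^d$. **Data.** Action space $A$, transition rates $Q_{i,j}:[0,T]\times A\times S_d\to[0,\infty)$, running costs $f^i:[0,T]\times A\times S_d\to\mathbb{R}$, terminal costs $g^i:S_d\to\mathbb{R}$, $i,j\in\{1,\dots,d\}$. Set $F(t,a^1,\dots,a^d,m)=\sum_im_if^i(t,a^i,m)$ and $G(m)=\sum_im_ig^i(m)$. **Assumption A.** (A1) $A$ is a compact metric space. (A2) Each $Q_{i,j}$ is continuous on $[0,T]\times A\times S_d$ and $|Q_{i,j}(t,a,m)-Q_{i,j}(s,a,p)|\le C(|t-s|+|m-p|)$ with $C$ independent of $a$. (A3) $F$ is continuous on $[0,T]\times A^d\times S_d$, $|F(t,a,m)-F(s,a,p)|\le C(|t-s|+|m-p|)$ with $C$ independent of $a\in A^d$, and $|G(m)-G(p)|\le C|m-p|$. **$N$-agent optimization (mean field formulation).** Controls are measurable feedback functions $\alpha_N:[0,T]\times\{1,\dots,d\}\times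 S_d^N\to A$. Given $\alpha_N$, $\mu^N$ is the time-inhomogeneous Markov chain on $S_d^N$ which jumps at time $t$ from $m$ to $m+\frac1N(\delta_j-\delta_i)$, $i\ne j$, with rate $Nm_iQ_{i,j}(t,\alpha_N(t,i,m),m)$. $V^N(t,m)$, for $(t,m)\in[0,T]\times S^N_d$, is the infimum over $\alpha_N$ of $$\mathbb{E}\Big[\int_t^T\sum_i\mu^N_{i,s}f^i(s,\alpha_N(s,i,\mu^N_s),\mu^N_s)\,ds+\sum_i\mu^N_{i,T}g^i(\mu^N_T)\Big],\qquad\mu^N_t=m.$$ **Mean field control problem.** Controls are measurable functions $\alpha=(\alpha^1,\dots,\alpha^d):[0,T]\to A^d$. $V(t,m)$, for $(t,m)\in[0,T]\times S_d$, is the infimum over $\alpha$ of $\int_t^TF(s,\alpha(s),\mu_s)\,ds+G(\mu_T)$, where $\mu$ solves on $[t,T]$ $$\tfrac{d}{ds}\mu^i_s=\sum_j\big(\mu^j_sQ_{j,i}(s,\alpha^j(s),\mu_s)-\mu^i_sQ_{i,j}(s,\alpha^i(s),\mu_s)\big),\qquad\mu_t=m.$$ *)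

theory Defs
  imports "HOL-Probability.Probability"
begin

text \<open>
  The dimension \<open>d\<close> is \<open>CARD('d)\<close>. The action space is a subset \<open>A\<close> of a metric type \<open>'a\<close>, and
  tuples in \<open>A\<^sup>d\<close> are vectors \<open>a :: 'a ^ 'd\<close> with all components in \<open>A\<close>. The rates
  \<open>Q i j\<close>, the running costs \<open>f i\<close> and the terminal costs \<open>g i\<close> are total functions, of which
  only the values on \<open>[0,T]\<close>, \<open>A\<close> and the simplex are ever used.
\<close>

definition prob_simplex :: "(real ^ 'd) set" where
  "prob_simplex = {m. (\<forall>i. 0 \<le> m $ i) \<and> (\<Sum>i\<in>UNIV. m $ i) = 1}"

definition simplex_grid :: "nat \<Rightarrow> (real ^ 'd) set" where
  "simplex_grid N = {m \<in> prob_simplex. \<forall>i. \<exists>k::nat. m $ i = real k / real N}"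

definition tuples :: "'a set \<Rightarrow> ('a ^ 'd) set" where
  "tuples A = {a. \<forall>i. a $ i \<in> A}"

definition total_running_cost ::
    "('d \<Rightarrow> real \<Rightarrow> 'a \<Rightarrow> real ^ 'd \<Rightarrow> real) \<Rightarrow> real \<Rightarrow> 'a ^ 'd \<Rightarrow> real ^ 'd \<Rightarrow> real" where
  "total_running_cost f t a m = (\<Sum>i\<in>UNIV. m $ i * f i t (a $ i) m)"

definition total_terminal_cost :: "('d \<Rightarrow> real ^ 'd \<Rightarrow> real) \<Rightarrow> real ^ 'd \<Rightarrow> real" where
  "total_terminal_cost g m = (\<Sum>i\<in>UNIV. m $ i * g i m)"

definition assumption_A ::
    "real \<Rightarrow> 'a::metric_space set \<Rightarrow> ('d \<Rightarrow> 'd \<Rightarrow> real \<Rightarrow> 'a \<Rightarrow> real ^ 'd \<Rightarrow> real) \<Rightarrow>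
     ('d \<Rightarrow> real \<Rightarrow> 'a \<Rightarrow> real ^ 'd \<Rightarrow> real) \<Rightarrow> ('d \<Rightarrow> real ^ 'd \<Rightarrow> real) \<Rightarrow> bool" where
  "assumption_A T A Q f g \<longleftrightarrow>
     compact A \<and>
     (\<forall>i j. continuous_on ({0..T} \<times> A \<times> prob_simplex) (\<lambda>(t, a, m). Q i j t a m)) \<and>
     (\<exists>C. \<forall>i j. \<forall>t\<in>{0..T}. \<forall>s\<in>{0..T}. \<forall>a\<in>A. \<forall>m\<in>prob_simplex. \<forall>p\<in>prob_simplex.
        \<bar>Q i j t a m - Q i j s a p\<bar> \<le> C * (\<bar>t - s\<bar> + norm (m - p))) \<and>
     continuous_on ({0..T} \<times> tuples A \<times> prob_simplex) (\<lambda>(t, a, m). total_running_cost f t a m) \<and>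
     (\<exists>C. \<forall>t\<in>{0..T}. \<forall>s\<in>{0..T}. \<forall>a\<in>tuples A. \<forall>m\<in>prob_simplex. \<forall>p\<in>prob_simplex.
        \<bar>total_running_cost f t a m - total_running_cost f s a p\<bar>
          \<le> C * (\<bar>t - s\<bar> + norm (m - p))) \<and>
     (\<exists>C. \<forall>m\<in>prob_simplex. \<forall>p\<in>prob_simplex.
        \<bar>total_terminal_cost g m - total_terminal_cost g p\<bar> \<le> C * norm (m - p))"


subsection \<open>Time-inhomogeneous Markov chains on a finite state space\<close>

text \<open>
  \<open>q u x y\<close> is the rate at time \<open>u\<close> of a jump from \<open>x\<close> to \<open>y \<noteq> x\<close>; \<open>p s x r y\<close> is the probability
  of being in \<open>y\<close> at time \<open>r\<close> when starting from \<open>x\<close> at time \<open>s\<close>. The rates are only measurable in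
  time, so Kolmogorov's forward equation
  \<open>\<partial>\<^sub>r p s x r y = (\<Sum>z\<noteq>y. p s x r z * q r z y - p s x r y * q r y z)\<close> holds for almost every \<open>r\<close>
  and is stated in integrated form.
\<close>

definition transition_function ::
    "'s set \<Rightarrow> (real \<Rightarrow> 's \<Rightarrow> 's \<Rightarrow> real) \<Rightarrow> real \<Rightarrow> real \<Rightarrow>
     (real \<Rightarrow> 's \<Rightarrow> real \<Rightarrow> 's \<Rightarrow> real) \<Rightarrow> bool" where
  "transition_function S q t T p \<longleftrightarrow>
     (\<forall>s\<in>{t..T}. \<forall>r\<in>{s..T}. \<forall>x\<in>S.
        (\<forall>y\<in>S. 0 \<le> p s x r y) \<and> (\<Sum>y\<in>S. p s x r y) = 1 \<and>
        (\<forall>y\<in>S.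
           set_integrable lborel {s..r}
             (\<lambda>u. \<Sum>z\<in>S - {y}. p s x u z * q u z y - p s x u y * q u y z) \<and>
           p s x r y = (if x = y then 1 else 0) +
             (LBINT u:{s..r}. \<Sum>z\<in>S - {y}. p s x u z * q u z y - p s x u y * q u y z)))"

text \<open>
  For paths in a finite (discrete) state space, being right-continuous with left limits means being
  locally constant to the right and to the left of every time. The Markov property is with respect
  to the natural filtration: conditionally on the past \<open>E\<close> up to time \<open>s\<close> and on \<open>X s = x\<close>, the
  state at time \<open>r\<close> has distribution \<open>p s x r\<close>.
\<close>

definition markov_chain_with_rates ::
    "'s set \<Rightarrow> (real \<Rightarrow> 's \<Rightarrow> 's \<Rightarrow> real) \<Rightarrow> real \<Rightarrow> real \<Rightarrow> 's \<Rightarrow>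
     'w measure \<Rightarrow> (real \<Rightarrow> 'w \<Rightarrow> 's) \<Rightarrow> bool" where
  "markov_chain_with_rates S q t T x0 M X \<longleftrightarrow>
     prob_space M \<and>
     (\<forall>s\<in>{t..T}. X s \<in> measurable M (count_space S)) \<and>
     (AE \<omega> in M. X t \<omega> = x0) \<and>
     (\<forall>\<omega>\<in>space M.
        (\<forall>s\<in>{t..<T}. \<forall>\<^sub>F r in at_right s. X r \<omega> = X s \<omega>) \<and>
        (\<forall>s\<in>{t<..T}. \<exists>x. \<forall>\<^sub>F r in at_left s. X r \<omega> = x)) \<and>
     (\<exists>p. transition_function S q t T p \<and>
        (\<forall>s\<in>{t..T}. \<forall>r\<in>{s..T}. \<forall>x\<in>S. \<forall>y\<in>S.
         \<forall>E \<in> sigma_sets (space M) {X u -` B \<inter> space M | u B. u \<in> {t..s} \<and> B \<subseteq> S}.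
           measure M {\<omega>\<in>E. X s \<omega> = x \<and> X r \<omega> = y}
             = measure M {\<omega>\<in>E. X s \<omega> = x} * p s x r y))"


subsection \<open>The \<open>N\<close>-agent optimization\<close>

definition feedback_controls ::
    "nat \<Rightarrow> real \<Rightarrow> 'a::metric_space set \<Rightarrow> (real \<Rightarrow> 'd::finite \<Rightarrow> real ^ 'd \<Rightarrow> 'a) set" where
  "feedback_controls N T A =
     {\<alpha>. (\<lambda>(s, i, m). \<alpha> s i m) \<in> measurable
        (restrict_space borel {0..T} \<Otimes>\<^sub>M count_space UNIV \<Otimes>\<^sub>M count_space (simplex_grid N))
        (restrict_space borel A)}"

text \<open>
  The sum has at most one summand, since \<open>x\<close> and \<open>y \<noteq> x\<close> determine the pair \<open>(i, j)\<close>.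
\<close>

definition agent_jump_rate ::
    "nat \<Rightarrow> ('d \<Rightarrow> 'd \<Rightarrow> real \<Rightarrow> 'a \<Rightarrow> real ^ 'd \<Rightarrow> real) \<Rightarrow>
     (real \<Rightarrow> 'd::finite \<Rightarrow> real ^ 'd \<Rightarrow> 'a) \<Rightarrow> real \<Rightarrow> real ^ 'd \<Rightarrow> real ^ 'd \<Rightarrow> real" where
  "agent_jump_rate N Q \<alpha> s x y =
     (\<Sum>(i, j) \<in> {(i, j). i \<noteq> j \<and> y = x + (1 / real N) *\<^sub>R (axis j 1 - axis i 1)}.
        real N * x $ i * Q i j s (\<alpha> s i x) x)"

definition agent_cost ::
    "real \<Rightarrow> ('d \<Rightarrow> real \<Rightarrow> 'a \<Rightarrow> real ^ 'd \<Rightarrow> real) \<Rightarrow> ('d \<Rightarrow> real ^ 'd \<Rightarrow> real) \<Rightarrow> real \<Rightarrow>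
     (real \<Rightarrow> 'd::finite \<Rightarrow> real ^ 'd \<Rightarrow> 'a) \<Rightarrow> 'w measure \<Rightarrow> (real \<Rightarrow> 'w \<Rightarrow> real ^ 'd) \<Rightarrow> real" where
  "agent_cost T f g t \<alpha> M X =
     integral\<^sup>L M (\<lambda>\<omega>.
       (LBINT s:{t..T}. \<Sum>i\<in>UNIV. X s \<omega> $ i * f i s (\<alpha> s i (X s \<omega>)) (X s \<omega>)) +
       (\<Sum>i\<in>UNIV. X T \<omega> $ i * g i (X T \<omega>)))"

text \<open>
  The cost of \<open>\<alpha>\<close> depends only on the law of the chain, which is determined by the rates and the
  initial state. The chain is therefore realised as the coordinate process on a space of paths.
\<close>

definition agent_value ::
    "nat \<Rightarrow> real \<Rightarrow> 'a::metric_space set \<Rightarrow> ('d \<Rightarrow> 'd \<Rightarrow> real \<Rightarrow> 'a \<Rightarrow> real ^ 'd \<Rightarrow> real) \<Rightarrow>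
     ('d \<Rightarrow> real \<Rightarrow> 'a \<Rightarrow> real ^ 'd \<Rightarrow> real) \<Rightarrow> ('d::finite \<Rightarrow> real ^ 'd \<Rightarrow> real) \<Rightarrow>
     real \<Rightarrow> real ^ 'd \<Rightarrow> real" where
  "agent_value N T A Q f g t m =
     Inf {agent_cost T f g t \<alpha> M (\<lambda>s \<omega>. \<omega> s) | \<alpha> (M :: (real \<Rightarrow> real ^ 'd) measure).
       \<alpha> \<in> feedback_controls N T A \<and>
       markov_chain_with_rates (simplex_grid N) (agent_jump_rate N Q \<alpha>) t T m M (\<lambda>s \<omega>. \<omega> s)}"


subsection \<open>The mean field control problem\<close>

definition mf_controls :: "real \<Rightarrow> 'a::metric_space set \<Rightarrow> (real \<Rightarrow> 'a ^ 'd::finite) set" where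
  "mf_controls T A = measurable (restrict_space borel {0..T}) (restrict_space borel (tuples A))"

definition mf_drift ::
    "('d \<Rightarrow> 'd \<Rightarrow> real \<Rightarrow> 'a \<Rightarrow> real ^ 'd \<Rightarrow> real) \<Rightarrow> real \<Rightarrow> 'a ^ 'd \<Rightarrow> real ^ 'd \<Rightarrow> 'd::finite \<Rightarrow> real"
  where
  "mf_drift Q s a m i =
     (\<Sum>j\<in>UNIV. m $ j * Q j i s (a $ j) m - m $ i * Q i j s (a $ i) m)"

text \<open>
  The control is only measurable in time, so the differential equation is understood in the sense
  of Caratheodory, that is, in integrated form.
\<close>

definition mf_solution ::
    "real \<Rightarrow> ('d \<Rightarrow> 'd \<Rightarrow> real \<Rightarrow> 'a \<Rightarrow> real ^ 'd \<Rightarrow> real) \<Rightarrow> real \<Rightarrow> real ^ 'd::finite \<Rightarrow>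
     (real \<Rightarrow> 'a ^ 'd) \<Rightarrow> (real \<Rightarrow> real ^ 'd) \<Rightarrow> bool" where
  "mf_solution T Q t m \<alpha> \<mu> \<longleftrightarrow>
     (\<forall>s\<in>{t..T}. \<mu> s \<in> prob_simplex \<and>
        (\<forall>i. set_integrable lborel {t..s} (\<lambda>u. mf_drift Q u (\<alpha> u) (\<mu> u) i) \<and>
             \<mu> s $ i = m $ i + (LBINT u:{t..s}. mf_drift Q u (\<alpha> u) (\<mu> u) i)))"

definition mf_value ::
    "real \<Rightarrow> 'a::metric_space set \<Rightarrow> ('d \<Rightarrow> 'd \<Rightarrow> real \<Rightarrow> 'a \<Rightarrow> real ^ 'd \<Rightarrow> real) \<Rightarrow>
     ('d \<Rightarrow> real \<Rightarrow> 'a \<Rightarrow> real ^ 'd \<Rightarrow> real) \<Rightarrow> ('d::finite \<Rightarrow> real ^ 'd \<Rightarrow> real) \<Rightarrow>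
     real \<Rightarrow> real ^ 'd \<Rightarrow> real" where
  "mf_value T A Q f g t m =
     Inf {(LBINT s:{t..T}. total_running_cost f s (\<alpha> s) (\<mu> s)) + total_terminal_cost g (\<mu> T) |
       \<alpha> \<mu>. \<alpha> \<in> mf_controls T A \<and> mf_solution T Q t m \<alpha> \<mu>}"

end

(* Fix a trajectory X of the N-agent system with feedback control a. Inserting it into a gives the
   open-loop control s -> (a(s, i, X_s))_i of the mean field problem, and X solves the mean field
   equation for this control up to the martingale part of X. Since the drift and the costs are
   Lipschitz in the state, uniformly in the control, a Gronwall estimate bounds the difference
   between the cost along X and the cost of the exact solution by the size of the martingale part,
   whose second moment is O(1/N) because there are O(N) jumps of size O(1/N). Taking expectations
   gives V <= V^N + C/sqrt N. For the converse the agents use a nearly optimal open-loop control.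
   This needs the existence of the chain: it is built by thinning a Poisson clock, and its
   finite-dimensional distributions are identified by a duality between the backward equation that
   they satisfy and a solution of the forward equation. *)

theory Submission imports Defs begin

subsection \<open>Integrals over intervals\<close>

text \<open>The infimum in \<open>agent_value\<close> ranges over every realisation of a chain, so
  the martingale estimate may use only the definition of a chain: Dynkin's formula comes from the
  integrated forward equation, and joint measurability in time and \<omega> from right-continuity.
  The construction of a chain serves the other inequality, where a given open-loop control must have
  some realisation for its cost to enter the infimum. Controls are merely measurable in time, so all
  equations stay in integrated form, and differentiation is replaced by a product rule for
  indefinite integrals. Gronwall's inequality is used in an averaged form: the error of the cost is
  bounded by the defect at the final time plus the time integral of the defect, and by Fubini's
  theorem both are controlled by second moments at single times. One existence theorem for flows on
  a simplex provides the mean field trajectories, with the d components as indices, and the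
  solutions of the forward equation, with the grid points as indices.\<close>

lemma set_integrable_bounded:
  fixes f :: "real \<Rightarrow> real"
  assumes "set_borel_measurable lborel {a..b} f" "\<And>x. x \<in> {a..b} \<Longrightarrow> \<bar>f x\<bar> \<le> B"
  shows "set_integrable lborel {a..b} f"
  unfolding set_integrable_def
proof (rule integrableI_bounded_set[where A="{a..b}" and B=B])
  show "(\<lambda>x. indicator {a..b} x *\<^sub>R f x) \<in> borel_measurable lborel"
    using assms(1) by (simp add: set_borel_measurable_def)
  show "emeasure lborel {a..b} < \<infinity>"
    by (metis emeasure_lborel_Icc_eq infinity_ennreal_def ennreal_less_top top.not_eq_extremum)
  show "AE x\<in>{a..b} in lborel. norm (indicator {a..b} x *\<^sub>R f x) \<le> B"
    using assms(2) by (auto simp: indicator_def)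
qed auto

text \<open>Fubini's theorem on the plane cut along the diagonal, which is a null set. In the second
  term the order of integration is exchanged, so that in both terms the inner integral runs up to
  the outer variable.\<close>

lemma lborel_triangle_split:
  fixes g :: "real \<Rightarrow> real \<Rightarrow> real"
  assumes g: "integrable (lborel \<Otimes>\<^sub>M lborel) (\<lambda>(u, v). g u v)"
  shows "(LBINT u. LBINT v. g u v) =
    (LBINT u. LBINT v. indicator {..u} v * g u v) + (LBINT v. LBINT u. indicator {..v} u * g u v)"
proof -
  have gm[measurable]: "(\<lambda>(u, v). g u v) \<in> borel_measurable (lborel \<Otimes>\<^sub>M lborel)"
    using g by auto
  let ?g1 = "\<lambda>(u, v). indicator {..u} v * g u v"
  let ?g2 = "\<lambda>(u, v). indicator {..<v} u * g u v"
  have m1: "?g1 \<in> borel_measurable (lborel \<Otimes>\<^sub>M lborel)"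
  proof -
    have "?g1 = (\<lambda>x. (if snd x \<le> fst x then 1 else 0) * (case x of (u, v) \<Rightarrow> g u v))"
      by (auto simp: fun_eq_iff)
    then show ?thesis using gm by simp
  qed
  have m2: "?g2 \<in> borel_measurable (lborel \<Otimes>\<^sub>M lborel)"
  proof -
    have "?g2 = (\<lambda>x. (if fst x < snd x then 1 else 0) * (case x of (u, v) \<Rightarrow> g u v))"
      by (auto simp: fun_eq_iff)
    then show ?thesis using gm by simp
  qed
  have i1: "integrable (lborel \<Otimes>\<^sub>M lborel) ?g1"
    by (rule Bochner_Integration.integrable_bound[OF g m1]) (auto simp: indicator_def)
  have i2: "integrable (lborel \<Otimes>\<^sub>M lborel) ?g2"
    by (rule Bochner_Integration.integrable_bound[OF g m2]) (auto simp: indicator_def)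
  have "(LBINT u. LBINT v. g u v) = (LINT x|(lborel \<Otimes>\<^sub>M lborel). (case x of (u, v) \<Rightarrow> g u v))"
    using lborel_pair.integral_fst'[OF g] by simp
  also have "\<dots> = (LINT x|(lborel \<Otimes>\<^sub>M lborel). ?g1 x + ?g2 x)"
    by (intro Bochner_Integration.integral_cong) (auto simp: indicator_def)
  also have "\<dots> = (LINT x|(lborel \<Otimes>\<^sub>M lborel). ?g1 x) + (LINT x|(lborel \<Otimes>\<^sub>M lborel). ?g2 x)"
    using i1 i2 by simp
  also have "(LINT x|(lborel \<Otimes>\<^sub>M lborel). ?g1 x) = (LBINT u. LBINT v. indicator {..u} v * g u v)"
    using lborel_pair.integral_fst'[OF i1] by simp
  also have "(LINT x|(lborel \<Otimes>\<^sub>M lborel). ?g2 x) = (LBINT v. LBINT u. indicator {..<v} u * g u v)"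
    using lborel_pair.integral_snd[OF i2] by simp
  also have "\<dots> = (LBINT v. LBINT u. indicator {..v} u * g u v)"
  proof (rule Bochner_Integration.integral_cong[OF refl])
    fix v :: real
    have "AE u in lborel. u \<noteq> v" by (rule AE_lborel_singleton)
    then have "AE u in lborel. indicator {..<v} u * g u v = indicator {..v} u * g u v"
      by eventually_elim (auto simp: indicator_def)
    moreover have "(\<lambda>u. g u v) \<in> borel_measurable lborel"
      using measurable_Pair1'[of v lborel lborel] gm by (auto dest: measurable_Pair1)
    ultimately show "(LBINT u. indicator {..<v} u * g u v) = (LBINT u. indicator {..v} u * g u v)"
      by (intro integral_cong_AE) measurable
  qed
  finally show ?thesis .
qed

lemma integrable_lborel_prod_mult:
  fixes a c :: "real \<Rightarrow> real"
  assumes a: "integrable lborel a" and c: "integrable lborel c"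
  shows "integrable (lborel \<Otimes>\<^sub>M lborel) (\<lambda>(u, v). a u * c v)"
proof (rule lborel_pair.Fubini_integrable)
  have [measurable]: "a \<in> borel_measurable lborel" "c \<in> borel_measurable lborel"
    using a c by auto
  show "(\<lambda>(u, v). a u * c v) \<in> borel_measurable (lborel \<Otimes>\<^sub>M lborel)" by measurable
  show "integrable lborel (\<lambda>u. LBINT v. norm (case (u, v) of (u, v) \<Rightarrow> a u * c v))"
    using a c by (simp add: abs_mult)
  show "AE u in lborel. integrable lborel (\<lambda>v. case (u, v) of (u, v) \<Rightarrow> a u * c v)"
    using c by simp
qed

lemma borel_measurable_indefinite_integral:
  fixes a' :: "real \<Rightarrow> real"
  assumes a': "integrable lborel a'"
  shows "(\<lambda>u. LBINT v. indicator {..u} v * a' v) \<in> borel_measurable lborel"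
proof -
  have [measurable]: "a' \<in> borel_measurable lborel" using a' by auto
  have "(\<lambda>(u, v). (if v \<le> u then 1 else 0) * a' v) \<in> borel_measurable (lborel \<Otimes>\<^sub>M lborel)"
    by measurable
  then have "(\<lambda>u. LBINT v. (if v \<le> u then 1 else 0) * a' v) \<in> borel_measurable lborel"
    by (intro lborel.borel_measurable_lebesgue_integral) auto
  then show ?thesis by (simp add: indicator_def)
qed

lemma abs_indefinite_integral_le:
  fixes a' :: "real \<Rightarrow> real"
  assumes a': "integrable lborel a'"
  shows "\<bar>LBINT v. indicator {..u} v * a' v\<bar> \<le> (LBINT v. \<bar>a' v\<bar>)"
proof -
  have i: "integrable lborel (\<lambda>v. indicator {..u} v * a' v)"
    using integrable_real_mult_indicator[of "{..u}" lborel a'] a' by (simp add: mult.commute)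
  have "\<bar>LBINT v. indicator {..u} v * a' v\<bar> \<le> (LBINT v. \<bar>indicator {..u} v * a' v\<bar>)"
    by (rule integral_abs_bound)
  also have "\<dots> \<le> (LBINT v. \<bar>a' v\<bar>)"
    using i a' by (intro integral_mono) (auto simp: indicator_def)
  finally show ?thesis .
qed

text \<open>Integration by parts for absolutely continuous functions given only through their
  integrable derivatives. Up to the initial values, the product of the two indefinite integrals is
  an integral over a square, and its two triangles yield the two terms.\<close>

lemma set_integral_product_rule:
  fixes a a' c c' :: "real \<Rightarrow> real"
  assumes ts: "t \<le> s"
    and a': "set_integrable lborel {t..s} a'" and c': "set_integrable lborel {t..s} c'"
    and a: "\<And>u. u \<in> {t..s} \<Longrightarrow> a u = a0 + (LBINT v:{t..u}. a' v)"
    and c: "\<And>u. u \<in> {t..s} \<Longrightarrow> c u = c0 + (LBINT v:{t..u}. c' v)"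
  shows "set_integrable lborel {t..s} (\<lambda>u. a' u * c u)"
    and "set_integrable lborel {t..s} (\<lambda>u. a u * c' u)"
    and "a s * c s = a0 * c0 + (LBINT u:{t..s}. a' u * c u) + (LBINT u:{t..s}. a u * c' u)"
proof -
  \<comment> \<open>Extension by zero lets all integrals run over the whole line with the cut-off
    {..u}, the form in which \<open>lborel_triangle_split\<close> applies.\<close>
  define f where "f v = indicator {t..s} v * a' v" for v
  define h where "h v = indicator {t..s} v * c' v" for v
  have f: "integrable lborel f" and h: "integrable lborel h"
    using a' c' by (simp_all add: f_def[abs_def] h_def[abs_def] set_integrable_def)
  note [measurable] = borel_measurable_indefinite_integral[OF f] borel_measurable_indefinite_integral[OF h]
  have [measurable]: "f \<in> borel_measurable lborel" "h \<in> borel_measurable lborel" using f h by auto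
  have af: "a u = a0 + (LBINT v. indicator {..u} v * f v)" if "u \<in> {t..s}" for u
    unfolding a[OF that] set_lebesgue_integral_def f_def using that
    by (intro arg_cong2[where f="(+)"] Bochner_Integration.integral_cong) (auto simp: indicator_def)
  have ch: "c u = c0 + (LBINT v. indicator {..u} v * h v)" if "u \<in> {t..s}" for u
    unfolding c[OF that] set_lebesgue_integral_def h_def using that
    by (intro arg_cong2[where f="(+)"] Bochner_Integration.integral_cong) (auto simp: indicator_def)
  have i_bd: "integrable lborel (\<lambda>u. p u * (LBINT v. indicator {..u} v * q v))"
    if p: "integrable lborel p" and q: "integrable lborel q" for p q :: "real \<Rightarrow> real"
  proof (rule Bochner_Integration.integrable_bound[where f="\<lambda>u. p u * (LBINT v. \<bar>q v\<bar>)"])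
    show "integrable lborel (\<lambda>u. p u * (LBINT v. \<bar>q v\<bar>))" using p by simp
    note [measurable] = borel_measurable_indefinite_integral[OF q]
    have [measurable]: "p \<in> borel_measurable lborel" using p by auto
    show "(\<lambda>u. p u * (LBINT v. indicator {..u} v * q v)) \<in> borel_measurable lborel" by measurable
    show "AE u in lborel. norm (p u * (LBINT v. indicator {..u} v * q v)) \<le> norm (p u * (LBINT v. \<bar>q v\<bar>))"
    proof (rule AE_I2)
      fix u
      have "\<bar>LBINT v. indicator {..u} v * q v\<bar> \<le> \<bar>LBINT v. \<bar>q v\<bar>\<bar>"
        using abs_indefinite_integral_le[OF q, of u] by linarith
      then show "norm (p u * (LBINT v. indicator {..u} v * q v)) \<le> norm (p u * (LBINT v. \<bar>q v\<bar>))"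
        by (simp add: abs_mult mult_left_mono)
    qed
  qed
  have e1: "indicator {t..s} u * (a' u * c u) = f u * c0 + f u * (LBINT v. indicator {..u} v * h v)" for u
    by (cases "u \<in> {t..s}") (auto simp: f_def ch algebra_simps)
  have e2: "indicator {t..s} u * (a u * c' u) = a0 * h u + h u * (LBINT v. indicator {..u} v * f v)" for u
    by (cases "u \<in> {t..s}") (auto simp: h_def af algebra_simps)
  show "set_integrable lborel {t..s} (\<lambda>u. a' u * c u)"
    unfolding set_integrable_def using f i_bd[OF f h] by (simp add: e1)
  show "set_integrable lborel {t..s} (\<lambda>u. a u * c' u)"
    unfolding set_integrable_def using h i_bd[OF h f] by (simp add: e2)
  have "(LBINT u. f u) * (LBINT v. h v) = (LBINT u. LBINT v. f u * h v)" by simp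
  also have "\<dots> = (LBINT u. LBINT v. indicator {..u} v * (f u * h v)) + (LBINT v. LBINT u. indicator {..v} u * (f u * h v))"
    by (rule lborel_triangle_split[OF integrable_lborel_prod_mult[OF f h]])
  also have "(LBINT u. LBINT v. indicator {..u} v * (f u * h v)) = (LBINT u. f u * (LBINT v. indicator {..u} v * h v))"
    by (intro Bochner_Integration.integral_cong refl)
       (simp add: algebra_simps flip: integral_mult_right_zero integral_mult_left_zero)
  also have "(LBINT v. LBINT u. indicator {..v} u * (f u * h v)) = (LBINT v. h v * (LBINT u. indicator {..v} u * f u))"
    by (intro Bochner_Integration.integral_cong refl)
       (simp add: algebra_simps flip: integral_mult_right_zero integral_mult_left_zero)
  finally have P: "(LBINT u. f u) * (LBINT v. h v) =
    (LBINT u. f u * (LBINT v. indicator {..u} v * h v)) + (LBINT v. h v * (LBINT u. indicator {..v} u * f u))" .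
  have s: "s \<in> {t..s}" using ts by simp
  have fs: "(LBINT v. indicator {..s} v * f v) = (LBINT v. f v)"
    and hs: "(LBINT v. indicator {..s} v * h v) = (LBINT v. h v)"
    by (auto intro!: Bochner_Integration.integral_cong simp: f_def h_def indicator_def)
  have "(LBINT u:{t..s}. a' u * c u) = (LBINT u. f u) * c0 + (LBINT u. f u * (LBINT v. indicator {..u} v * h v))"
    unfolding set_lebesgue_integral_def using f i_bd[OF f h] by (simp add: e1)
  moreover have "(LBINT u:{t..s}. a u * c' u) = a0 * (LBINT u. h u) + (LBINT v. h v * (LBINT u. indicator {..v} u * f u))"
    unfolding set_lebesgue_integral_def using h i_bd[OF h f] by (simp add: e2)
  ultimately show "a s * c s = a0 * c0 + (LBINT u:{t..s}. a' u * c u) + (LBINT u:{t..s}. a u * c' u)"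
    unfolding af[OF s] ch[OF s] fs hs using P by (simp add: algebra_simps)
qed

lemma set_integrable_continuous_mult:
  fixes a c :: "real \<Rightarrow> real"
  assumes a: "set_integrable lborel {t..s} a" and c: "continuous_on {t..s} c"
  shows "set_integrable lborel {t..s} (\<lambda>u. c u * a u)"
proof -
  have "compact (c ` {t..s})" by (rule compact_continuous_image[OF c]) simp
  then have "bounded (c ` {t..s})" by (rule compact_imp_bounded)
  then obtain B where "\<forall>x\<in>c ` {t..s}. norm x \<le> B" unfolding bounded_iff by blast
  then have B: "\<And>u. u \<in> {t..s} \<Longrightarrow> \<bar>c u\<bar> \<le> B" by simp
  have cm: "(\<lambda>u. indicator {t..s} u *\<^sub>R c u) \<in> borel_measurable lborel"
    using borel_measurable_continuous_on_indicator[OF _ c] by simp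
  have am: "(\<lambda>u. indicator {t..s} u *\<^sub>R a u) \<in> borel_measurable lborel"
    using a by (auto simp: set_integrable_def)
  show ?thesis unfolding set_integrable_def
  proof (rule Bochner_Integration.integrable_bound[where f="\<lambda>u. B * (indicator {t..s} u *\<^sub>R a u)"])
    show "integrable lborel (\<lambda>u. B * (indicator {t..s} u *\<^sub>R a u))"
      using a unfolding set_integrable_def by (rule integrable_mult_right)
    have "(\<lambda>u. (indicator {t..s} u *\<^sub>R c u) * (indicator {t..s} u *\<^sub>R a u)) \<in> borel_measurable lborel"
      using cm am by (rule borel_measurable_times)
    moreover have "(\<lambda>u. (indicator {t..s} u *\<^sub>R c u) * (indicator {t..s} u *\<^sub>R a u)) = (\<lambda>u. indicator {t..s} u *\<^sub>R (c u * a u))"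
      by (auto simp: fun_eq_iff indicator_def)
    ultimately show "(\<lambda>u. indicator {t..s} u *\<^sub>R (c u * a u)) \<in> borel_measurable lborel" by simp
    show "AE u in lborel. norm (indicator {t..s} u *\<^sub>R (c u * a u)) \<le> norm (B * (indicator {t..s} u *\<^sub>R a u))"
    proof (rule AE_I2)
      fix u
      have "u \<in> {t..s} \<Longrightarrow> \<bar>c u\<bar> \<le> \<bar>B\<bar>" using B[of u] by linarith
      then show "norm (indicator {t..s} u *\<^sub>R (c u * a u)) \<le> norm (B * (indicator {t..s} u *\<^sub>R a u))"
        by (auto simp: indicator_def abs_mult intro: mult_right_mono)
    qed
  qed
qed

section \<open>Exponential weights and Gronwall's inequality\<close>

lemma exp_eq_set_integral:
  fixes k t s :: real
  assumes "t \<le> s"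
  shows "set_integrable lborel {t..s} (\<lambda>u. k * exp (k * (u - t)))"
    and "exp (k * (s - t)) = 1 + (LBINT u:{t..s}. k * exp (k * (u - t)))"
proof -
  show "set_integrable lborel {t..s} (\<lambda>u. k * exp (k * (u - t)))"
    by (rule borel_integrable_compact[of "{t..s}", folded set_integrable_def]) (auto intro!: continuous_intros)
  have "(LBINT u:{t..s}. k * exp (k * (u - t))) = exp (k * (s - t)) - exp (k * (t - t))"
    unfolding set_lebesgue_integral_def
    by (rule integral_FTC_atLeastAtMost[OF assms])
       (auto intro!: derivative_eq_intros continuous_intros simp flip: has_real_derivative_iff_has_vector_derivative)
  then show "exp (k * (s - t)) = 1 + (LBINT u:{t..s}. k * exp (k * (u - t)))" by simp
qed

text \<open>Integrating factors: the weight adds k * a to the derivative. A negative k serves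
  Gronwall's inequality and undoes the mild formulation of a flow; k = \<open>rate\<close> removes
  the clock rate from the renewal equation.\<close>

lemma exp_product_rule:
  fixes a a' :: "real \<Rightarrow> real"
  assumes ts: "t \<le> s"
    and a': "set_integrable lborel {t..s} a'"
    and a: "\<And>u. u \<in> {t..s} \<Longrightarrow> a u = a0 + (LBINT v:{t..u}. a' v)"
  shows "set_integrable lborel {t..s} (\<lambda>u. exp (k * (u - t)) * (a' u + k * a u))"
    and "exp (k * (s - t)) * a s = a0 + (LBINT u:{t..s}. exp (k * (u - t)) * (a' u + k * a u))"
proof -
  have c: "exp (k * (u - t)) = 1 + (LBINT v:{t..u}. k * exp (k * (v - t)))" if "u \<in> {t..s}" for u
    using exp_eq_set_integral(2)[of t u k] that by simp
  note P = set_integral_product_rule[OF ts a' exp_eq_set_integral(1)[OF ts] a c]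
  have e: "a' u * exp (k * (u - t)) + a u * (k * exp (k * (u - t))) = exp (k * (u - t)) * (a' u + k * a u)" for u
    by (simp add: algebra_simps)
  show "set_integrable lborel {t..s} (\<lambda>u. exp (k * (u - t)) * (a' u + k * a u))"
    using set_integral_add(1)[OF P(1,2)] by (simp only: e)
  show "exp (k * (s - t)) * a s = a0 + (LBINT u:{t..s}. exp (k * (u - t)) * (a' u + k * a u))"
    using P(3) set_integral_add(2)[OF P(1,2)] by (simp add: e mult.commute)
qed

lemma set_integrable_Icc_subset:
  fixes f :: "real \<Rightarrow> real"
  assumes "set_integrable lborel {a..b} f" "a \<le> c" "d \<le> b"
  shows "set_integrable lborel {c..d} f"
  using assms by (intro set_integrable_subset[OF assms(1)]) auto

text \<open>Let a(u) be the integral of D up to u and w(u) = exp (-2L(u - t)). The product rule and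
  w(s) a(s) \<ge> 0 show that 2L times the integral of w a is at most the integral of w D. When the
  hypothesis is integrated against w, the term with L is therefore at most half of the left side and
  is absorbed; this is the origin of both factors 2.\<close>

lemma gronwall_average:
  fixes D e :: "real \<Rightarrow> real"
  assumes ts: "t \<le> s" and L: "L > 0"
    and D: "set_integrable lborel {t..s} D" and e: "set_integrable lborel {t..s} e"
    and D0: "\<And>u. u \<in> {t..s} \<Longrightarrow> 0 \<le> D u" and e0: "\<And>u. u \<in> {t..s} \<Longrightarrow> 0 \<le> e u"
    and le: "\<And>u. u \<in> {t..s} \<Longrightarrow> D u \<le> e u + L * (LBINT v:{t..u}. D v)"
  shows "(LBINT u:{t..s}. D u) \<le> 2 * exp (2 * L * (s - t)) * (LBINT u:{t..s}. e u)"
proof -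
  define a where "a u = (LBINT v:{t..u}. D v)" for u
  define w where "w u = exp ((- 2 * L) * (u - t))" for u
  have w_cont: "continuous_on {t..s} w" by (auto simp: w_def intro!: continuous_intros)
  have iwD: "set_integrable lborel {t..s} (\<lambda>u. w u * D u)"
    and iwe: "set_integrable lborel {t..s} (\<lambda>u. w u * e u)"
    using set_integrable_continuous_mult[OF _ w_cont] D e by auto
  have "a u = 0 + (LBINT v:{t..u}. D v)" for u by (simp add: a_def)
  note P = exp_product_rule[OF ts D this, where k="- 2 * L", folded w_def]
  \<comment> \<open>Integrability of w * a is read off from the derivative of w * a, which the
    product rule has just shown to be integrable.\<close>
  have iwa: "set_integrable lborel {t..s} (\<lambda>u. w u * a u)"
  proof -
    have "set_integrable lborel {t..s} (\<lambda>u. (1 / (2 * L)) * (w u * D u - w u * (D u + (- 2 * L) * a u)))"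
      by (intro set_integrable_mult_right set_integral_diff(1) iwD P(1))
    moreover have "(1 / (2 * L)) * (w u * D u - w u * (D u + (- 2 * L) * a u)) = w u * a u" for u
      using L by (simp add: field_simps)
    ultimately show ?thesis by simp
  qed
  have a_nn: "0 \<le> a s" unfolding a_def set_lebesgue_integral_def
    by (rule Bochner_Integration.integral_nonneg) (use D0 in \<open>auto simp: indicator_def\<close>)
  have "0 \<le> w s * a s" using a_nn by (simp add: w_def)
  also have "\<dots> = (LBINT u:{t..s}. w u * D u - 2 * L * (w u * a u))"
    unfolding P(2) by (simp add: algebra_simps)
  also have "\<dots> = (LBINT u:{t..s}. w u * D u) - 2 * L * (LBINT u:{t..s}. w u * a u)"
    using set_integral_diff(2)[OF iwD set_integrable_mult_right[OF iwa], of "2 * L"] L by simp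
  finally have 1: "2 * L * (LBINT u:{t..s}. w u * a u) \<le> (LBINT u:{t..s}. w u * D u)" by simp
  have "(LBINT u:{t..s}. w u * D u) \<le> (LBINT u:{t..s}. w u * e u + L * (w u * a u))"
  proof (rule set_integral_mono[OF iwD])
    show "set_integrable lborel {t..s} (\<lambda>u. w u * e u + L * (w u * a u))"
      by (intro set_integral_add(1) iwe set_integrable_mult_right iwa)
    show "w u * D u \<le> w u * e u + L * (w u * a u)" if "u \<in> {t..s}" for u
      using mult_left_mono[OF le[OF that], of "w u"] by (simp add: w_def a_def algebra_simps)
  qed
  also have "\<dots> = (LBINT u:{t..s}. w u * e u) + L * (LBINT u:{t..s}. w u * a u)"
    using set_integral_add(2)[OF iwe set_integrable_mult_right[OF iwa], of L] L by simp
  finally have 2: "(LBINT u:{t..s}. w u * D u) \<le> 2 * (LBINT u:{t..s}. w u * e u)" using 1 by linarith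
  \<comment> \<open>On {t..s} the weight lies between w s and 1, so it is removed at the cost of the
    factor 1 / w s.\<close>
  have "w s * (LBINT u:{t..s}. D u) = (LBINT u:{t..s}. w s * D u)" by simp
  also have "\<dots> \<le> (LBINT u:{t..s}. w u * D u)"
    using L by (intro set_integral_mono set_integrable_mult_right D iwD mult_right_mono D0) (auto simp: w_def)
  also note 2
  also have "(LBINT u:{t..s}. w u * e u) \<le> (LBINT u:{t..s}. e u)"
    using L by (intro set_integral_mono iwe e) (auto simp: w_def intro!: mult_left_le_one_le e0)
  finally have "w s * (LBINT u:{t..s}. D u) \<le> 2 * (LBINT u:{t..s}. e u)" by simp
  then have "exp (2 * L * (s - t)) * (w s * (LBINT u:{t..s}. D u)) \<le> exp (2 * L * (s - t)) * (2 * (LBINT u:{t..s}. e u))"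
    by (intro mult_left_mono) auto
  moreover have "exp (2 * L * (s - t)) * w s = 1" by (simp add: w_def flip: exp_add)
  ultimately show ?thesis by (simp add: mult.assoc[symmetric])
qed

subsection \<open>Measurability of functions with values in compact sets\<close>

lemma borel_measurable_finite_range:
  fixes f :: "'b \<Rightarrow> 'c::topological_space"
  assumes "finite D" "\<And>x. x \<in> space M \<Longrightarrow> f x \<in> D" "\<And>y. y \<in> D \<Longrightarrow> {x \<in> space M. f x = y} \<in> sets M"
  shows "f \<in> borel_measurable M"
proof -
  have "f \<in> measurable M (count_space D)"
  proof (rule measurableI)
    fix A assume "A \<in> sets (count_space D)"
    then have A: "A \<subseteq> D" by simp
    have "f -` A \<inter> space M = (\<Union>y\<in>A. {x \<in> space M. f x = y})" by auto
    also have "\<dots> \<in> sets M"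
      using A assms(1,3) by (intro sets.finite_UN) (auto intro: finite_subset)
    finally show "f -` A \<inter> space M \<in> sets M" .
  qed (use assms(2) in auto)
  moreover have "(\<lambda>x. x) \<in> measurable (count_space D) borel" by simp
  ultimately show ?thesis using measurable_compose by blast
qed

text \<open>Compactness yields a finite net. Each value is replaced by the first point of the net,
  in the order of a list, at distance less than e; fixing the order makes the choice
  measurable.\<close>

lemma compact_finite_valued_approx:
  fixes f :: "'b \<Rightarrow> 'c::metric_space"
  assumes K: "compact K" and f: "f \<in> borel_measurable M" and fK: "\<And>x. x \<in> space M \<Longrightarrow> f x \<in> K"
    and e: "e > 0"
  obtains D h where "finite D" "\<And>x. x \<in> space M \<Longrightarrow> h x \<in> D"
    "\<And>x. x \<in> space M \<Longrightarrow> dist (h x) (f x) < e" "\<And>y. {x \<in> space M. h x = y} \<in> sets M"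
proof -
  obtain k where k: "finite k" "K \<subseteq> (\<Union>x\<in>k. ball x e)"
    using K e unfolding compact_eq_totally_bounded by blast
  obtain xs where xs: "set xs = k" using finite_list[OF k(1)] by blast
  have [measurable]: "f \<in> borel_measurable M" by (rule f)
  have b: "{x \<in> space M. dist y (f x) < e} \<in> sets M" for y
  proof -
    have "{x \<in> space M. dist y (f x) < e} = f -` ball y e \<inter> space M" by auto
    then show ?thesis using measurable_sets[OF f] by simp
  qed
  define h where "h x = (case find (\<lambda>y. dist y (f x) < e) xs of Some y \<Rightarrow> y | None \<Rightarrow> undefined)" for x
  have ex: "\<exists>y. find (\<lambda>y. dist y (f x) < e) xs = Some y \<and> y \<in> k \<and> dist y (f x) < e" if x: "x \<in> space M" for x
  proof -
    have "\<exists>y\<in>set xs. dist y (f x) < e" using fK[OF x] k(2) xs by (auto simp: subset_iff)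
    then have "find (\<lambda>y. dist y (f x) < e) xs \<noteq> None" by (auto simp: find_None_iff)
    then obtain y where y: "find (\<lambda>y. dist y (f x) < e) xs = Some y" by auto
    then show ?thesis using xs by (metis find_Some_iff nth_mem)
  qed
  \<comment> \<open>Whether \<open>find\<close> stops at the head depends on a single ball, so
    induction on the list writes the event as a Boolean combination of preimages of balls.\<close>
  have m: "{x \<in> space M. find (\<lambda>y. dist y (f x) < e) ys = Some z} \<in> sets M" for ys z
  proof (induction ys)
    case (Cons a ys)
    have "{x \<in> space M. find (\<lambda>y. dist y (f x) < e) (a # ys) = Some z} =
       ({x \<in> space M. dist a (f x) < e} \<inter> {x \<in> space M. a = z}) \<union>
       ((space M - {x \<in> space M. dist a (f x) < e}) \<inter> {x \<in> space M. find (\<lambda>y. dist y (f x) < e) ys = Some z})"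
      by auto
    also have "\<dots> \<in> sets M" using Cons b by (intro sets.Un sets.Int sets.Diff) auto
    finally show ?case .
  qed simp
  show ?thesis
  proof (rule that)
    show "h x \<in> k" "dist (h x) (f x) < e" if "x \<in> space M" for x
      using ex[OF that] by (auto simp: h_def)
    show "{x \<in> space M. h x = y} \<in> sets M" for y
    proof -
      have "h x = y \<longleftrightarrow> find (\<lambda>y. dist y (f x) < e) xs = Some y" if "x \<in> space M" for x
        using ex[OF that] by (auto simp: h_def)
      then have "{x \<in> space M. h x = y} = {x \<in> space M. find (\<lambda>y. dist y (f x) < e) xs = Some y}"
        by blast
      then show ?thesis using m by simp
    qed
  qed (use k in auto)
qed

text \<open>The type of the values need not be second countable, so the Borel sets of a product need not be
  generated by rectangles; finite-valued approximations avoid this problem on compact sets.\<close>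

lemma borel_measurable_Pair_compact:
  fixes f :: "'b \<Rightarrow> 'c::metric_space" and g :: "'b \<Rightarrow> 'e::metric_space"
  assumes K: "compact K" and f: "f \<in> borel_measurable M" and fK: "\<And>x. x \<in> space M \<Longrightarrow> f x \<in> K"
    and L: "compact L" and g: "g \<in> borel_measurable M" and gL: "\<And>x. x \<in> space M \<Longrightarrow> g x \<in> L"
  shows "(\<lambda>x. (f x, g x)) \<in> borel_measurable M"
proof -
  have "\<exists>h. h \<in> borel_measurable M \<and> (\<forall>x\<in>space M. dist (h x) (f x, g x) < inverse (Suc n))" for n :: nat
  proof -
    define e where "e = inverse (Suc n) / 2"
    have e: "e > 0" by (simp add: e_def)
    obtain D p where p: "finite D" "\<And>x. x \<in> space M \<Longrightarrow> p x \<in> D"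
      "\<And>x. x \<in> space M \<Longrightarrow> dist (p x) (f x) < e" "\<And>y. {x \<in> space M. p x = y} \<in> sets M"
      using compact_finite_valued_approx[OF K f fK e] by blast
    obtain E q where q: "finite E" "\<And>x. x \<in> space M \<Longrightarrow> q x \<in> E"
      "\<And>x. x \<in> space M \<Longrightarrow> dist (q x) (g x) < e" "\<And>y. {x \<in> space M. q x = y} \<in> sets M"
      using compact_finite_valued_approx[OF L g gL e] by blast
    have "(\<lambda>x. (p x, q x)) \<in> borel_measurable M"
    proof (rule borel_measurable_finite_range)
      show "finite (D \<times> E)" using p q by simp
      show "{x \<in> space M. (p x, q x) = y} \<in> sets M" for y
      proof -
        have "{x \<in> space M. (p x, q x) = y} = {x \<in> space M. p x = fst y} \<inter> {x \<in> space M. q x = snd y}" by auto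
        then show ?thesis using p(4) q(4) by auto
      qed
    qed (use p q in auto)
    moreover have "dist (p x, q x) (f x, g x) < inverse (Suc n)" if "x \<in> space M" for x
    proof -
      have "dist (p x, q x) (f x, g x) \<le> dist (p x) (f x) + dist (q x) (g x)"
        unfolding dist_prod_def by (rule order_trans[OF sqrt_sum_squares_le_sum_abs]) auto
      also have "\<dots> < e + e" using p(3)[OF that] q(3)[OF that] by linarith
      finally show ?thesis by (simp add: e_def)
    qed
    ultimately show ?thesis by (intro exI[of _ "\<lambda>x. (p x, q x)"]) auto
  qed
  then have "\<forall>n. \<exists>h. h \<in> borel_measurable M \<and> (\<forall>x\<in>space M. dist (h x) (f x, g x) < inverse (Suc n))" by blast
  from choice[OF this] obtain h where h: "\<And>n. h n \<in> borel_measurable M"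
    "\<And>n x. x \<in> space M \<Longrightarrow> dist (h n x) (f x, g x) < inverse (Suc n)" by blast
  show ?thesis
  proof (rule borel_measurable_LIMSEQ_metric[OF h(1)])
    fix x assume x: "x \<in> space M"
    show "(\<lambda>n. h n x) \<longlonglongrightarrow> (f x, g x)"
      unfolding tendsto_dist_iff[of "\<lambda>n. h n x"]
      by (rule tendsto_sandwich[OF _ _ tendsto_const LIMSEQ_inverse_real_of_nat])
         (use h(2)[OF x] in \<open>auto intro!: always_eventually less_imp_le\<close>)
  qed
qed

lemma borel_measurable_vec_compact:
  fixes f :: "'d::finite \<Rightarrow> 'b \<Rightarrow> 'c::metric_space"
  assumes K: "compact K" and f: "\<And>i. f i \<in> borel_measurable M" and fK: "\<And>i x. x \<in> space M \<Longrightarrow> f i x \<in> K"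
  shows "(\<lambda>x. \<chi> i. f i x) \<in> borel_measurable M"
proof -
  have "\<exists>h. h \<in> borel_measurable M \<and> (\<forall>x\<in>space M. dist (h x) (\<chi> i. f i x) \<le> inverse (Suc n))" for n :: nat
  proof -
    \<comment> \<open>The distance of two vectors is at most the sum of the distances of their
      components.\<close>
    define e where "e = inverse (Suc n) / CARD('d)"
    have e: "e > 0" by (simp add: e_def)
    have "\<exists>p D. finite D \<and> (\<forall>x\<in>space M. p x \<in> D) \<and> (\<forall>x\<in>space M. dist (p x) (f i x) < e) \<and>
       (\<forall>y. {x \<in> space M. p x = y} \<in> sets M)" for i
    proof -
      obtain D p where "finite D" "\<And>x. x \<in> space M \<Longrightarrow> p x \<in> D"
        "\<And>x. x \<in> space M \<Longrightarrow> dist (p x) (f i x) < e" "\<And>y. {x \<in> space M. p x = y} \<in> sets M"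
        using compact_finite_valued_approx[OF K f[of i] fK e] by blast
      then show ?thesis by (intro exI[of _ p] exI[of _ D]) auto
    qed
    then have "\<forall>i. \<exists>p D. finite D \<and> (\<forall>x\<in>space M. p x \<in> D) \<and> (\<forall>x\<in>space M. dist (p x) (f i x) < e) \<and>
       (\<forall>y. {x \<in> space M. p x = y} \<in> sets M)" by blast
    from choice[OF this] obtain p where "\<forall>i. \<exists>D. finite D \<and> (\<forall>x\<in>space M. p i x \<in> D) \<and> (\<forall>x\<in>space M. dist (p i x) (f i x) < e) \<and>
       (\<forall>y. {x \<in> space M. p i x = y} \<in> sets M)" by blast
    from choice[OF this] obtain D where p: "\<And>i. finite (D i)" "\<And>i x. x \<in> space M \<Longrightarrow> p i x \<in> D i"
      "\<And>i x. x \<in> space M \<Longrightarrow> dist (p i x) (f i x) < e" "\<And>i y. {x \<in> space M. p i x = y} \<in> sets M"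
      by blast
    have "(\<lambda>x. \<chi> i. p i x) \<in> borel_measurable M"
    proof (rule borel_measurable_finite_range)
      have "finite (Pi\<^sub>E UNIV D)" using p by (intro finite_PiE) auto
      then show "finite (vec_lambda ` (Pi\<^sub>E UNIV D))" by (rule finite_imageI)
      show "(\<chi> i. p i x) \<in> vec_lambda ` (Pi\<^sub>E UNIV D)" if "x \<in> space M" for x
        using p(2)[OF that] by (intro imageI) auto
      show "{x \<in> space M. (\<chi> i. p i x) = y} \<in> sets M" for y
      proof -
        have "{x \<in> space M. (\<chi> i. p i x) = y} = (\<Inter>i\<in>UNIV. {x \<in> space M. p i x = y $ i})"
          by (auto simp: vec_eq_iff)
        then show ?thesis using p(4) by (auto intro!: sets.finite_INT)
      qed
    qed
    moreover have "dist (\<chi> i. p i x) (\<chi> i. f i x) \<le> inverse (Suc n)" if "x \<in> space M" for x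
    proof -
      have "dist (\<chi> i. p i x) (\<chi> i. f i x) \<le> (\<Sum>i\<in>UNIV. dist (p i x) (f i x))"
        unfolding dist_vec_def by (rule order_trans[OF L2_set_le_sum]) auto
      also have "\<dots> \<le> (\<Sum>i\<in>(UNIV::'d set). e)"
        by (intro sum_mono less_imp_le p(3)[OF that])
      finally show ?thesis by (simp add: e_def)
    qed
    ultimately show ?thesis by (intro exI[of _ "\<lambda>x. \<chi> i. p i x"]) auto
  qed
  then have "\<forall>n. \<exists>h. h \<in> borel_measurable M \<and> (\<forall>x\<in>space M. dist (h x) (\<chi> i. f i x) \<le> inverse (Suc n))" by blast
  from choice[OF this] obtain h where h: "\<And>n. h n \<in> borel_measurable M"
    "\<And>n x. x \<in> space M \<Longrightarrow> dist (h n x) (\<chi> i. f i x) \<le> inverse (Suc n)" by blast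
  show ?thesis
  proof (rule borel_measurable_LIMSEQ_metric[OF h(1)])
    fix x assume x: "x \<in> space M"
    show "(\<lambda>n. h n x) \<longlonglongrightarrow> (\<chi> i. f i x)"
      unfolding tendsto_dist_iff[of "\<lambda>n. h n x"]
      by (rule tendsto_sandwich[OF _ _ tendsto_const LIMSEQ_inverse_real_of_nat])
         (use h(2)[OF x] in \<open>auto intro!: always_eventually\<close>)
  qed
qed

text \<open>Tychonoff's theorem for functions on the index type, carried over to vectors by the
  continuous map \<open>vec_lambda\<close>.\<close>

lemma compact_tuples:
  assumes "compact A"
  shows "compact (tuples A :: ('a::metric_space ^ 'd::finite) set)"
proof -
  have "compactin (product_topology (\<lambda>_. euclidean) (UNIV::'d set)) (Pi\<^sub>E UNIV (\<lambda>_. A))"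
    using assms by (simp add: compactin_PiE compactin_euclidean_iff)
  then have "compact (Pi\<^sub>E (UNIV::'d set) (\<lambda>_. A))"
    by (simp add: euclidean_product_topology compactin_euclidean_iff)
  moreover have "continuous_on (Pi\<^sub>E (UNIV::'d set) (\<lambda>_. A)) vec_lambda"
    by (intro continuous_on_vec_lambda continuous_on_subset[OF continuous_on_product_coordinates]) auto
  ultimately have "compact (vec_lambda ` (Pi\<^sub>E (UNIV::'d set) (\<lambda>_. A)))"
    by (rule compact_continuous_image[rotated])
  moreover have "vec_lambda ` (Pi\<^sub>E (UNIV::'d set) (\<lambda>_. A)) = tuples A"
  proof -
    have "x \<in> vec_lambda ` (Pi\<^sub>E (UNIV::'d set) (\<lambda>_. A))" if "x \<in> tuples A" for x
      using that by (intro image_eqI[where x="vec_nth x"]) (auto simp: tuples_def)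
    then show ?thesis by (auto simp: tuples_def)
  qed
  ultimately show ?thesis by simp
qed

lemma compact_prob_simplex: "compact (prob_simplex :: (real ^ 'd::finite) set)"
proof -
  have "closed (prob_simplex :: (real ^ 'd) set)"
    unfolding prob_simplex_def
    by (intro closed_Collect_conj closed_Collect_all closed_Collect_le closed_Collect_eq continuous_intros)
  moreover have "bounded (prob_simplex :: (real ^ 'd) set)"
    unfolding bounded_iff
  proof (intro exI ballI)
    fix m :: "real ^ 'd" assume m: "m \<in> prob_simplex"
    have "norm m \<le> (\<Sum>i\<in>UNIV. \<bar>m $ i\<bar>)" by (rule norm_le_l1_cart)
    also have "\<dots> = 1" using m by (auto simp: prob_simplex_def)
    finally show "norm m \<le> 1" .
  qed
  ultimately show ?thesis by (simp add: compact_eq_bounded_closed)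
qed

subsection \<open>Flows on the simplex\<close>

lemma set_borel_measurable_iff_restrict_space:
  fixes f :: "real \<Rightarrow> real"
  shows "set_borel_measurable lborel {a..b} f \<longleftrightarrow> f \<in> borel_measurable (restrict_space borel {a..b})"
  by (simp add: set_borel_measurable_def borel_measurable_restrict_space_iff)

lemma set_integrable_bounded_restrict:
  fixes f :: "real \<Rightarrow> real"
  assumes "f \<in> borel_measurable (restrict_space borel {a..b})" "\<And>x. x \<in> {a..b} \<Longrightarrow> \<bar>f x\<bar> \<le> B"
    "a \<le> c" "d \<le> b"
  shows "set_integrable lborel {c..d} f"
  using assms
  by (intro set_integrable_Icc_subset[OF set_integrable_bounded[of a b f B]])
     (auto simp: set_borel_measurable_iff_restrict_space)

lemma restrict_measurable_indefinite_integral: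
  fixes h :: "real \<Rightarrow> real"
  assumes "set_integrable lborel {t..T} h"
  shows "(\<lambda>s. LBINT u:{t..s}. h u) \<in> borel_measurable (restrict_space borel {t..T})"
proof -
  let ?h = "\<lambda>u. indicator {t..T} u * h u"
  have "integrable lborel ?h" using assms by (simp add: set_integrable_def)
  from borel_measurable_indefinite_integral[OF this]
  have "(\<lambda>s. LBINT u. indicator {..s} u * ?h u) \<in> borel_measurable (restrict_space borel {t..T})"
    by (intro measurable_restrict_space1) simp
  moreover have "(LBINT u:{t..s}. h u) = (LBINT u. indicator {..s} u * ?h u)" if "s \<in> {t..T}" for s
    unfolding set_lebesgue_integral_def using that
    by (intro Bochner_Integration.integral_cong) (auto simp: indicator_def)
  ultimately show ?thesis
    by (subst measurable_cong) (auto simp: space_restrict_space)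
qed

lemma measurable_restrict_Icc_later:
  fixes t T :: real
  assumes h: "h \<in> measurable (restrict_space borel {0..T}) N" and t: "t \<in> {0..T}"
  shows "h \<in> measurable (restrict_space borel {t..T}) N"
proof -
  have "h \<in> measurable (restrict_space (restrict_space borel {0..T}) {t..T}) N"
    by (rule measurable_restrict_space1[OF h])
  also have "restrict_space (restrict_space borel {0..T}) {t..T} = restrict_space borel ({0..T} \<inter> {t..T})"
    by (rule restrict_restrict_space) auto
  also have "{0..T} \<inter> {t..T} = {t..T}" using t by auto
  finally show ?thesis .
qed

text \<open>Functions on an arbitrary index set, so that one existence theorem serves both for laws
  on the grid of states and, with the components as indices, for points of
  \<open>prob_simplex\<close>. Values outside S are arbitrary.\<close>

definition prob_vectors :: "'s set \<Rightarrow> ('s \<Rightarrow> real) set" where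
  "prob_vectors S = {m. (\<forall>y\<in>S. 0 \<le> m y) \<and> (\<Sum>y\<in>S. m y) = 1}"

lemma prob_vectors_le_1:
  assumes "finite S" "m \<in> prob_vectors S" "y \<in> S"
  shows "m y \<le> 1"
  using assms member_le_sum[of y S m] by (auto simp: prob_vectors_def)

text \<open>The bound \<open>b u m y \<ge> - k * m y\<close> makes \<open>k * m y + b u m y\<close> nonnegative, so that the Picard
  map of the mild formulation below preserves the simplex, outside of which \<open>b\<close> is not controlled.\<close>

locale simplex_flow =
  fixes S :: "'s set" and t T :: real and x0 :: "'s \<Rightarrow> real"
    and b :: "real \<Rightarrow> ('s \<Rightarrow> real) \<Rightarrow> 's \<Rightarrow> real" and k L :: real
  assumes finite_S: "finite S" and tT: "t \<le> T" and x0: "x0 \<in> prob_vectors S"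
    and k: "k > 0" and L: "L \<ge> 0"
    and sum_b: "\<And>u m. u \<in> {t..T} \<Longrightarrow> m \<in> prob_vectors S \<Longrightarrow> (\<Sum>y\<in>S. b u m y) = 0"
    and b_ge: "\<And>u m y. u \<in> {t..T} \<Longrightarrow> m \<in> prob_vectors S \<Longrightarrow> y \<in> S \<Longrightarrow> - k * m y \<le> b u m y"
    and b_lip: "\<And>u m m'. u \<in> {t..T} \<Longrightarrow> m \<in> prob_vectors S \<Longrightarrow> m' \<in> prob_vectors S \<Longrightarrow>
      (\<Sum>y\<in>S. \<bar>b u m y - b u m' y\<bar>) \<le> L * (\<Sum>y\<in>S. \<bar>m y - m' y\<bar>)"
    and b_meas: "\<And>\<mu> y. (\<And>z. z \<in> S \<Longrightarrow> (\<lambda>u. \<mu> u z) \<in> borel_measurable (restrict_space borel {t..T})) \<Longrightarrow>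
      (\<And>u. u \<in> {t..T} \<Longrightarrow> \<mu> u \<in> prob_vectors S) \<Longrightarrow> y \<in> S \<Longrightarrow>
      (\<lambda>u. b u (\<mu> u) y) \<in> borel_measurable (restrict_space borel {t..T})"
begin

definition curve :: "(real \<Rightarrow> 's \<Rightarrow> real) \<Rightarrow> bool" where
  "curve \<mu> \<longleftrightarrow> (\<forall>z\<in>S. (\<lambda>u. \<mu> u z) \<in> borel_measurable (restrict_space borel {t..T})) \<and>
     (\<forall>u\<in>{t..T}. \<mu> u \<in> prob_vectors S)"

text \<open>Along a solution this is the derivative of \<open>exp (k * (u - t)) * \<mu> u y\<close>.
  The integrating factor compensates the possible loss of mass and leaves a nonnegative
  integrand.\<close>

definition mild :: "(real \<Rightarrow> 's \<Rightarrow> real) \<Rightarrow> 's \<Rightarrow> real \<Rightarrow> real" where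
  "mild \<mu> y u = exp (k * (u - t)) * (k * \<mu> u y + b u (\<mu> u) y)"

definition picard :: "(real \<Rightarrow> 's \<Rightarrow> real) \<Rightarrow> real \<Rightarrow> 's \<Rightarrow> real" where
  "picard \<mu> s y = exp ((- k) * (s - t)) * (x0 y + (LBINT u:{t..s}. mild \<mu> y u))"

lemma mild_nonneg:
  assumes "curve \<mu>" "u \<in> {t..T}" "y \<in> S"
  shows "0 \<le> mild \<mu> y u"
proof -
  have "- k * \<mu> u y \<le> b u (\<mu> u) y" using assms b_ge by (auto simp: curve_def)
  then show ?thesis by (simp add: mild_def)
qed

lemma sum_mild:
  assumes "curve \<mu>" "u \<in> {t..T}"
  shows "(\<Sum>y\<in>S. mild \<mu> y u) = k * exp (k * (u - t))"
proof -
  have m: "\<mu> u \<in> prob_vectors S" using assms by (auto simp: curve_def)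
  have "(\<Sum>y\<in>S. mild \<mu> y u) = exp (k * (u - t)) * (k * (\<Sum>y\<in>S. \<mu> u y) + (\<Sum>y\<in>S. b u (\<mu> u) y))"
    by (simp add: mild_def sum_distrib_left sum.distrib distrib_left)
  then show ?thesis using m sum_b[OF assms(2) m] by (simp add: prob_vectors_def)
qed

lemma mild_le:
  assumes "curve \<mu>" "u \<in> {t..T}" "y \<in> S"
  shows "mild \<mu> y u \<le> k * exp (k * (u - t))"
  using member_le_sum[of y S "\<lambda>y. mild \<mu> y u"] mild_nonneg[OF assms(1,2)] sum_mild[OF assms(1,2)]
    finite_S assms(3) by auto

lemma mild_measurable:
  assumes "curve \<mu>" "y \<in> S"
  shows "mild \<mu> y \<in> borel_measurable (restrict_space borel {t..T})"
proof -
  have [measurable]: "(\<lambda>u. \<mu> u y) \<in> borel_measurable (restrict_space borel {t..T})"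
    using assms by (auto simp: curve_def)
  have [measurable]: "(\<lambda>u. b u (\<mu> u) y) \<in> borel_measurable (restrict_space borel {t..T})"
    using assms by (intro b_meas) (auto simp: curve_def)
  have [measurable]: "(\<lambda>u. exp (k * (u - t))) \<in> borel_measurable (restrict_space borel {t..T})"
    by (intro measurable_restrict_space1) measurable
  show ?thesis unfolding mild_def[abs_def] by measurable
qed

lemma mild_integrable:
  assumes "curve \<mu>" "y \<in> S" "s \<le> T"
  shows "set_integrable lborel {t..s} (mild \<mu> y)"
proof (rule set_integrable_bounded_restrict[OF mild_measurable[OF assms(1,2)]])
  fix u assume u: "u \<in> {t..T}"
  have "mild \<mu> y u \<le> k * exp (k * (u - t))" by (rule mild_le[OF assms(1) u assms(2)])
  also have "\<dots> \<le> k * exp (k * (T - t))" using u k by auto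
  finally show "\<bar>mild \<mu> y u\<bar> \<le> k * exp (k * (T - t))" using mild_nonneg[OF assms(1) u assms(2)] by simp
qed (use assms in auto)

text \<open>Nonnegativity is inherited from \<open>mild_nonneg\<close>. The mass is exactly one
  because the integrands sum to the derivative of exp (k (u - t)), and the prefactor of
  \<open>picard\<close> cancels the resulting exponential.\<close>

lemma curve_picard:
  assumes c: "curve \<mu>"
  shows "curve (picard \<mu>)"
  unfolding curve_def
proof safe
  fix z assume z: "z \<in> S"
  have [measurable]: "(\<lambda>s. LBINT u:{t..s}. mild \<mu> z u) \<in> borel_measurable (restrict_space borel {t..T})"
    by (rule restrict_measurable_indefinite_integral[OF mild_integrable[OF c z order_refl]])
  have [measurable]: "(\<lambda>u. exp ((- k) * (u - t))) \<in> borel_measurable (restrict_space borel {t..T})"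
    by (intro measurable_restrict_space1) measurable
  show "(\<lambda>u. picard \<mu> u z) \<in> borel_measurable (restrict_space borel {t..T})"
    unfolding picard_def by measurable
next
  fix s assume s: "s \<in> {t..T}"
  have nn: "0 \<le> (LBINT u:{t..s}. mild \<mu> y u)" if "y \<in> S" for y
    unfolding set_lebesgue_integral_def
    using mild_nonneg[OF c _ that] s
    by (intro Bochner_Integration.integral_nonneg) (auto simp: indicator_def)
  have "(\<Sum>y\<in>S. LBINT u:{t..s}. mild \<mu> y u) = (LBINT u:{t..s}. \<Sum>y\<in>S. mild \<mu> y u)"
    unfolding set_lebesgue_integral_def scaleR_sum_right
    using mild_integrable[OF c] s
    by (intro Bochner_Integration.integral_sum[symmetric]) (auto simp: set_integrable_def)
  also have "\<dots> = (LBINT u:{t..s}. k * exp (k * (u - t)))"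
    using sum_mild[OF c] s by (intro set_lebesgue_integral_cong) auto
  finally have "(\<Sum>y\<in>S. x0 y + (LBINT u:{t..s}. mild \<mu> y u)) = exp (k * (s - t))"
    using exp_eq_set_integral(2)[of t s k] s x0 by (simp add: sum.distrib prob_vectors_def)
  then have "(\<Sum>y\<in>S. picard \<mu> s y) = exp ((- k) * (s - t)) * exp (k * (s - t))"
    by (simp add: picard_def flip: sum_distrib_left)
  also have "\<dots> = 1" by (simp flip: exp_add)
  finally show "picard \<mu> s \<in> prob_vectors S"
    using nn x0 by (auto simp: prob_vectors_def picard_def)
qed

text \<open>In the constant k + L, the k stems from the integrating factor and the L from
  \<open>b_lip\<close>; the two exponentials combine to a factor at most one. The integrated form is
  used for the convergence of the iteration and again to identify its limit.\<close>

lemma picard_diff_le: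
  assumes c: "curve \<mu>" and d: "curve \<nu>" and s: "s \<in> {t..T}"
  shows "set_integrable lborel {t..s} (\<lambda>u. \<Sum>y\<in>S. \<bar>\<mu> u y - \<nu> u y\<bar>)"
    and "(\<Sum>y\<in>S. \<bar>picard \<mu> s y - picard \<nu> s y\<bar>) \<le> (k + L) * (LBINT u:{t..s}. \<Sum>y\<in>S. \<bar>\<mu> u y - \<nu> u y\<bar>)"
proof -
  have diff_le_1: "\<bar>\<mu> u y - \<nu> u y\<bar> \<le> 1" if "u \<in> {t..T}" "y \<in> S" for u y
  proof -
    have "\<mu> u \<in> prob_vectors S" "\<nu> u \<in> prob_vectors S" using c d that by (auto simp: curve_def)
    then have "0 \<le> \<mu> u y" "\<mu> u y \<le> 1" "0 \<le> \<nu> u y" "\<nu> u y \<le> 1"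
      using prob_vectors_le_1[OF finite_S _ that(2)] that(2) by (auto simp: prob_vectors_def)
    then show ?thesis by linarith
  qed
  show I: "set_integrable lborel {t..s} (\<lambda>u. \<Sum>y\<in>S. \<bar>\<mu> u y - \<nu> u y\<bar>)"
  proof (rule set_integrable_bounded_restrict[where a=t and b=T and B="\<Sum>y\<in>S. 1"])
    show "(\<lambda>u. \<Sum>y\<in>S. \<bar>\<mu> u y - \<nu> u y\<bar>) \<in> borel_measurable (restrict_space borel {t..T})"
      using c d by (intro borel_measurable_sum borel_measurable_abs borel_measurable_diff) (auto simp: curve_def)
    show "\<bar>\<Sum>y\<in>S. \<bar>\<mu> u y - \<nu> u y\<bar>\<bar> \<le> (\<Sum>y\<in>S. 1)" if "u \<in> {t..T}" for u
    proof -
      have "\<bar>\<Sum>y\<in>S. \<bar>\<mu> u y - \<nu> u y\<bar>\<bar> = (\<Sum>y\<in>S. \<bar>\<mu> u y - \<nu> u y\<bar>)" by (simp add: sum_nonneg)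
      also have "\<dots> \<le> (\<Sum>y\<in>S. 1)" by (rule sum_mono[OF diff_le_1[OF that]])
      finally show ?thesis .
    qed
  qed (use s in auto)
  have im: "set_integrable lborel {t..s} (mild \<mu> y)" "set_integrable lborel {t..s} (mild \<nu> y)" if "y \<in> S" for y
    using mild_integrable[OF c that] mild_integrable[OF d that] s by auto
  let ?D = "\<lambda>y u. exp ((- k) * (s - t)) * \<bar>mild \<mu> y u - mild \<nu> y u\<bar>"
  have iD: "set_integrable lborel {t..s} (?D y)" if "y \<in> S" for y
    by (intro set_integrable_mult_right set_integrable_abs set_integral_diff(1) im that)
  have "(\<Sum>y\<in>S. \<bar>picard \<mu> s y - picard \<nu> s y\<bar>) \<le> (\<Sum>y\<in>S. LBINT u:{t..s}. ?D y u)"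
  proof (rule sum_mono)
    fix y assume y: "y \<in> S"
    have "picard \<mu> s y - picard \<nu> s y = exp ((- k) * (s - t)) * (LBINT u:{t..s}. mild \<mu> y u - mild \<nu> y u)"
      by (simp add: set_integral_diff(2)[OF im[OF y]] picard_def right_diff_distrib distrib_left)
    then have "\<bar>picard \<mu> s y - picard \<nu> s y\<bar> = exp ((- k) * (s - t)) * \<bar>LBINT u:{t..s}. mild \<mu> y u - mild \<nu> y u\<bar>"
      by (simp add: abs_mult)
    also have "\<dots> \<le> exp ((- k) * (s - t)) * (LBINT u:{t..s}. \<bar>mild \<mu> y u - mild \<nu> y u\<bar>)"
      using set_integral_norm_bound[OF set_integral_diff(1)[OF im[OF y]]] by (intro mult_left_mono) auto
    finally show "\<bar>picard \<mu> s y - picard \<nu> s y\<bar> \<le> (LBINT u:{t..s}. ?D y u)" by simp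
  qed
  also have "\<dots> = (LBINT u:{t..s}. \<Sum>y\<in>S. ?D y u)"
    unfolding set_lebesgue_integral_def scaleR_sum_right
    using iD by (intro Bochner_Integration.integral_sum[symmetric]) (auto simp: set_integrable_def)
  also have "\<dots> \<le> (LBINT u:{t..s}. (k + L) * (\<Sum>y\<in>S. \<bar>\<mu> u y - \<nu> u y\<bar>))"
  proof (rule set_integral_mono)
    show "set_integrable lborel {t..s} (\<lambda>u. \<Sum>y\<in>S. ?D y u)"
      unfolding set_integrable_def scaleR_sum_right
      using iD by (intro Bochner_Integration.integrable_sum) (auto simp: set_integrable_def)
    show "set_integrable lborel {t..s} (\<lambda>u. (k + L) * (\<Sum>y\<in>S. \<bar>\<mu> u y - \<nu> u y\<bar>))"
      by (intro set_integrable_mult_right I)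
    fix u assume u: "u \<in> {t..s}"
    then have u': "u \<in> {t..T}" using s by auto
    have e: "exp ((- k) * (s - t)) * exp (k * (u - t)) \<le> 1"
      using u k by (simp add: flip: exp_add)
    have "?D y u = exp ((- k) * (s - t)) * exp (k * (u - t)) *
        \<bar>k * (\<mu> u y - \<nu> u y) + (b u (\<mu> u) y - b u (\<nu> u) y)\<bar>" for y
    proof -
      have "mild \<mu> y u - mild \<nu> y u = exp (k * (u - t)) * (k * (\<mu> u y - \<nu> u y) + (b u (\<mu> u) y - b u (\<nu> u) y))"
        by (simp add: mild_def algebra_simps)
      then show ?thesis by (simp add: abs_mult)
    qed
    also have "\<dots> y \<le> \<bar>k * (\<mu> u y - \<nu> u y) + (b u (\<mu> u) y - b u (\<nu> u) y)\<bar>" for y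
      using mult_right_mono[OF e, of "\<bar>k * (\<mu> u y - \<nu> u y) + (b u (\<mu> u) y - b u (\<nu> u) y)\<bar>"] by simp
    also have "\<dots> y \<le> \<bar>k * (\<mu> u y - \<nu> u y)\<bar> + \<bar>b u (\<mu> u) y - b u (\<nu> u) y\<bar>" for y
      by (rule abs_triangle_ineq)
    also have "\<dots> y = k * \<bar>\<mu> u y - \<nu> u y\<bar> + \<bar>b u (\<mu> u) y - b u (\<nu> u) y\<bar>" for y
      using k by (simp add: abs_mult)
    finally have "(\<Sum>y\<in>S. ?D y u) \<le> (\<Sum>y\<in>S. k * \<bar>\<mu> u y - \<nu> u y\<bar> + \<bar>b u (\<mu> u) y - b u (\<nu> u) y\<bar>)"
      by (intro sum_mono) auto
    also have "\<dots> = k * (\<Sum>y\<in>S. \<bar>\<mu> u y - \<nu> u y\<bar>) + (\<Sum>y\<in>S. \<bar>b u (\<mu> u) y - b u (\<nu> u) y\<bar>)"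
      by (simp add: sum.distrib sum_distrib_left)
    also have "\<dots> \<le> (k + L) * (\<Sum>y\<in>S. \<bar>\<mu> u y - \<nu> u y\<bar>)"
      using b_lip[OF u', of "\<mu> u" "\<nu> u"] c d u' by (auto simp: curve_def algebra_simps)
    finally show "(\<Sum>y\<in>S. ?D y u) \<le> (k + L) * (\<Sum>y\<in>S. \<bar>\<mu> u y - \<nu> u y\<bar>)" .
  qed
  finally show "(\<Sum>y\<in>S. \<bar>picard \<mu> s y - picard \<nu> s y\<bar>) \<le> (k + L) * (LBINT u:{t..s}. \<Sum>y\<in>S. \<bar>\<mu> u y - \<nu> u y\<bar>)"
    by simp
qed

section \<open>Picard iteration and its limit\<close>

primrec iter :: "nat \<Rightarrow> real \<Rightarrow> 's \<Rightarrow> real" where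
  "iter 0 = (\<lambda>_. x0)"
| "iter (Suc n) = picard (iter n)"

lemma curve_iter: "curve (iter n)"
proof (induction n)
  case 0
  show ?case using x0 by (simp add: curve_def)
next
  case (Suc n)
  then show ?case by (simp add: curve_picard)
qed

lemma sum_abs_diff_le_2:
  assumes "m \<in> prob_vectors S" "m' \<in> prob_vectors S"
  shows "(\<Sum>y\<in>S. \<bar>m y - m' y\<bar>) \<le> 2"
proof -
  have "(\<Sum>y\<in>S. \<bar>m y - m' y\<bar>) \<le> (\<Sum>y\<in>S. m y + m' y)"
  proof (rule sum_mono)
    fix y assume "y \<in> S"
    then have "0 \<le> m y" "0 \<le> m' y" using assms by (auto simp: prob_vectors_def)
    then show "\<bar>m y - m' y\<bar> \<le> m y + m' y" by linarith
  qed
  then show ?thesis using assms by (simp add: sum.distrib prob_vectors_def)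
qed

text \<open>A Picard step halves the distance in the supremum norm weighted by exp (-2 (k + L) (s -
  t)): integrating the exponential produces 1 / (2 (k + L)), against the factor k + L of
  \<open>picard_diff_le\<close>. The initial 2 is the l1 bound of
  \<open>sum_abs_diff_le_2\<close>.\<close>

lemma iter_diff_le:
  assumes "s \<in> {t..T}"
  shows "(\<Sum>y\<in>S. \<bar>iter (Suc n) s y - iter n s y\<bar>) \<le> 2 * (1/2)^n * exp (2 * (k + L) * (s - t))"
  using assms
proof (induction n arbitrary: s)
  case 0
  have "(\<Sum>y\<in>S. \<bar>iter (Suc 0) s y - iter 0 s y\<bar>) \<le> 2"
    using curve_iter[of "Suc 0"] curve_iter[of 0] 0
    by (intro sum_abs_diff_le_2) (auto simp: curve_def simp del: iter.simps)
  also have "\<dots> \<le> 2 * (1/2)^0 * exp (2 * (k + L) * (s - t))" using 0 k L by simp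
  finally show ?case .
next
  case (Suc n)
  let ?K = "2 * (k + L)"
  have K: "?K > 0" using k L by simp
  note P = picard_diff_le[OF curve_iter[of "Suc n"] curve_iter[of n] Suc.prems]
  have e: "set_integrable lborel {t..s} (\<lambda>u. ?K * exp (?K * (u - t)))"
    using exp_eq_set_integral(1)[of t s ?K] Suc.prems by simp
  have "(\<Sum>y\<in>S. \<bar>iter (Suc (Suc n)) s y - iter (Suc n) s y\<bar>)
      \<le> (k + L) * (LBINT u:{t..s}. \<Sum>y\<in>S. \<bar>iter (Suc n) u y - iter n u y\<bar>)"
    using P(2) by simp
  also have "(LBINT u:{t..s}. \<Sum>y\<in>S. \<bar>iter (Suc n) u y - iter n u y\<bar>)
      \<le> (LBINT u:{t..s}. (2 * (1/2)^n / ?K) * (?K * exp (?K * (u - t))))"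
  proof (rule set_integral_mono[OF P(1) set_integrable_mult_right[OF e]])
    fix u assume "u \<in> {t..s}"
    then have "u \<in> {t..T}" using Suc.prems by auto
    from Suc.IH[OF this] show "(\<Sum>y\<in>S. \<bar>iter (Suc n) u y - iter n u y\<bar>) \<le> (2 * (1/2)^n / ?K) * (?K * exp (?K * (u - t)))"
      using K by (simp add: mult.assoc del: iter.simps)
  qed
  also have "(LBINT u:{t..s}. (2 * (1/2)^n / ?K) * (?K * exp (?K * (u - t)))) = (2 * (1/2)^n / ?K) * (exp (?K * (s - t)) - 1)"
    using exp_eq_set_integral(2)[of t s ?K] Suc.prems by (simp only: set_integral_mult_right) simp
  also have "(k + L) * \<dots> = ((k + L) / (k + L)) * ((1/2)^n * (exp (?K * (s - t)) - 1))"
  proof -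
    have "c * (2 * x / (2 * c) * z) = (c / c) * (x * z)" for c x z :: real by simp
    then show ?thesis .
  qed
  also have "\<dots> = (1/2)^n * (exp (?K * (s - t)) - 1)" using K by simp
  also have "\<dots> \<le> 2 * (1/2)^(Suc n) * exp (?K * (s - t))" by (simp add: field_simps)
  finally show ?case using K by (simp add: mult_left_mono)
qed

lemma iter_convergent:
  assumes s: "s \<in> {t..T}" and y: "y \<in> S"
  shows "convergent (\<lambda>n. iter n s y)"
proof -
  have "summable (\<lambda>n. iter (Suc n) s y - iter n s y)"
  proof (rule summable_comparison_test')
    show "summable (\<lambda>n. 2 * (1/2)^n * exp (2 * (k + L) * (s - t)))"
      by (intro summable_mult summable_mult2 summable_geometric) auto
    show "norm (iter (Suc n) s y - iter n s y) \<le> 2 * (1/2)^n * exp (2 * (k + L) * (s - t))" for n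
      using iter_diff_le[OF s, of n] member_le_sum[of y S "\<lambda>y. \<bar>iter (Suc n) s y - iter n s y\<bar>"] y finite_S
      by (auto simp del: iter.simps)
  qed
  then have "convergent (\<lambda>n. \<Sum>i<n. iter (Suc i) s y - iter i s y)"
    by (simp add: summable_iff_convergent)
  then have "convergent (\<lambda>n. iter n s y - iter 0 s y)"
    by (simp only: sum_lessThan_telescope[of "\<lambda>n. iter n s y"])
  then have "convergent (\<lambda>n. (iter n s y - iter 0 s y) + iter 0 s y)"
    by (intro convergent_add convergent_const)
  then show ?thesis by simp
qed

definition flow :: "real \<Rightarrow> 's \<Rightarrow> real" where
  "flow s y = lim (\<lambda>n. iter n s y)"

lemma iter_LIMSEQ: "s \<in> {t..T} \<Longrightarrow> y \<in> S \<Longrightarrow> (\<lambda>n. iter n s y) \<longlonglongrightarrow> flow s y"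
  unfolding flow_def by (simp add: convergent_LIMSEQ_iff[symmetric] iter_convergent)

lemma curve_flow: "curve flow"
  unfolding curve_def
proof safe
  fix z assume z: "z \<in> S"
  show "(\<lambda>u. flow u z) \<in> borel_measurable (restrict_space borel {t..T})"
  proof (rule borel_measurable_LIMSEQ_real[where u="\<lambda>n u. iter n u z"])
    show "(\<lambda>u. iter n u z) \<in> borel_measurable (restrict_space borel {t..T})" for n
      using curve_iter[of n] z by (simp add: curve_def)
  qed (use iter_LIMSEQ z in \<open>auto simp: space_restrict_space\<close>)
next
  fix s assume s: "s \<in> {t..T}"
  have p: "\<And>n. iter n s \<in> prob_vectors S" using curve_iter s by (simp add: curve_def)
  have "0 \<le> flow s y" if "y \<in> S" for y
    using p that by (intro LIMSEQ_le_const[OF iter_LIMSEQ[OF s that]]) (auto simp: prob_vectors_def)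
  moreover have "(\<lambda>n. \<Sum>y\<in>S. iter n s y) \<longlonglongrightarrow> (\<Sum>y\<in>S. flow s y)"
    by (intro tendsto_sum iter_LIMSEQ s)
  then have "(\<Sum>y\<in>S. flow s y) = 1"
    using p LIMSEQ_unique[OF _ tendsto_const] by (auto simp: prob_vectors_def)
  ultimately show "flow s \<in> prob_vectors S" by (simp add: prob_vectors_def)
qed

text \<open>Dominated convergence, with the bound 2 for the l1 distance, makes the right-hand side
  of \<open>picard_diff_le\<close> tend to zero. So the Picard images of the iterates converge to
  the image of the limit, and also to the limit itself.\<close>

lemma picard_flow:
  assumes s: "s \<in> {t..T}" and y: "y \<in> S"
  shows "picard flow s y = flow s y"
proof -
  let ?D = "\<lambda>n u. \<Sum>y\<in>S. \<bar>iter n u y - flow u y\<bar>"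
  note I = picard_diff_le[OF curve_iter curve_flow s]
  have "(\<lambda>n. LBINT u. indicator {t..s} u *\<^sub>R ?D n u) \<longlonglongrightarrow> (LBINT (u::real). 0)"
  proof (rule integral_dominated_convergence[where w="\<lambda>u. indicator {t..s} u * 2"])
    show "(\<lambda>u. indicator {t..s} u *\<^sub>R ?D n u) \<in> borel_measurable lborel" for n
      using I(1)[of n] by (auto simp: set_integrable_def)
    show "integrable lborel (\<lambda>u. indicator {t..s} u * 2 :: real)"
      using emeasure_lborel_Icc_eq[of t s] by (intro integrable_mult_left integrable_real_indicator) auto
    show "AE u in lborel. (\<lambda>n. indicator {t..s} u *\<^sub>R ?D n u) \<longlonglongrightarrow> 0"
    proof (rule AE_I2)
      fix u :: real
      show "(\<lambda>n. indicator {t..s} u *\<^sub>R ?D n u) \<longlonglongrightarrow> 0"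
      proof (cases "u \<in> {t..s}")
        case True
        then have "u \<in> {t..T}" using s by auto
        then have "(\<lambda>n. ?D n u) \<longlonglongrightarrow> (\<Sum>y\<in>S. \<bar>flow u y - flow u y\<bar>)"
          by (intro tendsto_intros iter_LIMSEQ)
        with True show ?thesis by simp
      qed simp
    qed
    show "AE u in lborel. norm (indicator {t..s} u *\<^sub>R ?D n u) \<le> indicator {t..s} u * 2" for n
    proof (rule AE_I2)
      fix u :: real
      have "?D n u \<le> 2" "0 \<le> ?D n u" if "u \<in> {t..s}"
        using that s curve_iter[of n] curve_flow by (auto intro!: sum_abs_diff_le_2 sum_nonneg simp: curve_def)
      then show "norm (indicator {t..s} u *\<^sub>R ?D n u) \<le> indicator {t..s} u * 2" by (auto simp: indicator_def)
    qed
  qed simp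
  then have lim0: "(\<lambda>n. (k + L) * (LBINT u:{t..s}. ?D n u)) \<longlonglongrightarrow> 0"
    by (intro tendsto_mult_right_zero) (simp add: set_lebesgue_integral_def)
  have "(\<lambda>n. picard (iter n) s y - picard flow s y) \<longlonglongrightarrow> 0"
  proof (rule Lim_null_comparison[OF _ lim0], rule always_eventually, rule allI)
    fix n
    have "\<bar>picard (iter n) s y - picard flow s y\<bar> \<le> (\<Sum>y\<in>S. \<bar>picard (iter n) s y - picard flow s y\<bar>)"
      using finite_S y by (intro member_le_sum) auto
    also note I(2)
    finally show "norm (picard (iter n) s y - picard flow s y) \<le> (k + L) * (LBINT u:{t..s}. ?D n u)" by simp
  qed
  then have "(\<lambda>n. iter (Suc n) s y) \<longlonglongrightarrow> picard flow s y" by (simp add: LIM_zero_iff)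
  moreover have "(\<lambda>n. iter (Suc n) s y) \<longlonglongrightarrow> flow s y"
    using iter_LIMSEQ[OF s y] by (rule LIMSEQ_Suc)
  ultimately show ?thesis by (rule LIMSEQ_unique)
qed

text \<open>A fixed point of \<open>picard\<close> is exp (- k (s - t)) times an indefinite integral
  of \<open>mild\<close>. The product rule with the factor - k cancels the added term k * m and
  leaves the original equation.\<close>

theorem flow_solution:
  assumes s: "s \<in> {t..T}"
  shows "flow s \<in> prob_vectors S"
    and "y \<in> S \<Longrightarrow> set_integrable lborel {t..s} (\<lambda>u. b u (flow u) y)"
    and "y \<in> S \<Longrightarrow> flow s y = x0 y + (LBINT u:{t..s}. b u (flow u) y)"
proof -
  show "flow s \<in> prob_vectors S" using curve_flow s by (auto simp: curve_def)
  assume y: "y \<in> S"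
  define a where "a u = x0 y + (LBINT v:{t..u}. mild flow y v)" for u
  have ts: "t \<le> s" using s by simp
  have im: "set_integrable lborel {t..s} (mild flow y)"
    by (rule mild_integrable[OF curve_flow y]) (use s in simp)
  note P = exp_product_rule[OF ts im, of a "x0 y" "- k", OF a_def]
  have fl: "flow u y = exp ((- k) * (u - t)) * a u" if "u \<in> {t..s}" for u
    using picard_flow[of u y] that s y by (simp add: a_def picard_def)
  have e: "exp ((- k) * (u - t)) * (mild flow y u + (- k) * a u) = b u (flow u) y" if "u \<in> {t..s}" for u
  proof -
    have "exp ((- k) * (u - t)) * mild flow y u
        = (exp ((- k) * (u - t)) * exp (k * (u - t))) * (k * flow u y + b u (flow u) y)"
      by (simp add: mild_def)
    also have "exp ((- k) * (u - t)) * exp (k * (u - t)) = 1" by (simp flip: exp_add)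
    finally show ?thesis using fl[OF that] by (simp add: algebra_simps)
  qed
  show "set_integrable lborel {t..s} (\<lambda>u. b u (flow u) y)"
    using P(1) by (rule set_integrable_cong[THEN iffD1, rotated -1]) (use e in auto)
  have "flow s y = x0 y + (LBINT u:{t..s}. exp ((- k) * (u - t)) * (mild flow y u + (- k) * a u))"
    using fl[of s] P(2) s by simp
  also have "(LBINT u:{t..s}. exp ((- k) * (u - t)) * (mild flow y u + (- k) * a u)) = (LBINT u:{t..s}. b u (flow u) y)"
    using e by (intro set_lebesgue_integral_cong) auto
  finally show "flow s y = x0 y + (LBINT u:{t..s}. b u (flow u) y)" .
qed

end

subsection \<open>Construction of Markov chains with bounded measurable rates\<close>

text \<open>Summation by parts: the operator of the forward equation on the left is the transpose of
  the generator on the right. The diagonal terms vanish on both sides, so both sums may run over all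
  of S before they are interchanged. With \<phi> = 1 this is conservation of mass.\<close>

lemma generator_adjoint:
  fixes m \<phi> :: "'s \<Rightarrow> real" and q :: "'s \<Rightarrow> 's \<Rightarrow> real"
  assumes S: "finite S"
  shows "(\<Sum>y\<in>S. (\<Sum>z\<in>S - {y}. m z * q z y - m y * q y z) * \<phi> y) =
    (\<Sum>y\<in>S. m y * (\<Sum>z\<in>S - {y}. q y z * (\<phi> z - \<phi> y)))"
proof -
  have "(\<Sum>y\<in>S. (\<Sum>z\<in>S - {y}. m z * q z y - m y * q y z) * \<phi> y)
      = (\<Sum>y\<in>S. (\<Sum>z\<in>S. m z * q z y - m y * q y z) * \<phi> y)"
    using S by (intro sum.cong refl) (simp add: sum.remove[of S])
  also have "\<dots> = (\<Sum>y\<in>S. \<Sum>z\<in>S. m z * q z y * \<phi> y) - (\<Sum>y\<in>S. \<Sum>z\<in>S. m y * q y z * \<phi> y)"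
    by (simp add: sum_distrib_right left_diff_distrib sum_subtractf)
  also have "(\<Sum>y\<in>S. \<Sum>z\<in>S. m z * q z y * \<phi> y) = (\<Sum>y\<in>S. \<Sum>z\<in>S. m y * q y z * \<phi> z)"
    by (rule sum.swap)
  also have "\<dots> - (\<Sum>y\<in>S. \<Sum>z\<in>S. m y * q y z * \<phi> y) = (\<Sum>y\<in>S. m y * (\<Sum>z\<in>S. q y z * (\<phi> z - \<phi> y)))"
    by (simp add: sum_distrib_left right_diff_distrib sum_subtractf mult.assoc)
  also have "\<dots> = (\<Sum>y\<in>S. m y * (\<Sum>z\<in>S - {y}. q y z * (\<phi> z - \<phi> y)))"
    using S by (intro sum.cong refl) (simp add: sum.remove[of S])
  finally show ?thesis .
qed

text \<open>First-step analysis: a stream of independent letters is its first letter followed by an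
  independent copy of the stream. Real-valued measures and Bochner integrals are used because the
  renewal equation will contain differences.\<close>

lemma (in prob_space) measure_stream_space:
  assumes X[measurable]: "X \<in> sets (stream_space M)"
  shows "integrable M (\<lambda>w. measure (stream_space M) {\<omega> \<in> space (stream_space M). w ## \<omega> \<in> X})"
    and "measure (stream_space M) X = (\<integral>w. measure (stream_space M) {\<omega> \<in> space (stream_space M). w ## \<omega> \<in> X} \<partial>M)"
proof -
  interpret SM: prob_space "stream_space M" by (rule prob_space_stream_space)
  let ?Q = "{p \<in> space (M \<Otimes>\<^sub>M stream_space M). fst p ## snd p \<in> X}"
  have Q: "?Q \<in> sets (M \<Otimes>\<^sub>M stream_space M)" by measurable
  have Qe: "emeasure (stream_space M) {\<omega> \<in> space (stream_space M). w ## \<omega> \<in> X} = emeasure (stream_space M) (Pair w -` ?Q)"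
    if "w \<in> space M" for w
    using that by (intro arg_cong[where f="emeasure (stream_space M)"]) (auto simp: space_pair_measure)
  have m: "(\<lambda>w. emeasure (stream_space M) {\<omega> \<in> space (stream_space M). w ## \<omega> \<in> X}) \<in> borel_measurable M"
    using SM.measurable_emeasure_Pair[OF Q] by (subst measurable_cong[OF Qe])
  have m': "(\<lambda>w. measure (stream_space M) {\<omega> \<in> space (stream_space M). w ## \<omega> \<in> X}) \<in> borel_measurable M"
    unfolding measure_def using m by measurable
  show I: "integrable M (\<lambda>w. measure (stream_space M) {\<omega> \<in> space (stream_space M). w ## \<omega> \<in> X})"
    by (rule integrable_const_bound[where B=1]) (use m' in auto)
  have "ennreal (measure (stream_space M) X) = (\<integral>\<^sup>+w. emeasure (stream_space M) {\<omega> \<in> space (stream_space M). w ## \<omega> \<in> X} \<partial>M)"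
    using emeasure_stream_space[OF X] by (simp add: SM.emeasure_eq_measure)
  also have "\<dots> = (\<integral>\<^sup>+w. ennreal (measure (stream_space M) {\<omega> \<in> space (stream_space M). w ## \<omega> \<in> X}) \<partial>M)"
    by (simp add: SM.emeasure_eq_measure)
  also have "\<dots> = ennreal (\<integral>w. measure (stream_space M) {\<omega> \<in> space (stream_space M). w ## \<omega> \<in> X} \<partial>M)"
    by (rule nn_integral_eq_integral[OF I]) auto
  finally show "measure (stream_space M) X = (\<integral>w. measure (stream_space M) {\<omega> \<in> space (stream_space M). w ## \<omega> \<in> X} \<partial>M)"
    by (subst (asm) ennreal_inj) (auto intro!: Bochner_Integration.integral_nonneg)
qed

text \<open>The chain is built by uniformization: at the ticks of a Poisson clock of rate \<open>B * card S\<close> a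
  target \<open>z \<in> S\<close> and a threshold \<open>\<theta> \<in> [0,1]\<close> are drawn uniformly, and at time \<open>v\<close> the chain jumps
  from \<open>x\<close> to \<open>z\<close> if \<open>B * \<theta> < q v x z\<close>.\<close>

locale jump_rates =
  fixes S :: "'s set" and q :: "real \<Rightarrow> 's \<Rightarrow> 's \<Rightarrow> real" and B :: real
  assumes finite_S: "finite S" and S_ne: "S \<noteq> {}" and B_pos: "B > 0"
    and q_nonneg: "\<And>u x z. x \<in> S \<Longrightarrow> z \<in> S \<Longrightarrow> 0 \<le> q u x z"
    and q_le: "\<And>u x z. x \<in> S \<Longrightarrow> z \<in> S \<Longrightarrow> q u x z \<le> B"
    and q_meas: "\<And>x z. x \<in> S \<Longrightarrow> z \<in> S \<Longrightarrow> (\<lambda>u. q u x z) \<in> borel_measurable borel"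
begin

text \<open>Each of the \<open>card S\<close> targets is proposed at rate B and accepted with
  probability q v x z / B, so jumps from x to z occur at rate q v x z. Proposing z = x changes
  nothing.\<close>

definition rate :: real where "rate = B * real (card S)"

definition mark_space :: "('s \<times> real) measure" where
  "mark_space = uniform_count_measure S \<Otimes>\<^sub>M uniform_measure lborel {0..1}"

definition tick_space :: "(real \<times> 's \<times> real) measure" where
  "tick_space = density lborel (exponential_density rate) \<Otimes>\<^sub>M mark_space"

abbreviation "tick_stream \<equiv> stream_space tick_space"

definition hop :: "real \<Rightarrow> 's \<Rightarrow> 's \<times> real \<Rightarrow> 's" where
  "hop v x w = (if B * snd w < q v x (fst w) then fst w else x)"

primrec tick :: "nat \<Rightarrow> real \<Rightarrow> (real \<times> 's \<times> real) stream \<Rightarrow> real" where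
  "tick 0 u \<omega> = u"
| "tick (Suc n) u \<omega> = tick n (u + fst (shd \<omega>)) (stl \<omega>)"

text \<open>The recursion is on the number of ticks that are read, since the stream itself is
  infinite. Reading as many ticks as are needed to pass r gives the position at time r.\<close>

primrec truncated_path :: "nat \<Rightarrow> real \<Rightarrow> 's \<Rightarrow> (real \<times> 's \<times> real) stream \<Rightarrow> real \<Rightarrow> 's" where
  "truncated_path 0 u x \<omega> r = x"
| "truncated_path (Suc n) u x \<omega> r =
     (if r < u + fst (shd \<omega>) then x
      else truncated_path n (u + fst (shd \<omega>)) (hop (u + fst (shd \<omega>)) x (snd (shd \<omega>))) (stl \<omega>) r)"

text \<open>If the clock never passes r, an event of probability zero by \<open>AE_tick_gt\<close>,
  the default is a state of S, so that the map stays measurable into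
  \<open>count_space S\<close>.\<close>

definition jump_path :: "real \<Rightarrow> 's \<Rightarrow> (real \<times> 's \<times> real) stream \<Rightarrow> real \<Rightarrow> 's" where
  "jump_path u x \<omega> r = (if \<exists>n. r < tick n u \<omega> then truncated_path (LEAST n. r < tick n u \<omega>) u x \<omega> r
     else (SOME y. y \<in> S))"

lemma rate_pos: "rate > 0"
  using B_pos finite_S S_ne by (simp add: rate_def card_gt_0_iff)

text \<open>Renewal at the first tick. Since u \<le> r, tick number 0 does not pass r, so prepending
  a letter raises the \<open>LEAST\<close> index by exactly one.\<close>

lemma jump_path_SCons:
  assumes "u \<le> r"
  shows "jump_path u x (w ## \<omega>) r =
    (if r < u + fst w then x else jump_path (u + fst w) (hop (u + fst w) x (snd w)) \<omega> r)"
proof -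
  let ?v = "u + fst w"
  have Suc: "(r < tick (Suc n) u (w ## \<omega>)) = (r < tick n ?v \<omega>)" for n by simp
  have 0: "\<not> r < tick 0 u (w ## \<omega>)" using assms by simp
  have ex: "(\<exists>n. r < tick n u (w ## \<omega>)) \<longleftrightarrow> (\<exists>n. r < tick n ?v \<omega>)"
    by (metis 0 Suc not0_implies_Suc)
  show ?thesis
  proof (cases "\<exists>n. r < tick n ?v \<omega>")
    case True
    then obtain n where n: "r < tick (Suc n) u (w ## \<omega>)" by auto
    have L: "(LEAST n. r < tick n u (w ## \<omega>)) = Suc (LEAST n. r < tick n ?v \<omega>)"
      using Least_Suc[of "\<lambda>n. r < tick n u (w ## \<omega>)", OF n 0] by (simp only: Suc)
    have "(LEAST n. r < tick n ?v \<omega>) = 0" if "r < ?v" using that by (intro Least_eq_0) simp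
    then show ?thesis using True ex L by (auto simp: jump_path_def)
  next
    case False
    then have "\<not> r < ?v" by (metis tick.simps(1))
    then show ?thesis using False ex by (simp add: jump_path_def)
  qed
qed

section \<open>Measurability and regularity of the constructed paths\<close>

lemma prob_space_exp: "prob_space (density lborel (exponential_density rate))"
  by (rule prob_space_exponential_density[OF rate_pos])

lemma prob_space_mark_space: "prob_space mark_space"
proof -
  interpret A: prob_space "uniform_count_measure S"
    by (rule prob_space_uniform_count_measure[OF finite_S S_ne])
  interpret U: prob_space "uniform_measure lborel {0..1::real}"
    by (rule prob_space_uniform_measure) auto
  interpret pair_prob_space "uniform_count_measure S" "uniform_measure lborel {0..1::real}" ..
  show ?thesis unfolding mark_space_def by (rule P.prob_space_axioms)
qed

lemma prob_space_tick_space: "prob_space tick_space"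
proof -
  interpret A: prob_space "density lborel (exponential_density rate)" by (rule prob_space_exp)
  interpret U: prob_space mark_space by (rule prob_space_mark_space)
  interpret pair_prob_space "density lborel (exponential_density rate)" mark_space ..
  show ?thesis unfolding tick_space_def by (rule P.prob_space_axioms)
qed

lemma prob_space_tick_stream: "prob_space tick_stream"
  using prob_space.prob_space_stream_space[OF prob_space_tick_space] .

lemma sets_mark_space[measurable_cong]: "sets mark_space = sets (count_space S \<Otimes>\<^sub>M borel)"
  unfolding mark_space_def by (intro sets_pair_measure_cong) (auto simp: sets_uniform_count_measure)

lemma sets_tick_space[measurable_cong]: "sets tick_space = sets (borel \<Otimes>\<^sub>M (count_space S \<Otimes>\<^sub>M borel))"
  unfolding tick_space_def by (intro sets_pair_measure_cong sets_mark_space) auto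

lemma space_mark_space: "space mark_space = S \<times> UNIV"
  using sets_eq_imp_space_eq[OF sets_mark_space] by (simp add: space_pair_measure)

lemma q_meas_pair: "x \<in> S \<Longrightarrow> (\<lambda>p. q (fst p) x (fst (snd p))) \<in> borel_measurable (borel \<Otimes>\<^sub>M (count_space S \<Otimes>\<^sub>M borel))"
proof (rule measurable_compose_countable'[where I=S and f="\<lambda>z p. q (fst p) x z" and g="\<lambda>p. fst (snd p)"])
  fix z assume "x \<in> S" "z \<in> S"
  note [measurable] = q_meas[OF this]
  show "(\<lambda>p. q (fst p) x z) \<in> borel_measurable (borel \<Otimes>\<^sub>M (count_space S \<Otimes>\<^sub>M borel))" by measurable
qed (use finite_S in \<open>auto intro: countable_finite\<close>)

lemma hop_measurable:
  assumes x: "x \<in> S"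
  shows "(\<lambda>p. hop (fst p) x (snd p)) \<in> measurable (borel \<Otimes>\<^sub>M (count_space S \<Otimes>\<^sub>M borel)) (count_space S)"
proof -
  note [measurable] = q_meas_pair[OF x]
  have "Measurable.pred (borel \<Otimes>\<^sub>M (count_space S \<Otimes>\<^sub>M borel)) (\<lambda>p. B * snd (snd p) < q (fst p) x (fst (snd p)))"
    by measurable
  then show ?thesis unfolding hop_def using x by (intro measurable_If) auto
qed

lemma hop_in: "x \<in> S \<Longrightarrow> fst w \<in> S \<Longrightarrow> hop v x w \<in> S"
  by (simp add: hop_def)

lemma shd_measurable[measurable]: "shd \<in> measurable tick_stream (borel \<Otimes>\<^sub>M (count_space S \<Otimes>\<^sub>M borel))"
  using measurable_shd[of tick_space] measurable_cong_sets[OF refl sets_tick_space] by blast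

text \<open>Joint in the starting time and the stream, because the recursion restarts at the random
  time of the first tick. The same reason shapes the measurability of \<open>truncated_path\<close>
  and \<open>jump_path\<close>.\<close>

lemma tick_measurable: "(\<lambda>p. tick n (fst p) (snd p)) \<in> borel_measurable (borel \<Otimes>\<^sub>M tick_stream)"
proof (induction n)
  case (Suc n)
  have "(\<lambda>p. (fst p + fst (shd (snd p)), stl (snd p))) \<in> measurable (borel \<Otimes>\<^sub>M tick_stream) (borel \<Otimes>\<^sub>M tick_stream)"
    by measurable
  from measurable_compose[OF this Suc] show ?case by simp
qed simp

lemma truncated_path_measurable:
  "x \<in> S \<Longrightarrow> (\<lambda>p. truncated_path n (fst p) x (snd p) r) \<in> measurable (borel \<Otimes>\<^sub>M tick_stream) (count_space S)"
proof (induction n arbitrary: x)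
  case (Suc n)
  let ?N = "borel \<Otimes>\<^sub>M tick_stream"
  let ?g = "\<lambda>p::real \<times> _. hop (fst p + fst (shd (snd p))) x (snd (shd (snd p)))"
  have 1: "(\<lambda>p. (fst p + fst (shd (snd p)), stl (snd p))) \<in> measurable ?N ?N" by measurable
  have 2: "(\<lambda>p. (fst p + fst (shd (snd p)), snd (shd (snd p)))) \<in> measurable ?N (borel \<Otimes>\<^sub>M (count_space S \<Otimes>\<^sub>M borel))"
    by measurable
  have g: "?g \<in> measurable ?N (count_space S)"
    using measurable_compose[OF 2 hop_measurable[OF Suc.prems]] by simp
  have "(\<lambda>p. truncated_path n (fst p + fst (shd (snd p))) (?g p) (stl (snd p)) r) \<in> measurable ?N (count_space S)"
  proof (rule measurable_compose_countable'[where I=S and g="?g" and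
      f="\<lambda>y p. truncated_path n (fst p + fst (shd (snd p))) y (stl (snd p)) r"])
    fix y assume "y \<in> S"
    from measurable_compose[OF 1 Suc.IH[OF this]]
    show "(\<lambda>p. truncated_path n (fst p + fst (shd (snd p))) y (stl (snd p)) r) \<in> measurable ?N (count_space S)"
      by simp
  qed (use g finite_S in \<open>auto intro: countable_finite\<close>)
  moreover have "Measurable.pred ?N (\<lambda>p. r < fst p + fst (shd (snd p)))" by measurable
  ultimately show ?case using Suc.prems unfolding truncated_path.simps by (intro measurable_If) auto
qed simp

lemma jump_path_measurable:
  assumes x: "x \<in> S"
  shows "(\<lambda>p. jump_path (fst p) x (snd p) r) \<in> measurable (borel \<Otimes>\<^sub>M tick_stream) (count_space S)"
proof -
  let ?N = "borel \<Otimes>\<^sub>M tick_stream"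
  note [measurable] = tick_measurable
  have l: "(\<lambda>p. LEAST n. r < tick n (fst p) (snd p)) \<in> measurable ?N (count_space UNIV)" by measurable
  have "(\<lambda>p. truncated_path (LEAST n. r < tick n (fst p) (snd p)) (fst p) x (snd p) r) \<in> measurable ?N (count_space S)"
    by (rule measurable_compose_countable'[where I=UNIV and g="\<lambda>p. LEAST n. r < tick n (fst p) (snd p)" and
      f="\<lambda>n p. truncated_path n (fst p) x (snd p) r"]) (use l truncated_path_measurable[OF x] in auto)
  moreover have "Measurable.pred ?N (\<lambda>p. \<exists>n. r < tick n (fst p) (snd p))" by measurable
  moreover have "(SOME y. y \<in> S) \<in> S" using S_ne by (simp add: some_in_eq)
  ultimately show ?thesis unfolding jump_path_def by (intro measurable_If) auto
qed

lemma jump_path_measurable_stream: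
  assumes "x \<in> S"
  shows "(\<lambda>\<omega>. jump_path s x \<omega> r) \<in> measurable tick_stream (count_space S)"
proof -
  have "(\<lambda>\<omega>. (s, \<omega>)) \<in> measurable tick_stream (borel \<Otimes>\<^sub>M tick_stream)" by measurable
  from measurable_compose[OF this jump_path_measurable[OF assms, of r]] show ?thesis by simp
qed

definition regular :: "real \<Rightarrow> real \<Rightarrow> (real \<Rightarrow> 's) \<Rightarrow> bool" where
  "regular u T w \<longleftrightarrow> (\<forall>s\<in>{u..<T}. \<forall>\<^sub>F r in at_right s. w r = w s) \<and>
     (\<forall>s\<in>{u<..T}. \<exists>x. \<forall>\<^sub>F r in at_left s. w r = x)"

text \<open>Induction on the number of ticks needed to pass T: the path is constant before the first
  tick and afterwards coincides with a path started at that tick.\<close>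

lemma jump_path_regular:
  "T < tick n u \<omega> \<Longrightarrow> regular u T (jump_path u x \<omega>)"
proof (induction n arbitrary: u x \<omega>)
  case 0
  then show ?case by (auto simp: regular_def)
next
  case (Suc n)
  define e where "e = fst (shd \<omega>)"
  define v where "v = u + e"
  define y where "y = hop v x (snd (shd \<omega>))"
  have r: "regular v T (jump_path v y (stl \<omega>))" using Suc by (auto simp: v_def e_def)
  have p: "jump_path u x \<omega> r = (if r < v then x else jump_path v y (stl \<omega>) r)" if "u \<le> r" for r
    using jump_path_SCons[OF that, of x "shd \<omega>" "stl \<omega>"] by (simp add: v_def y_def e_def)
  show ?case unfolding regular_def
  proof safe
    fix s assume s: "s \<in> {u..<T}"
    show "\<forall>\<^sub>F r in at_right s. jump_path u x \<omega> r = jump_path u x \<omega> s"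
    proof (cases "s < v")
      case True
      have "\<forall>\<^sub>F r in at_right s. r \<in> {s<..<v}" using True by (rule eventually_at_right_real)
      then show ?thesis by eventually_elim (use s True p in auto)
    next
      case False
      have "\<forall>\<^sub>F r in at_right s. jump_path v y (stl \<omega>) r = jump_path v y (stl \<omega>) s"
        using r s False by (auto simp: regular_def)
      moreover have "\<forall>\<^sub>F r in at_right s. r \<in> {s<..<T}" using s by (intro eventually_at_right_real) auto
      ultimately show ?thesis by eventually_elim (use s False p in auto)
    qed
  next
    fix s assume s: "s \<in> {u<..T}"
    show "\<exists>x'. \<forall>\<^sub>F r in at_left s. jump_path u x \<omega> r = x'"
    proof (cases "s \<le> v")
      case True
      have "\<forall>\<^sub>F r in at_left s. r \<in> {u<..<s}" using s by (intro eventually_at_left_real) auto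
      then have "\<forall>\<^sub>F r in at_left s. jump_path u x \<omega> r = x" by eventually_elim (use True p in auto)
      then show ?thesis by blast
    next
      case False
      then obtain z where "\<forall>\<^sub>F r in at_left s. jump_path v y (stl \<omega>) r = z"
        using r s unfolding regular_def by (meson greaterThanAtMost_iff not_le)
      \<comment> \<open>Waiting times are positive only almost surely, so the first tick v of this
        particular stream may lie before u.\<close>
      moreover have "\<forall>\<^sub>F r in at_left s. r \<in> {max u v<..<s}" using s False by (intro eventually_at_left_real) auto
      ultimately have "\<forall>\<^sub>F r in at_left s. jump_path u x \<omega> r = z" by eventually_elim (use p in auto)
      then show ?thesis by blast
    qed
  qed
qed

lemma tick_space_integral:
  fixes F :: "real \<times> 's \<times> real \<Rightarrow> real"
  assumes F: "integrable tick_space F"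
  shows "(\<integral>w. F w \<partial>tick_space) = (LBINT e. exponential_density rate e * (\<integral>m. F (e, m) \<partial>mark_space))"
    and "integrable lborel (\<lambda>e. exponential_density rate e * (\<integral>m. F (e, m) \<partial>mark_space))"
proof -
  interpret A: prob_space "density lborel (exponential_density rate)" by (rule prob_space_exp)
  interpret U: prob_space mark_space by (rule prob_space_mark_space)
  interpret pair_prob_space "density lborel (exponential_density rate)" mark_space ..
  have F': "integrable (density lborel (exponential_density rate) \<Otimes>\<^sub>M mark_space) F"
    using F by (simp add: tick_space_def)
  have i: "integrable (density lborel (exponential_density rate)) (\<lambda>e. \<integral>m. F (e, m) \<partial>mark_space)"
    using integrable_fst'[OF F'] .
  have m: "(\<lambda>e. \<integral>m. F (e, m) \<partial>mark_space) \<in> borel_measurable lborel" using i by auto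
  have nn: "AE e in lborel. 0 \<le> exponential_density rate e"
    by (intro AE_I2 exponential_density_nonneg rate_pos)
  have em: "(\<lambda>e. exponential_density rate e) \<in> borel_measurable lborel" by simp
  have "(\<integral>w. F w \<partial>tick_space) = (\<integral>e. (\<integral>m. F (e, m) \<partial>mark_space) \<partial>density lborel (exponential_density rate))"
    using integral_fst'[OF F'] by (simp add: tick_space_def)
  also have "\<dots> = (LBINT e. exponential_density rate e * (\<integral>m. F (e, m) \<partial>mark_space))"
    by (subst integral_density[OF m em nn]) simp
  finally show "(\<integral>w. F w \<partial>tick_space) = (LBINT e. exponential_density rate e * (\<integral>m. F (e, m) \<partial>mark_space))" .
  show "integrable lborel (\<lambda>e. exponential_density rate e * (\<integral>m. F (e, m) \<partial>mark_space))"
    using i by (subst (asm) integrable_density[OF m em nn]) simp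
qed

text \<open>On functions, a tick acts as the identity plus the generator divided by the clock rate:
  the threshold accepts the target z with probability q v x z / B, and averaging over the targets
  divides by \<open>card S\<close>.\<close>

lemma mark_space_integral_hop:
  fixes h :: "'s \<Rightarrow> real"
  assumes x: "x \<in> S"
  shows "(\<integral>w. h (hop v x w) \<partial>mark_space) = h x + (\<Sum>z\<in>S. q v x z * (h z - h x)) / rate"
proof -
  let ?C = "uniform_count_measure S" and ?U = "uniform_measure lborel {0..1::real}"
  interpret A: prob_space ?C
    by (rule prob_space_uniform_count_measure[OF finite_S S_ne])
  interpret U: prob_space ?U
    by (rule prob_space_uniform_measure) auto
  interpret pair_prob_space ?C ?U ..
  interpret M: prob_space mark_space by (rule prob_space_mark_space)
  have hm: "(\<lambda>w. hop v x w) \<in> measurable mark_space (count_space S)"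
  proof -
    have "(\<lambda>w. (v, w)) \<in> measurable mark_space (borel \<Otimes>\<^sub>M (count_space S \<Otimes>\<^sub>M borel))" by measurable
    from measurable_compose[OF this hop_measurable[OF x]] show ?thesis by simp
  qed
  have m: "(\<lambda>w. h (hop v x w)) \<in> borel_measurable mark_space"
    using measurable_compose[OF hm, of h borel] by simp
  obtain D where D: "\<And>y. y \<in> S \<Longrightarrow> \<bar>h y\<bar> \<le> D"
    using finite_S by (meson finite_imageI Max_ge image_eqI)
  have I: "integrable mark_space (\<lambda>w. h (hop v x w))"
    by (rule M.integrable_const_bound[where B=D, OF _ m])
       (use D hop_in[OF x] in \<open>auto simp: space_mark_space\<close>)
  have inner: "(\<integral>\<theta>. h (hop v x (z, \<theta>)) \<partial>?U) = h x + q v x z / B * (h z - h x)" if z: "z \<in> S" for z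
  proof -
    have c: "0 \<le> q v x z / B" "q v x z / B \<le> 1" using q_nonneg[OF x z] q_le[OF x z] B_pos by auto
    have "(\<integral>\<theta>. h (hop v x (z, \<theta>)) \<partial>?U) = (\<integral>\<theta>. h x + indicator {..< q v x z / B} \<theta> * (h z - h x) \<partial>?U)"
      using B_pos by (intro Bochner_Integration.integral_cong) (auto simp: hop_def indicator_def field_simps)
    also have "\<dots> = h x + measure ?U {..< q v x z / B} * (h z - h x)"
    proof -
      have "integrable ?U (\<lambda>\<theta>. indicator {..< q v x z / B} \<theta> * (h z - h x))"
        by (intro integrable_mult_left integrable_real_indicator) (auto simp: U.emeasure_eq_measure)
      then show ?thesis by (simp add: U.prob_space)
    qed
    also have "measure ?U {..< q v x z / B} = q v x z / B"
    proof -
      have "{0..1} \<inter> {..< q v x z / B} = {0..< q v x z / B}" using c by auto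
      then show ?thesis using c by (subst measure_uniform_measure) auto
    qed
    finally show ?thesis by (simp add: mult.commute)
  qed
  have "(\<integral>w. h (hop v x w) \<partial>mark_space) = (\<integral>z. (\<integral>\<theta>. h (hop v x (z, \<theta>)) \<partial>?U) \<partial>?C)"
    using integral_fst'[of "\<lambda>w. h (hop v x w)"] I by (simp add: mark_space_def)
  also have "\<dots> = (\<Sum>z\<in>S. \<integral>\<theta>. h (hop v x (z, \<theta>)) \<partial>?U) / card S"
    by (rule integral_uniform_count_measure[OF finite_S])
  also have "\<dots> = (\<Sum>z\<in>S. h x + q v x z / B * (h z - h x)) / card S"
    using inner by simp
  also have "\<dots> = h x + (\<Sum>z\<in>S. q v x z * (h z - h x)) / rate"
    using finite_S S_ne B_pos
    by (simp add: sum.distrib rate_def add_divide_distrib flip: sum_divide_distrib)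
  finally show ?thesis .
qed

end

lemma set_integral_Icc_split:
  fixes f :: "real \<Rightarrow> real"
  assumes "a \<le> b" "b \<le> c" and f: "set_integrable lborel {a..c} f"
  shows "(LBINT u:{a..c}. f u) = (LBINT u:{a..b}. f u) + (LBINT u:{b..c}. f u)"
proof -
  have "AE u in lborel. u \<noteq> b" by (rule AE_lborel_singleton)
  then have ae: "AE u in lborel. \<not> (u \<in> {a..b} \<and> u \<in> {b..c})" by eventually_elim auto
  have "{a..c} = {a..b} \<union> {b..c}" using assms by auto
  then show ?thesis
    using set_integral_Un_AE[OF ae, of f] set_integrable_Icc_subset[OF f] assms by simp
qed

lemma set_integral_singleton: "(LBINT u:{a}. f u) = (0::real)" for f :: "real \<Rightarrow> real"
  unfolding set_lebesgue_integral_def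
proof (rule integral_eq_zero_AE)
  have "AE u in lborel. u \<noteq> a" by (rule AE_lborel_singleton)
  then show "AE u in lborel. indicator {a} u *\<^sub>R f u = 0" by eventually_elim auto
qed

context jump_rates
begin

section \<open>Ticks do not accumulate; finite-dimensional distributions and their backward
  equation\<close>

lemma exponential_density_integral: "(LBINT e. exponential_density l e) = 1" if "l > 0"
proof -
  interpret prob_space "density lborel (exponential_density l)"
    by (rule prob_space_exponential_density[OF that])
  have nn: "AE e in lborel. 0 \<le> exponential_density l e"
    by (intro AE_I2 exponential_density_nonneg that)
  have "(LBINT e. exponential_density l e) = (\<integral>e. 1 \<partial>density lborel (exponential_density l))"
    by (subst integral_density[OF _ _ nn]) auto
  then show ?thesis using prob_space by simp
qed

lemma exponential_density_integrable: "integrable lborel (\<lambda>e. exponential_density l e)" if "l > 0"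
  using exponential_density_integral[OF that] not_integrable_integral_eq by fastforce

text \<open>Chernoff's bound: a waiting time \<xi> with parameter \<open>rate\<close> satisfies E
  exp (- rate \<xi>) = 1/2. In the induction this appears as follows: for e \<ge> 0, the density
  with parameter \<open>rate\<close> times exp (- rate e) is half of the density with parameter 2
  rate.\<close>

lemma measure_tick_le:
  "measure tick_stream {\<omega> \<in> space tick_stream. tick n u \<omega> \<le> T} \<le> exp (rate * (T - u)) * (1/2)^n"
proof (induction n arbitrary: u)
  case 0
  interpret prob_space tick_stream by (rule prob_space_tick_stream)
  show ?case
  proof (cases "u \<le> T")
    case True
    have "measure tick_stream {\<omega> \<in> space tick_stream. tick 0 u \<omega> \<le> T} \<le> 1" by simp
    also have "1 \<le> exp (rate * (T - u))" using True rate_pos by simp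
    finally show ?thesis by simp
  qed simp
next
  case (Suc n)
  interpret W: prob_space tick_space by (rule prob_space_tick_space)
  interpret U: prob_space mark_space by (rule prob_space_mark_space)
  let ?P = "\<lambda>u. measure tick_stream {\<omega> \<in> space tick_stream. tick n u \<omega> \<le> T}"
  let ?X = "{\<omega> \<in> space tick_stream. tick (Suc n) u \<omega> \<le> T}"
  have "(\<lambda>\<omega>. tick (Suc n) u \<omega>) \<in> borel_measurable tick_stream"
    using measurable_compose[OF _ tick_measurable[of "Suc n"], of "\<lambda>\<omega>. (u, \<omega>)" tick_stream] by simp
  then have X: "?X \<in> sets tick_stream" by (rule borel_measurable_le) simp
  have e: "measure tick_stream {\<omega> \<in> space tick_stream. w ## \<omega> \<in> ?X} = ?P (u + fst w)"
    if "w \<in> space tick_space" for w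
    using that by (intro arg_cong[where f="measure tick_stream"])
      (auto simp: space_stream_space streams_Stream)
  note M = W.measure_stream_space[OF X]
  have I: "integrable tick_space (\<lambda>w. ?P (u + fst w))"
    using M(1) by (subst (asm) Bochner_Integration.integrable_cong[OF refl e])
  have "measure tick_stream ?X = (\<integral>w. ?P (u + fst w) \<partial>tick_space)"
    unfolding M(2) by (intro Bochner_Integration.integral_cong refl e)
  also have "\<dots> = (LBINT e. exponential_density rate e * ?P (u + e))"
    using tick_space_integral(1)[OF I] by (simp add: U.prob_space)
  also have "\<dots> \<le> (LBINT e. exp (rate * (T - u)) * (1/2)^(Suc n) * exponential_density (2 * rate) e)"
  proof (rule integral_mono)
    show "integrable lborel (\<lambda>e. exponential_density rate e * ?P (u + e))"
      using tick_space_integral(2)[OF I] by (simp add: U.prob_space)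
    show "integrable lborel (\<lambda>e. exp (rate * (T - u)) * (1/2)^(Suc n) * exponential_density (2 * rate) e)"
      using exponential_density_integrable[of "2 * rate"] rate_pos by simp
    fix e :: real
    show "exponential_density rate e * ?P (u + e) \<le> exp (rate * (T - u)) * (1/2)^(Suc n) * exponential_density (2 * rate) e"
    proof (cases "e < 0")
      case False
      have "exponential_density rate e * ?P (u + e) \<le> exponential_density rate e * (exp (rate * (T - (u + e))) * (1/2)^n)"
        by (intro mult_left_mono Suc exponential_density_nonneg rate_pos)
      also have "\<dots> = rate * (1/2)^n * (exp (- e * rate) * exp (rate * (T - (u + e))))"
        using False by (simp add: exponential_density_def)
      also have "exp (- e * rate) * exp (rate * (T - (u + e))) = exp (rate * (T - u)) * exp (- e * (2 * rate))"
        by (simp add: algebra_simps flip: exp_add)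
      also have "rate * (1/2)^n * \<dots> = exp (rate * (T - u)) * (1/2)^(Suc n) * exponential_density (2 * rate) e"
        using False by (simp add: exponential_density_def)
      finally show ?thesis .
    qed (simp add: exponential_density_def)
  qed
  also have "\<dots> = exp (rate * (T - u)) * (1/2)^(Suc n)"
    using exponential_density_integral[of "2 * rate"] rate_pos by simp
  finally show ?case .
qed

text \<open>The event that all ticks stay below T lies in events whose probability is at most a
  constant times (1/2)^n.\<close>

lemma AE_tick_gt: "AE \<omega> in tick_stream. \<exists>n. T < tick n u \<omega>"
proof -
  interpret prob_space tick_stream by (rule prob_space_tick_stream)
  have tm: "(\<lambda>\<omega>. tick n u \<omega>) \<in> borel_measurable tick_stream" for n
    using measurable_compose[OF _ tick_measurable[of n], of "\<lambda>\<omega>. (u, \<omega>)" tick_stream] by simp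
  note [measurable] = tm
  let ?X = "{\<omega> \<in> space tick_stream. \<forall>n. tick n u \<omega> \<le> T}"
  have X: "?X \<in> sets tick_stream" by measurable
  have "measure tick_stream ?X \<le> exp (rate * (T - u)) * (1/2)^n" for n
  proof -
    have "measure tick_stream ?X \<le> measure tick_stream {\<omega> \<in> space tick_stream. tick n u \<omega> \<le> T}"
      by (intro finite_measure_mono) auto
    also note measure_tick_le
    finally show ?thesis .
  qed
  moreover have "(\<lambda>n. exp (rate * (T - u)) * (1/2)^n) \<longlonglongrightarrow> exp (rate * (T - u)) * 0"
    by (intro tendsto_intros LIMSEQ_power_zero) auto
  ultimately have "measure tick_stream ?X \<le> 0"
    by (intro LIMSEQ_le_const[where X="\<lambda>n. exp (rate * (T - u)) * (1/2)^n"]) auto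
  then have "emeasure tick_stream ?X = 0" by (simp add: emeasure_eq_measure measure_le_0_iff)
  then show ?thesis
    by (intro AE_I[OF _ _ X]) (auto simp: not_less)
qed

text \<open>The finite-dimensional distributions of the path started in x at time s. Constraints
  form a list so that the earliest one can be treated separately while the later ones are carried
  along.\<close>

definition match :: "real \<Rightarrow> 's \<Rightarrow> (real \<times> 's) list \<Rightarrow> real" where
  "match s x L = measure tick_stream {\<omega> \<in> space tick_stream. \<forall>(r, y)\<in>set L. jump_path s x \<omega> r = y}"

lemma sets_match_pair:
  assumes "x \<in> S"
  shows "{p \<in> space (borel \<Otimes>\<^sub>M tick_stream). \<forall>(r, y)\<in>set L. jump_path (fst p) x (snd p) r = y} \<in> sets (borel \<Otimes>\<^sub>M tick_stream)"
proof -
  have "{p \<in> space (borel \<Otimes>\<^sub>M tick_stream). jump_path (fst p) x (snd p) r = y} \<in> sets (borel \<Otimes>\<^sub>M tick_stream)" for r y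
  proof -
    have "{p \<in> space (borel \<Otimes>\<^sub>M tick_stream). jump_path (fst p) x (snd p) r = y}
      = (\<lambda>p. jump_path (fst p) x (snd p) r) -` ({y} \<inter> S) \<inter> space (borel \<Otimes>\<^sub>M tick_stream)"
      using measurable_space[OF jump_path_measurable[OF assms, of r]] by auto
    also have "\<dots> \<in> sets (borel \<Otimes>\<^sub>M tick_stream)"
      by (rule measurable_sets[OF jump_path_measurable[OF assms]]) auto
    finally show ?thesis .
  qed
  then have "{p \<in> space (borel \<Otimes>\<^sub>M tick_stream). \<forall>c\<in>set L. jump_path (fst p) x (snd p) (fst c) = snd c} \<in> sets (borel \<Otimes>\<^sub>M tick_stream)"
    by (intro sets.sets_Collect_finite_All) auto
  then show ?thesis by (simp add: case_prod_beta)
qed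

lemma sets_match:
  assumes "x \<in> S"
  shows "{\<omega> \<in> space tick_stream. \<forall>(r, y)\<in>set L. jump_path s x \<omega> r = y} \<in> sets tick_stream"
proof -
  have "{\<omega> \<in> space tick_stream. \<forall>(r, y)\<in>set L. jump_path s x \<omega> r = y} =
    Pair s -` {p \<in> space (borel \<Otimes>\<^sub>M tick_stream). \<forall>(r, y)\<in>set L. jump_path (fst p) x (snd p) r = y}"
    by (auto simp: space_pair_measure)
  then show ?thesis using sets_Pair1[OF sets_match_pair[OF assms]] by simp
qed

lemma match_measurable:
  assumes x: "x \<in> S"
  shows "(\<lambda>s. match s x L) \<in> borel_measurable borel"
proof -
  interpret prob_space tick_stream by (rule prob_space_tick_stream)
  have "emeasure tick_stream {\<omega> \<in> space tick_stream. \<forall>(r, y)\<in>set L. jump_path s x \<omega> r = y} =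
    emeasure tick_stream (Pair s -` {p \<in> space (borel \<Otimes>\<^sub>M tick_stream). \<forall>(r, y)\<in>set L. jump_path (fst p) x (snd p) r = y})" for s
    by (intro arg_cong[where f="emeasure tick_stream"]) (auto simp: space_pair_measure)
  then show ?thesis unfolding match_def measure_def
    using measurable_emeasure_Pair[OF sets_match_pair[OF x, of L]] by simp
qed

lemma match_bounds: "0 \<le> match s x L" "match s x L \<le> 1"
proof -
  interpret prob_space tick_stream by (rule prob_space_tick_stream)
  show "0 \<le> match s x L" "match s x L \<le> 1" by (auto simp: match_def)
qed

text \<open>Conditioning on the first tick v. If v \<le> r1, the path restarts at v from the state
  given by the mark, and averaging over the mark yields \<open>match\<close> plus the generator
  divided by the clock rate. If v > r1, the path is still in x at r1, which decides the first
  constraint, and the memoryless clock may be restarted at r1 for the constraints L'.\<close>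

lemma match_renewal:
  fixes y1 :: 's
  assumes x: "x \<in> S" and s: "s \<le> r1" and L': "\<And>r y. (r, y) \<in> set L' \<Longrightarrow> r1 \<le> r"
  defines "L \<equiv> (r1, y1) # L'"
  shows "match s x L = (LBINT v:{s..r1}. exp (- rate * (v - s)) *
      (rate * match v x L + (\<Sum>z\<in>S. q v x z * (match v z L - match v x L)))) +
    exp (- rate * (r1 - s)) * (if x = y1 then match r1 x L' else 0)"
proof -
  interpret W: prob_space tick_space by (rule prob_space_tick_space)
  define inner where "inner L s w = measure tick_stream {\<omega> \<in> space tick_stream. \<forall>(r, y)\<in>set L. jump_path s x (w ## \<omega>) r = y}" for L s w
  have inner: "integrable tick_space (inner L s)" "match s x L = (\<integral>w. inner L s w \<partial>tick_space)" for s L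
  proof -
    let ?X = "{\<omega> \<in> space tick_stream. \<forall>(r, y)\<in>set L. jump_path s x \<omega> r = y}"
    have e: "measure tick_stream {\<omega> \<in> space tick_stream. w ## \<omega> \<in> ?X} = inner L s w" if "w \<in> space tick_space" for w
      unfolding inner_def using that
      by (intro arg_cong[where f="measure tick_stream"]) (auto simp: space_stream_space streams_Stream)
    note M = W.measure_stream_space[OF sets_match[OF x, of L s]]
    show "integrable tick_space (inner L s)"
      using M(1) by (subst (asm) Bochner_Integration.integrable_cong[OF refl e])
    show "match s x L = (\<integral>w. inner L s w \<partial>tick_space)"
      unfolding match_def M(2) by (intro Bochner_Integration.integral_cong refl e)
  qed
  define a where "a = r1 - s"
  define A where "A v = match v x L + (\<Sum>z\<in>S. q v x z * (match v z L - match v x L)) / rate" for v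
  define J where "J e = (\<integral>m. inner L' r1 (e, m) \<partial>mark_space)" for e
  define I where "I e = (\<integral>m. inner L s (e, m) \<partial>mark_space)" for e
  have I1: "I e = A (s + e)" if e: "s + e \<le> r1" for e
  proof -
    have "inner L s (e, m) = match (s + e) (hop (s + e) x m) L" for m
    proof -
      have "jump_path s x ((e, m) ## \<omega>) r = jump_path (s + e) (hop (s + e) x m) \<omega> r" if "(r, y) \<in> set L" for r y \<omega>
      proof -
        have "r1 \<le> r" using that L' by (auto simp: L_def)
        then have "s \<le> r" "\<not> r < s + e" using e s by linarith+
        then show ?thesis using jump_path_SCons[of s r x "(e, m)" \<omega>] by simp
      qed
      then show ?thesis unfolding inner_def match_def
        by (intro arg_cong[where f="measure tick_stream"]) fastforce
    qed
    then show ?thesis unfolding I_def A_def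
      using mark_space_integral_hop[OF x, of "\<lambda>y. match (s + e) y L" "s + e"] by simp
  qed
  \<comment> \<open>The first tick falls after r1, so the state at r1 is x; seen from r1, the
    waiting time e has shrunk to e - a.\<close>
  have I2: "I e = (if x = y1 then J (e - a) else 0)" if e: "r1 < s + e" for e
  proof -
    have "inner L s (e, m) = (if x = y1 then inner L' r1 (e - a, m) else 0)" for m
    proof -
      have 1: "jump_path s x ((e, m) ## \<omega>) r1 = x" for \<omega>
        using e s by (subst jump_path_SCons) auto
      have 2: "jump_path s x ((e, m) ## \<omega>) r = jump_path r1 x ((e - a, m) ## \<omega>) r" if "(r, y) \<in> set L'" for r y \<omega>
      proof -
        have r: "r1 \<le> r" using that L' by auto
        have Q: "r1 + (e - a) = s + e" by (simp add: a_def)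
        have sr: "s \<le> r" using r s by simp
        show ?thesis
          unfolding jump_path_SCons[OF sr] jump_path_SCons[OF r] fst_conv snd_conv Q ..
      qed
      show ?thesis
      proof (cases "x = y1")
        case True
        have "{\<omega> \<in> space tick_stream. \<forall>(r, y)\<in>set L. jump_path s x ((e, m) ## \<omega>) r = y} =
          {\<omega> \<in> space tick_stream. \<forall>(r, y)\<in>set L'. jump_path r1 x ((e - a, m) ## \<omega>) r = y}"
          using 1 2 True by (fastforce simp: L_def)
        with True show ?thesis by (simp add: inner_def)
      next
        case False
        then have E0: "{\<omega> \<in> space tick_stream. \<forall>(r, y)\<in>set L. jump_path s x ((e, m) ## \<omega>) r = y} = {}"
          using 1 by (auto simp: L_def)
        show ?thesis unfolding inner_def E0 using False by simp
      qed
    qed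
    then show ?thesis unfolding I_def J_def by simp
  qed
  note TI = tick_space_integral[OF inner(1)[of L s], folded I_def]
  have i1: "integrable lborel (\<lambda>e. indicator {..a} e * (exponential_density rate e * I e))"
    using integrable_real_mult_indicator[OF _ TI(2), of "{..a}"] by (simp add: mult.commute)
  have i2: "integrable lborel (\<lambda>e. indicator {a<..} e * (exponential_density rate e * I e))"
    using integrable_real_mult_indicator[OF _ TI(2), of "{a<..}"] by (simp add: mult.commute)
  have "match s x L = (LBINT e. exponential_density rate e * I e)"
    using inner(2) TI(1) by simp
  also have "\<dots> = (LBINT e. indicator {..a} e * (exponential_density rate e * I e) + indicator {a<..} e * (exponential_density rate e * I e))"
    by (intro Bochner_Integration.integral_cong) (auto simp: indicator_def)
  also have "\<dots> = (LBINT e. indicator {..a} e * (exponential_density rate e * I e)) + (LBINT e. indicator {a<..} e * (exponential_density rate e * I e))"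
    by (rule Bochner_Integration.integral_add[OF i1 i2])
  also have "(LBINT e. indicator {..a} e * (exponential_density rate e * I e)) =
      (LBINT v. indicator {..a} (- s + 1 * v) * (exponential_density rate (- s + 1 * v) * I (- s + 1 * v)))"
    using lborel_integral_real_affine[of 1 "\<lambda>e. indicator {..a} e * (exponential_density rate e * I e)" "- s"] by simp
  also have "\<dots> = (LBINT v:{s..r1}. exp (- rate * (v - s)) *
      (rate * match v x L + (\<Sum>z\<in>S. q v x z * (match v z L - match v x L))))"
    unfolding set_lebesgue_integral_def
  proof (intro Bochner_Integration.integral_cong refl)
    fix v
    have "rate * A v = rate * match v x L + (\<Sum>z\<in>S. q v x z * (match v z L - match v x L))"
      using rate_pos by (simp add: A_def field_simps)
    note A = this[symmetric]
    have I: "I (- s + 1 * v) = A v" if "v \<le> r1" using I1[of "- s + v"] that by simp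
    have ed: "exponential_density rate (- s + 1 * v) = exp (- rate * (v - s)) * rate" if "s \<le> v"
      using that by (simp add: exponential_density_def algebra_simps)
    have ed0: "exponential_density rate (- s + 1 * v) = 0" if "v < s"
      using that by (simp add: exponential_density_def)
    show "indicator {..a} (- s + 1 * v) * (exponential_density rate (- s + 1 * v) * I (- s + 1 * v)) =
      indicator {s..r1} v *\<^sub>R (exp (- rate * (v - s)) *
      (rate * match v x L + (\<Sum>z\<in>S. q v x z * (match v z L - match v x L))))"
      unfolding A using I ed ed0 by (cases "v < s"; cases "v \<le> r1") (auto simp: indicator_def a_def)
  qed
  also have "(LBINT e. indicator {a<..} e * (exponential_density rate e * I e)) =
      (LBINT v. indicator {a<..} (a + 1 * v) * (exponential_density rate (a + 1 * v) * I (a + 1 * v)))"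
    using lborel_integral_real_affine[of 1 "\<lambda>e. indicator {a<..} e * (exponential_density rate e * I e)" a] by simp
  \<comment> \<open>Memorylessness: after the shift by a, the density splits off the factor exp (-
    rate * a).\<close>
  also have "\<dots> = (LBINT v. exp (- rate * (r1 - s)) * (if x = y1 then 1 else 0) * (exponential_density rate v * J v))"
  proof (rule integral_cong_AE)
    have TJ: "integrable lborel (\<lambda>e. exponential_density rate e * J e)"
      using tick_space_integral(2)[OF inner(1)[of L' r1], folded J_def] .
    then show "(\<lambda>v. exp (- rate * (r1 - s)) * (if x = y1 then 1 else 0) * (exponential_density rate v * J v)) \<in> borel_measurable lborel"
      by (intro borel_measurable_times[OF borel_measurable_const] borel_measurable_integrable)
    have "(\<lambda>e. indicator {a<..} e * (exponential_density rate e * I e)) \<in> borel_measurable borel"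
      using i2 by auto
    then show "(\<lambda>v. indicator {a<..} (a + 1 * v) * (exponential_density rate (a + 1 * v) * I (a + 1 * v))) \<in> borel_measurable lborel"
      using measurable_compose[of "\<lambda>v. a + 1 * v" lborel borel] by fastforce
    \<comment> \<open>The point v = 0 must be left out: there the indicator vanishes but the
      exponential density does not.\<close>
    have "AE v in lborel. v \<noteq> (0::real)" by (rule AE_lborel_singleton)
    then show "AE v in lborel. indicator {a<..} (a + 1 * v) * (exponential_density rate (a + 1 * v) * I (a + 1 * v)) =
       exp (- rate * (r1 - s)) * (if x = y1 then 1 else 0) * (exponential_density rate v * J v)"
    proof eventually_elim
      case (elim v)
      show ?case
      proof (cases "v > 0")
        case True
        have "I (a + v) = (if x = y1 then J v else 0)" using I2[of "a + v"] True by (simp add: a_def)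
        moreover have "exponential_density rate (a + v) = exp (- rate * (r1 - s)) * exponential_density rate v"
          using True s by (auto simp: exponential_density_def a_def algebra_simps simp flip: exp_add)
        ultimately show ?thesis using True by simp
      next
        case False
        then show ?thesis using elim by (simp add: exponential_density_def)
      qed
    qed
  qed
  also have "\<dots> = exp (- rate * (r1 - s)) * (if x = y1 then match r1 x L' else 0)"
    using inner(2)[of r1 L'] tick_space_integral(1)[OF inner(1)[of L' r1], folded J_def]
    by (cases "x = y1") simp_all
  finally show ?thesis .
qed

text \<open>The renewal equation on the degenerate interval {r1..r1}, where the integral is zero and
  the exponential is one.\<close>

lemma match_at_start:
  assumes x: "x \<in> S" and L': "\<And>r y. (r, y) \<in> set L' \<Longrightarrow> r1 \<le> r"
  shows "match r1 x ((r1, y1) # L') = (if x = y1 then match r1 x L' else 0)"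
  using match_renewal[where ?y1.0=y1 and L'=L', OF x order_refl L'] by (simp add: set_integral_singleton)

text \<open>Kolmogorov's backward equation, integrated from s0. Multiplying the renewal equation by
  exp (- rate * (u - s0)) makes its integrand independent of u, so the product is an indefinite
  integral in u. The product rule then removes the factor, and the terms with the artificial clock
  rate cancel.\<close>

lemma match_backward:
  fixes y1 :: 's
  assumes x: "x \<in> S" and s: "s0 \<le> r1" and L': "\<And>r y. (r, y) \<in> set L' \<Longrightarrow> r1 \<le> r"
  defines "L \<equiv> (r1, y1) # L'"
  shows "set_integrable lborel {s0..r1} (\<lambda>v. - (\<Sum>z\<in>S. q v x z * (match v z L - match v x L)))"
    and "\<And>u. u \<in> {s0..r1} \<Longrightarrow> match u x L = match s0 x L +
      (LBINT v:{s0..u}. - (\<Sum>z\<in>S. q v x z * (match v z L - match v x L)))"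
proof -
  define G where "G v = (\<Sum>z\<in>S. q v x z * (match v z L - match v x L))" for v
  define H where "H v = rate * match v x L + G v" for v
  note [measurable] = match_measurable[OF x]
  have Gm[measurable]: "G \<in> borel_measurable borel" unfolding G_def[abs_def]
  proof (rule borel_measurable_sum)
    fix z assume z: "z \<in> S"
    note [measurable] = q_meas[OF x z] match_measurable[OF z]
    show "(\<lambda>v. q v x z * (match v z L - match v x L)) \<in> borel_measurable borel" by measurable
  qed
  have Gb: "\<bar>G v\<bar> \<le> (\<Sum>z\<in>S. B * 1)" for v
    unfolding G_def
  proof (rule order_trans[OF sum_abs sum_mono])
    fix z assume z: "z \<in> S"
    have "\<bar>match v z L - match v x L\<bar> \<le> 1"
      using match_bounds[of v z L] match_bounds[of v x L] by linarith
    then show "\<bar>q v x z * (match v z L - match v x L)\<bar> \<le> B * 1"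
      unfolding abs_mult using q_nonneg[OF x z] q_le[OF x z] B_pos by (intro mult_mono) auto
  qed
  have Hm[measurable]: "H \<in> borel_measurable borel" unfolding H_def[abs_def] by measurable
  have Hb: "\<bar>H v\<bar> \<le> rate + (\<Sum>z\<in>S. B * 1)" for v
  proof -
    have "\<bar>rate * match v x L\<bar> \<le> rate" using match_bounds[of v x L] rate_pos by (simp add: abs_mult mult_left_le)
    then show ?thesis unfolding H_def using Gb[of v] by linarith
  qed
  have iG: "set_integrable lborel {s0..r1} (\<lambda>v. - G v)"
    by (rule set_integrable_bounded_restrict[where a=s0 and b=r1, OF measurable_restrict_space1])
      (use Gb in auto)
  then show "set_integrable lborel {s0..r1} (\<lambda>v. - (\<Sum>z\<in>S. q v x z * (match v z L - match v x L)))"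
    by (simp add: G_def)
  have iH: "set_integrable lborel {s0..r1} H"
    by (rule set_integrable_bounded_restrict[where a=s0 and b=r1, OF measurable_restrict_space1])
      (use Hb in auto)
  define h where "h v = exp (- rate * (v - s0)) * H v" for v
  have ih: "set_integrable lborel {s0..r1} h"
    unfolding h_def[abs_def] by (rule set_integrable_continuous_mult[OF iH]) (intro continuous_intros)
  define a where "a u = exp (- rate * (u - s0)) * match u x L" for u
  have ren: "a u = (LBINT v:{u..r1}. h v) + exp (- rate * (r1 - s0)) * match r1 x L" if u: "u \<in> {s0..r1}" for u
  proof -
    have "match u x L = (LBINT v:{u..r1}. exp (- rate * (v - u)) * H v) + exp (- rate * (r1 - u)) * match r1 x L"
      using match_renewal[where ?y1.0=y1 and s=u and L'=L', OF x _ L'] match_at_start[where ?y1.0=y1 and L'=L', OF x L'] u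
      by (simp add: L_def H_def G_def)
    then have A: "a u = (LBINT v:{u..r1}. exp (- rate * (u - s0)) * (exp (- rate * (v - u)) * H v)) +
       exp (- rate * (u - s0)) * exp (- rate * (r1 - u)) * match r1 x L"
      unfolding a_def by (simp only: set_integral_mult_right distrib_left mult.assoc)
    have E1: "exp (- rate * (u - s0)) * (exp (- rate * (v - u)) * H v) = h v" for v
      by (simp add: h_def algebra_simps flip: exp_add mult.assoc)
    have E2: "exp (- rate * (u - s0)) * exp (- rate * (r1 - u)) = exp (- rate * (r1 - s0))"
      by (simp add: algebra_simps flip: exp_add)
    show ?thesis using A unfolding E1 E2 .
  qed
  have a0: "a s0 = match s0 x L" by (simp add: a_def)
  \<comment> \<open>The integral over {u..r1} is the one over {s0..r1} minus the one over {s0..u};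
    the case u = s0 of \<open>ren\<close> fixes the constant.\<close>
  have au: "a u = match s0 x L + (LBINT v:{s0..u}. - h v)" if u: "u \<in> {s0..r1}" for u
    using ren[OF u] ren[of s0] set_integral_Icc_split[of s0 u r1 h, OF _ _ ih] u s a0
    by (simp add: set_lebesgue_integral_def)
  fix u assume u: "u \<in> {s0..r1}"
  have iu: "set_integrable lborel {s0..u} (\<lambda>v. - h v)"
    using set_integrable_Icc_subset[OF set_integrable_mult_right[OF ih, of "-1"]] u by simp
  have "exp (rate * (u - s0)) * a u = match s0 x L + (LBINT v:{s0..u}. exp (rate * (v - s0)) * (- h v + rate * a v))"
    by (rule exp_product_rule(2)[OF _ iu]) (use u au in auto)
  moreover have "exp (rate * (v - s0)) * (- h v + rate * a v) = - G v" for v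
  proof -
    have e: "exp (rate * (v - s0)) * exp (- rate * (v - s0)) = 1" by (simp flip: exp_add)
    have "exp (rate * (v - s0)) * (- h v + rate * a v) =
      (exp (rate * (v - s0)) * exp (- rate * (v - s0))) * (- H v + rate * match v x L)"
      by (simp add: h_def a_def algebra_simps)
    then show ?thesis unfolding e by (simp add: H_def)
  qed
  moreover have "exp (rate * (u - s0)) * a u = match u x L"
    by (simp add: a_def flip: exp_add mult.assoc)
  ultimately show "match u x L = match s0 x L + (LBINT v:{s0..u}. - (\<Sum>z\<in>S. q v x z * (match v z L - match v x L)))"
    by (simp add: G_def)
qed

text \<open>Duality: by the forward equation for \<open>p s x\<close> and the backward equation for \<open>match\<close>, the sum
  \<open>\<Sum>y\<in>S. p s x u y * match u y L\<close> does not depend on \<open>u\<close>.\<close>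

lemma match_Cons:
  assumes p: "transition_function S q t T p" and s: "s \<in> {t..T}" and r1: "r1 \<in> {s..T}"
    and x: "x \<in> S" and y1: "y1 \<in> S" and L': "\<And>r y. (r, y) \<in> set L' \<Longrightarrow> r1 \<le> r"
  shows "match s x ((r1, y1) # L') = p s x r1 y1 * match r1 y1 L'"
proof -
  let ?L = "(r1, y1) # L'"
  let ?a' = "\<lambda>y u. \<Sum>z\<in>S - {y}. p s x u z * q u z y - p s x u y * q u y z"
  let ?c' = "\<lambda>y v. - (\<Sum>z\<in>S. q v y z * (match v z ?L - match v y ?L))"
  have sr: "s \<le> r1" using r1 by simp
  have fw: "p s x u y = (if x = y then 1 else 0) + (LBINT v:{s..u}. ?a' y v)"
     "set_integrable lborel {s..u} (?a' y)"
    if "u \<in> {s..r1}" "y \<in> S" for u y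
    using p s r1 x that unfolding transition_function_def by auto
  have pr: "p s x r1 y * match r1 y ?L = (if x = y then 1 else 0) * match s y ?L +
      (LBINT u:{s..r1}. ?a' y u * match u y ?L + p s x u y * ?c' y u)" 
     "set_integrable lborel {s..r1} (\<lambda>u. ?a' y u * match u y ?L + p s x u y * ?c' y u)" if y: "y \<in> S" for y
  proof -
    have 1: "set_integrable lborel {s..r1} (?a' y)" using fw(2)[OF _ y, of r1] sr by simp
    note B = match_backward[where ?y1.0=y1 and L'=L', OF y sr L']
    note P = set_integral_product_rule[OF sr 1 B(1) fw(1)[OF _ y] B(2)]
    show "set_integrable lborel {s..r1} (\<lambda>u. ?a' y u * match u y ?L + p s x u y * ?c' y u)"
      using set_integral_add(1)[OF P(1,2)] by simp
    show "p s x r1 y * match r1 y ?L = (if x = y then 1 else 0) * match s y ?L +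
      (LBINT u:{s..r1}. ?a' y u * match u y ?L + p s x u y * ?c' y u)"
      using P(3) set_integral_add(2)[OF P(1,2)] by simp
  qed
  \<comment> \<open>The forward operator on p and the generator on \<open>match\<close> are adjoint
    and enter with opposite signs, so the derivative of the pairing vanishes at every u.\<close>
  have z: "(\<Sum>y\<in>S. ?a' y u * match u y ?L + p s x u y * ?c' y u) = 0" for u
  proof -
    have "(\<Sum>z\<in>S. q u y z * (match u z ?L - match u y ?L)) = (\<Sum>z\<in>S - {y}. q u y z * (match u z ?L - match u y ?L))" if "y \<in> S" for y
      using that finite_S by (simp add: sum.remove[of S y])
    then have "(\<Sum>y\<in>S. p s x u y * ?c' y u) = - (\<Sum>y\<in>S. p s x u y * (\<Sum>z\<in>S - {y}. q u y z * (match u z ?L - match u y ?L)))"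
      by (simp add: sum_negf)
    then show ?thesis
      by (simp only: sum.distrib generator_adjoint[OF finite_S, of "p s x u" "q u" "\<lambda>y. match u y ?L"])
  qed
  have "(\<Sum>y\<in>S. p s x r1 y * match r1 y ?L) =
     (\<Sum>y\<in>S. (if x = y then 1 else 0) * match s y ?L) + (\<Sum>y\<in>S. LBINT u:{s..r1}. ?a' y u * match u y ?L + p s x u y * ?c' y u)"
    using pr(1) by (simp add: sum.distrib)
  also have "(\<Sum>y\<in>S. LBINT u:{s..r1}. ?a' y u * match u y ?L + p s x u y * ?c' y u) =
     (LBINT u:{s..r1}. (\<Sum>y\<in>S. ?a' y u * match u y ?L + p s x u y * ?c' y u))"
    unfolding set_lebesgue_integral_def scaleR_sum_right
    using pr(2) by (intro Bochner_Integration.integral_sum[symmetric]) (auto simp: set_integrable_def)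
  also have "\<dots> = 0" unfolding z by simp
  also have "(\<Sum>y\<in>S. (if x = y then 1 else 0) * match s y ?L) = match s x ?L"
    using x finite_S by (simp add: if_distrib[of "\<lambda>c. c * _"] cong: if_cong)
  finally have "match s x ?L = (\<Sum>y\<in>S. p s x r1 y * match r1 y ?L)" by simp
  \<comment> \<open>At u = r1 the first constraint is checked at its own time, so it selects the
    state y1.\<close>
  also have "\<dots> = (\<Sum>y\<in>S. if y = y1 then p s x r1 y * match r1 y L' else 0)"
    using match_at_start[OF _ L'] by (intro sum.cong) auto
  also have "\<dots> = p s x r1 y1 * match r1 y1 L'" using y1 finite_S by simp
  finally show ?thesis .
qed

end

text \<open>The forward operator is linear in m, so this estimate is the l1 Lipschitz bound required
  by \<open>simplex_flow\<close>.\<close>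

lemma sum_abs_generator_le:
  fixes m :: "'s \<Rightarrow> real" and q :: "'s \<Rightarrow> 's \<Rightarrow> real"
  assumes S: "finite S" and q: "\<And>x z. x \<in> S \<Longrightarrow> z \<in> S \<Longrightarrow> \<bar>q x z\<bar> \<le> B"
  shows "(\<Sum>y\<in>S. \<bar>\<Sum>z\<in>S - {y}. m z * q z y - m y * q y z\<bar>) \<le> 2 * B * card S * (\<Sum>y\<in>S. \<bar>m y\<bar>)"
proof -
  have "(\<Sum>y\<in>S. \<bar>\<Sum>z\<in>S - {y}. m z * q z y - m y * q y z\<bar>) \<le> (\<Sum>y\<in>S. \<Sum>z\<in>S. \<bar>m z\<bar> * B + \<bar>m y\<bar> * B)"
  proof (rule sum_mono)
    fix y assume y: "y \<in> S"
    have "\<bar>\<Sum>z\<in>S - {y}. m z * q z y - m y * q y z\<bar> \<le> (\<Sum>z\<in>S - {y}. \<bar>m z * q z y - m y * q y z\<bar>)"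
      by (rule sum_abs)
    also have "\<dots> \<le> (\<Sum>z\<in>S. \<bar>m z * q z y - m y * q y z\<bar>)"
      using S by (intro sum_mono2) auto
    also have "\<dots> \<le> (\<Sum>z\<in>S. \<bar>m z\<bar> * B + \<bar>m y\<bar> * B)"
    proof (rule sum_mono)
      fix z assume z: "z \<in> S"
      have "\<bar>m z * q z y - m y * q y z\<bar> \<le> \<bar>m z\<bar> * \<bar>q z y\<bar> + \<bar>m y\<bar> * \<bar>q y z\<bar>"
        using abs_triangle_ineq4[of "m z * q z y" "m y * q y z"] by (simp add: abs_mult)
      also have "\<dots> \<le> \<bar>m z\<bar> * B + \<bar>m y\<bar> * B"
        by (intro add_mono mult_left_mono q y z) auto
      finally show "\<bar>m z * q z y - m y * q y z\<bar> \<le> \<bar>m z\<bar> * B + \<bar>m y\<bar> * B" .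
    qed
    finally show "\<bar>\<Sum>z\<in>S - {y}. m z * q z y - m y * q y z\<bar> \<le> (\<Sum>z\<in>S. \<bar>m z\<bar> * B + \<bar>m y\<bar> * B)" .
  qed
  also have "\<dots> = 2 * B * card S * (\<Sum>y\<in>S. \<bar>m y\<bar>)"
    by (simp add: sum.distrib flip: sum_distrib_left sum_distrib_right)
  finally show ?thesis .
qed

section \<open>Transition function and Markov property of the constructed chain\<close>

context jump_rates
begin

text \<open>The forward equation is a flow on the probability vectors over S. The constant k is the
  clock rate, because mass leaves y at rate at most B towards each state.\<close>

lemma forward_solution_exists:
  assumes s: "s \<le> T" and x: "x \<in> S"
  shows "\<exists>\<mu>. \<forall>r\<in>{s..T}. \<mu> r \<in> prob_vectors S \<and> (\<forall>y\<in>S.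
    set_integrable lborel {s..r} (\<lambda>u. \<Sum>z\<in>S - {y}. \<mu> u z * q u z y - \<mu> u y * q u y z) \<and>
    \<mu> r y = (if x = y then 1 else 0) + (LBINT u:{s..r}. \<Sum>z\<in>S - {y}. \<mu> u z * q u z y - \<mu> u y * q u y z))"
proof -
  define b where "b u m y = (\<Sum>z\<in>S - {y}. m z * q u z y - m y * q u y z)" for u and m :: "'s \<Rightarrow> real" and y
  interpret simplex_flow S s T "\<lambda>y. if x = y then 1 else 0" b rate "2 * B * card S"
  proof
    show "finite S" "s \<le> T" "rate > 0" by (rule finite_S s rate_pos)+
    show "0 \<le> 2 * B * card S" using B_pos by simp
    show "(\<lambda>y. if x = y then 1 else 0) \<in> prob_vectors S"
      using x finite_S by (simp add: prob_vectors_def)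
    show "(\<Sum>y\<in>S. b u m y) = 0" for u m
      using generator_adjoint[OF finite_S, of m "q u" "\<lambda>_. 1"] by (simp add: b_def)
    show "- rate * m y \<le> b u m y" if "m \<in> prob_vectors S" "y \<in> S" for u m y
    proof -
      have m: "0 \<le> m z" if "z \<in> S" for z using \<open>m \<in> prob_vectors S\<close> that by (simp add: prob_vectors_def)
      have "- rate * m y = (\<Sum>z\<in>S. - (m y * B))" by (simp add: rate_def)
      also have "\<dots> \<le> (\<Sum>z\<in>S - {y}. - (m y * B))"
        unfolding sum_negf neg_le_iff_le using m[OF \<open>y \<in> S\<close>] B_pos finite_S by (intro sum_mono2) auto
      also have "\<dots> \<le> b u m y"
        unfolding b_def
      proof (rule sum_mono)
        fix z assume "z \<in> S - {y}"
        then have z: "z \<in> S" by simp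
        have "0 \<le> m z * q u z y" using m[OF z] q_nonneg[OF z \<open>y \<in> S\<close>] by simp
        moreover have "m y * q u y z \<le> m y * B" using m[OF \<open>y \<in> S\<close>] q_le[OF \<open>y \<in> S\<close> z] by (intro mult_left_mono) auto
        ultimately show "- (m y * B) \<le> m z * q u z y - m y * q u y z" by simp
      qed
      finally show ?thesis .
    qed
    show "(\<Sum>y\<in>S. \<bar>b u m y - b u m' y\<bar>) \<le> 2 * B * card S * (\<Sum>y\<in>S. \<bar>m y - m' y\<bar>)" for u m m'
    proof -
      have "b u m y - b u m' y = (\<Sum>z\<in>S - {y}. (m z - m' z) * q u z y - (m y - m' y) * q u y z)" for y
        by (simp add: b_def algebra_simps flip: sum_subtractf)
      then show ?thesis
        using sum_abs_generator_le[OF finite_S, of "q u" B "\<lambda>y. m y - m' y"] q_nonneg q_le by simp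
    qed
    show "(\<lambda>u. b u (\<mu> u) y) \<in> borel_measurable (restrict_space borel {s..T})"
      if \<mu>: "\<And>z. z \<in> S \<Longrightarrow> (\<lambda>u. \<mu> u z) \<in> borel_measurable (restrict_space borel {s..T})" and y: "y \<in> S" for \<mu> y
      unfolding b_def
    proof (intro borel_measurable_sum borel_measurable_diff borel_measurable_times)
      fix z assume "z \<in> S - {y}"
      then have z: "z \<in> S" by simp
      show "(\<lambda>u. \<mu> u z) \<in> borel_measurable (restrict_space borel {s..T})"
        "(\<lambda>u. \<mu> u y) \<in> borel_measurable (restrict_space borel {s..T})" by (rule \<mu> z y)+
      show "(\<lambda>u. q u z y) \<in> borel_measurable (restrict_space borel {s..T})"
        "(\<lambda>u. q u y z) \<in> borel_measurable (restrict_space borel {s..T})"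
        using q_meas y z by (auto intro: measurable_restrict_space1)
    qed
  qed
  show ?thesis
    using flow_solution by (intro exI[of _ flow]) (simp add: b_def)
qed

text \<open>A solution is chosen separately for each starting time and state. That these choices
  describe the constructed paths is the content of \<open>match_Cons\<close>, which holds for every
  transition function.\<close>

lemma transition_function_exists: "\<exists>p. transition_function S q t T p"
proof -
  define P where "P s x \<mu> \<longleftrightarrow> (\<forall>r\<in>{s..T}. \<mu> r \<in> prob_vectors S \<and> (\<forall>y\<in>S.
    set_integrable lborel {s..r} (\<lambda>u. \<Sum>z\<in>S - {y}. \<mu> u z * q u z y - \<mu> u y * q u y z) \<and>
    \<mu> r y = (if x = y then 1 else 0) + (LBINT u:{s..r}. \<Sum>z\<in>S - {y}. \<mu> u z * q u z y - \<mu> u y * q u y z)))"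
    for s x \<mu>
  define p where "p s x = (SOME \<mu>. P s x \<mu>)" for s x
  have "P s x (p s x)" if "s \<le> T" "x \<in> S" for s x
    unfolding p_def using forward_solution_exists[OF that, folded P_def] by (rule someI_ex[of "P s x"])
  then have P: "p s x r \<in> prob_vectors S \<and> (\<forall>y\<in>S.
    set_integrable lborel {s..r} (\<lambda>u. \<Sum>z\<in>S - {y}. p s x u z * q u z y - p s x u y * q u y z) \<and>
    p s x r y = (if x = y then 1 else 0) + (LBINT u:{s..r}. \<Sum>z\<in>S - {y}. p s x u z * q u z y - p s x u y * q u y z))"
    if "s \<in> {t..T}" "x \<in> S" "r \<in> {s..T}" for s x r using that unfolding P_def by simp
  have "transition_function S q t T p"
    unfolding transition_function_def
  proof (intro ballI)
    fix s r x assume "s \<in> {t..T}" "r \<in> {s..T}" "x \<in> S"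
    from P[OF this(1,3,2)] show "(\<forall>y\<in>S. 0 \<le> p s x r y) \<and> (\<Sum>y\<in>S. p s x r y) = 1 \<and> (\<forall>y\<in>S.
      set_integrable lborel {s..r} (\<lambda>u. \<Sum>z\<in>S - {y}. p s x u z * q u z y - p s x u y * q u y z) \<and>
      p s x r y = (if x = y then 1 else 0) + (LBINT u:{s..r}. \<Sum>z\<in>S - {y}. p s x u z * q u z y - p s x u y * q u y z))"
      unfolding prob_vectors_def by blast
  qed
  then show ?thesis by blast
qed

lemma match_Nil: "match s x [] = 1"
proof -
  interpret prob_space tick_stream by (rule prob_space_tick_stream)
  show ?thesis by (simp add: match_def prob_space)
qed

text \<open>The Markov property of the finite-dimensional distributions: \<open>match_Cons\<close>
  strips the constraints from the front of both lists until only (s, x) and (r, y) remain, and the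
  latter contributes the factor p s x r y. Sorted times keep \<open>match_Cons\<close> applicable
  throughout.\<close>

lemma match_append:
  assumes p: "transition_function S q t T p"
    and u: "u \<in> {t..s}" and s: "s \<in> {t..T}" and r: "r \<in> {s..T}"
    and x: "x \<in> S" and y: "y \<in> S" and z: "z \<in> S"
    and L: "sorted (map fst L)" "set L \<subseteq> {u..s} \<times> S"
  shows "match u z (L @ [(s, x), (r, y)]) = match u z (L @ [(s, x)]) * p s x r y"
  using u z L
proof (induction L arbitrary: u z)
  case Nil
  have "match u z [(s, x), (r, y)] = p u z s x * match s x [(r, y)]"
    by (rule match_Cons[OF p]) (use Nil s r x in auto)
  moreover have "match s x [(r, y)] = p s x r y * match r y []"
    by (rule match_Cons[OF p]) (use s r x y in auto)
  moreover have "match u z [(s, x)] = p u z s x * match s x []"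
    by (rule match_Cons[OF p]) (use Nil s x in auto)
  ultimately show ?case by (simp add: match_Nil)
next
  case (Cons c L)
  obtain r1 y1 where c: "c = (r1, y1)" by force
  have r1: "r1 \<in> {u..s}" "y1 \<in> S" and L: "set L \<subseteq> {r1..s} \<times> S" "sorted (map fst L)"
    using Cons.prems by (fastforce simp: c)+
  have ge: "r1 \<le> r'" if "(r', y') \<in> set (L @ [(s, x), (r, y)])" for r' y'
    using that L r1 r by auto
  have ge': "r1 \<le> r'" if "(r', y') \<in> set (L @ [(s, x)])" for r' y'
    using that L r1 r by auto
  have "match u z ((r1, y1) # (L @ [(s, x), (r, y)])) = p u z r1 y1 * match r1 y1 (L @ [(s, x), (r, y)])"
    by (rule match_Cons[OF p _ _ _ _ ge]) (use Cons.prems s r1 in auto)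
  moreover have "match u z ((r1, y1) # (L @ [(s, x)])) = p u z r1 y1 * match r1 y1 (L @ [(s, x)])"
    by (rule match_Cons[OF p _ _ _ _ ge']) (use Cons.prems s r1 in auto)
  moreover have "match r1 y1 (L @ [(s, x), (r, y)]) = match r1 y1 (L @ [(s, x)]) * p s x r y"
    by (rule Cons.IH) (use Cons.prems r1 L in auto)
  ultimately show ?case by (simp add: c)
qed

text \<open>The law of the paths is transported to the set \<open>Reg\<close> of regular paths,
  because regularity is demanded of every \<omega> and not only of almost every one. The Markov
  property for all events of the past follows from the finite-dimensional distributions by a
  \<pi>-\<lambda> argument.\<close>

theorem markov_chain_exists:
  assumes x0: "x0 \<in> S" and tT: "t \<le> T"
  shows "\<exists>M :: (real \<Rightarrow> 's) measure. markov_chain_with_rates S q t T x0 M (\<lambda>s \<omega>. \<omega> s)"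
proof -
  obtain p where p: "transition_function S q t T p" using transition_function_exists by blast
  interpret TS: prob_space tick_stream by (rule prob_space_tick_stream)
  define Reg where "Reg = {w. (\<forall>s\<in>{t..T}. w s \<in> S) \<and> regular t T w}"
  define gens where "gens = {{w \<in> Reg. w u \<in> B} | u B. u \<in> {t..T} \<and> B \<subseteq> S}"
  define N where "N = sigma Reg gens"
  \<comment> \<open>On the null event where the clock never passes T, a constant path is
    substituted, so that \<Phi> maps the whole space into \<open>Reg\<close>.\<close>
  define \<Phi> where "\<Phi> \<omega> = (if \<exists>n. T < tick n t \<omega> then jump_path t x0 \<omega> else (\<lambda>_. x0))" for \<omega>
  have gP: "gens \<subseteq> Pow Reg" by (auto simp: gens_def)
  have tm: "(\<lambda>\<omega>. tick n t \<omega>) \<in> borel_measurable tick_stream" for n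
    using measurable_compose[OF _ tick_measurable[of n], of "\<lambda>\<omega>. (t, \<omega>)" tick_stream] by simp
  note [measurable] = tm
  have \<Phi>r: "(\<lambda>\<omega>. \<Phi> \<omega> r) \<in> measurable tick_stream (count_space S)" for r
  proof -
    have "(\<lambda>\<omega>. if \<exists>n. T < tick n t \<omega> then jump_path t x0 \<omega> r else x0) \<in> measurable tick_stream (count_space S)"
      using x0 jump_path_measurable_stream[OF x0, of t r] by (intro measurable_If) (auto, measurable)
    moreover have "\<Phi> \<omega> r = (if \<exists>n. T < tick n t \<omega> then jump_path t x0 \<omega> r else x0)" for \<omega> by (simp add: \<Phi>_def)
    ultimately show ?thesis by simp
  qed
  have \<Phi>Reg: "\<Phi> \<omega> \<in> Reg" if "\<omega> \<in> space tick_stream" for \<omega>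
  proof -
    have "\<Phi> \<omega> s \<in> S" for s using measurable_space[OF \<Phi>r that] by simp
    moreover have "regular t T (\<Phi> \<omega>)"
    proof (cases "\<exists>n. T < tick n t \<omega>")
      case True
      then show ?thesis using jump_path_regular by (auto simp: \<Phi>_def)
    next
      case False
      then show ?thesis by (auto simp: \<Phi>_def regular_def)
    qed
    ultimately show ?thesis by (simp add: Reg_def)
  qed
  have \<Phi>m: "\<Phi> \<in> measurable tick_stream N"
    unfolding N_def
  proof (rule measurable_measure_of[OF gP])
    show "\<Phi> \<in> space tick_stream \<rightarrow> Reg" using \<Phi>Reg by auto
    fix Y assume "Y \<in> gens"
    then obtain u B where Y: "Y = {w \<in> Reg. w u \<in> B}" "B \<subseteq> S" by (auto simp: gens_def)
    have "\<Phi> -` Y \<inter> space tick_stream = (\<lambda>\<omega>. \<Phi> \<omega> u) -` B \<inter> space tick_stream"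
      using \<Phi>Reg Y by auto
    also have "\<dots> \<in> sets tick_stream" using measurable_sets[OF \<Phi>r] Y by simp
    finally show "\<Phi> -` Y \<inter> space tick_stream \<in> sets tick_stream" .
  qed
  define M where "M = distr tick_stream N \<Phi>"
  interpret M: prob_space M unfolding M_def by (rule TS.prob_space_distr[OF \<Phi>m])
  have spM: "space M = Reg" by (simp add: M_def N_def space_measure_of[OF gP])
  have gM: "gens \<subseteq> sets M" by (auto simp: M_def N_def sets_measure_of[OF gP])
  define E where "E L = {w \<in> Reg. \<forall>(r, y)\<in>set L. w r = y}" for L :: "(real \<times> 's) list"
  have Xm: "{w \<in> Reg. w u \<in> B} \<in> sets M" if "u \<in> {t..T}" "B \<subseteq> S" for u B
    using gM that by (auto simp: gens_def)
  have X: "(\<lambda>w. w u) \<in> measurable M (count_space S)" if u: "u \<in> {t..T}" for u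
  proof (rule measurableI)
    show "w u \<in> space (count_space S)" if "w \<in> space M" for w using that u by (auto simp: spM Reg_def)
    fix B assume "B \<in> sets (count_space S)"
    then have "B \<subseteq> S" by simp
    moreover have "(\<lambda>w. w u) -` B \<inter> space M = {w \<in> Reg. w u \<in> B}" by (auto simp: spM)
    ultimately show "(\<lambda>w. w u) -` B \<inter> space M \<in> sets M" using Xm[OF u] by simp
  qed
  have Em: "E L \<in> sets M" if "set L \<subseteq> {t..T} \<times> S" for L
  proof -
    have "{w \<in> space M. w (fst c) = snd c} \<in> sets M" if "c \<in> set L" for c
    proof -
      have c: "fst c \<in> {t..T}" "snd c \<in> S" using that \<open>set L \<subseteq> {t..T} \<times> S\<close> by auto
      have "{w \<in> space M. w (fst c) = snd c} = {w \<in> Reg. w (fst c) \<in> {snd c}}" by (auto simp: spM)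
      then show ?thesis using Xm[of "fst c" "{snd c}"] c by simp
    qed
    then have "{w \<in> space M. \<forall>c\<in>set L. w (fst c) = snd c} \<in> sets M"
      by (intro sets.sets_Collect_finite_All) auto
    then show ?thesis by (simp add: E_def spM case_prod_beta)
  qed
  have ME: "measure M (E L) = match t x0 L" if L: "set L \<subseteq> {t..T} \<times> S" for L
  proof -
    let ?Y = "{\<omega> \<in> space tick_stream. \<forall>(r, y)\<in>set L. jump_path t x0 \<omega> r = y}"
    have "measure M (E L) = measure tick_stream (\<Phi> -` E L \<inter> space tick_stream)"
      unfolding M_def using Em[OF L] by (intro measure_distr \<Phi>m) (simp add: M_def)
    also have "\<dots> = measure tick_stream ?Y"
    proof (rule TS.finite_measure_eq_AE)
      show "\<Phi> -` E L \<inter> space tick_stream \<in> sets tick_stream"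
        using Em[OF L] by (intro measurable_sets[OF \<Phi>m]) (simp add: M_def)
      show "?Y \<in> sets tick_stream" by (rule sets_match[OF x0])
      show "AE \<omega> in tick_stream. (\<omega> \<in> \<Phi> -` E L \<inter> space tick_stream) = (\<omega> \<in> ?Y)"
        using AE_tick_gt[of T t] AE_space
      proof eventually_elim
        case (elim \<omega>)
        then have "\<Phi> \<omega> = jump_path t x0 \<omega>" by (simp add: \<Phi>_def)
        then show ?case using elim(2) \<Phi>Reg[OF elim(2)] by (auto simp: E_def)
      qed
    qed
    finally show ?thesis by (simp add: match_def)
  qed
  have start: "AE w in M. w t = x0"
  proof -
    have "measure M (E [(t, x0)]) = match t x0 [(t, x0)]" using x0 tT by (intro ME) auto
    also have "\<dots> = 1" using match_at_start[of x0 "[]" t x0] x0 by (simp add: match_Nil)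
    finally have "AE w in M. w \<in> E [(t, x0)]" by (rule M.AE_prob_1)
    then show ?thesis by eventually_elim (simp add: E_def)
  qed
  have markov: "measure M {\<omega>\<in>D. \<omega> s = x \<and> \<omega> r = y} = measure M {\<omega>\<in>D. \<omega> s = x} * p s x r y"
    if s: "s \<in> {t..T}" and r: "r \<in> {s..T}" and x: "x \<in> S" and y: "y \<in> S"
      and D: "D \<in> sigma_sets (space M) {(\<lambda>\<omega>. \<omega> u) -` B \<inter> space M | u B. u \<in> {t..s} \<and> B \<subseteq> S}"
    for s r x y D
  proof -
    \<comment> \<open>Cylinder events with sorted times. An intersection of two of them belongs to
      the joined and re-sorted list, and sortedness is what \<open>match_append\<close>
      requires.\<close>
    define G where "G = {E L | L. sorted (map fst L) \<and> set L \<subseteq> {t..s} \<times> S}"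
    have GM: "G \<subseteq> sets M" unfolding G_def using Em s by (fastforce intro!: Em)
    have GP: "G \<subseteq> Pow Reg" by (auto simp: G_def E_def)
    have "Int_stable G"
    proof (rule Int_stableI)
      fix a b assume "a \<in> G" "b \<in> G"
      then obtain L L' where L: "a = E L" "b = E L'" "set L \<subseteq> {t..s} \<times> S" "set L' \<subseteq> {t..s} \<times> S"
        by (auto simp: G_def)
      have "a \<inter> b = E (sort_key fst (L @ L'))"
        unfolding L(1,2) E_def set_sort set_append ball_Un by (intro set_eqI) (simp only: Int_iff mem_Collect_eq, argo)
      moreover have "sorted (map fst (sort_key fst (L @ L')))" by (rule sorted_sort_key)
      ultimately show "a \<inter> b \<in> G" using L unfolding G_def
        by (intro CollectI exI[of _ "sort_key fst (L @ L')"]) auto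
    qed
    have sub: "sigma_sets (space M) {(\<lambda>\<omega>. \<omega> u) -` B \<inter> space M | u B. u \<in> {t..s} \<and> B \<subseteq> S} \<subseteq> sigma_sets Reg G"
      unfolding spM
    proof (rule sigma_sets_mono, rule subsetI)
      interpret sigma_algebra Reg "sigma_sets Reg G" by (rule sigma_algebra_sigma_sets[OF GP])
      fix a assume "a \<in> {(\<lambda>\<omega>. \<omega> u) -` B \<inter> Reg | u B. u \<in> {t..s} \<and> B \<subseteq> S}"
      then obtain u B where a: "a = (\<lambda>\<omega>. \<omega> u) -` B \<inter> Reg" "u \<in> {t..s}" "B \<subseteq> S" by auto
      \<comment> \<open>As S is finite, each generator of the past is a finite union of cylinders
        with one constraint.\<close>
      have "a = (\<Union>z\<in>B. E [(u, z)])" by (auto simp: a E_def)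
      also have "\<dots> \<in> sigma_sets Reg G"
      proof (rule finite_UN)
        show "finite B" using a finite_S by (auto intro: finite_subset)
        show "E [(u, z)] \<in> sigma_sets Reg G" if "z \<in> B" for z
          using a that unfolding G_def by (intro sigma_sets.Basic CollectI exI[of _ "[(u, z)]"]) auto
      qed
      finally show "a \<in> sigma_sets Reg G" .
    qed
    have setsG: "A \<in> sets M" if "A \<in> sigma_sets Reg G" for A
      using sets.sigma_sets_subset[OF GM] that by (auto simp: spM)
    have rT: "r \<in> {t..T}" using r s by auto
    have S1: "{\<omega>\<in>A. \<omega> s = x} \<in> sets M" "{\<omega>\<in>A. \<omega> s = x \<and> \<omega> r = y} \<in> sets M" if "A \<in> sigma_sets Reg G" for A
    proof -
      have AR: "A \<subseteq> Reg" using sets.sets_into_space[OF setsG[OF that]] by (simp add: spM)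
      have "{\<omega>\<in>A. \<omega> s = x} = A \<inter> {w\<in>Reg. w s \<in> {x}}"
        "{\<omega>\<in>A. \<omega> s = x \<and> \<omega> r = y} = A \<inter> {w\<in>Reg. w s \<in> {x}} \<inter> {w\<in>Reg. w r \<in> {y}}"
        using AR by auto
      then show "{\<omega>\<in>A. \<omega> s = x} \<in> sets M" "{\<omega>\<in>A. \<omega> s = x \<and> \<omega> r = y} \<in> sets M"
        using setsG[OF that] Xm[OF s, of "{x}"] Xm[OF rT, of "{y}"] x y by auto
    qed
    have fdd: "measure M {\<omega>\<in>E L. \<omega> s = x \<and> \<omega> r = y} = measure M {\<omega>\<in>E L. \<omega> s = x} * p s x r y"
      if L: "sorted (map fst L)" "set L \<subseteq> {t..s} \<times> S" for L
    proof -
      have "{\<omega>\<in>E L. \<omega> s = x \<and> \<omega> r = y} = E (L @ [(s, x), (r, y)])"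
        "{\<omega>\<in>E L. \<omega> s = x} = E (L @ [(s, x)])" by (auto simp: E_def)
      moreover have "measure M (E (L @ [(s, x), (r, y)])) = match t x0 (L @ [(s, x), (r, y)])"
        using L s rT x y by (intro ME) auto
      moreover have "measure M (E (L @ [(s, x)])) = match t x0 (L @ [(s, x)])"
        using L s rT x y by (intro ME) auto
      moreover have "match t x0 (L @ [(s, x), (r, y)]) = match t x0 (L @ [(s, x)]) * p s x r y"
        by (rule match_append[OF p _ s r x y x0]) (use L s in auto)
      ultimately show ?thesis by simp
    qed
    have "D \<in> sigma_sets Reg G" using D sub by blast
    with \<open>Int_stable G\<close> GP show ?thesis
    proof (induction rule: sigma_sets_induct_disjoint)
      case (basic A)
      then show ?case using fdd by (auto simp: G_def)
    next
      case empty
      show ?case by simp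
    next
      case (compl A)
      have RG: "Reg \<in> sigma_sets Reg G" by (rule sigma_sets_top)
      \<comment> \<open>The whole space is the cylinder of the empty list.\<close>
      have R: "measure M {\<omega>\<in>Reg. \<omega> s = x \<and> \<omega> r = y} = measure M {\<omega>\<in>Reg. \<omega> s = x} * p s x r y"
        using fdd[of "[]"] by (simp add: E_def)
      have AR: "A \<subseteq> Reg" using sets.sets_into_space[OF setsG[OF compl(1)]] by (simp add: spM)
      have e: "{\<omega>\<in>Reg - A. \<omega> s = x \<and> \<omega> r = y} = {\<omega>\<in>Reg. \<omega> s = x \<and> \<omega> r = y} - {\<omega>\<in>A. \<omega> s = x \<and> \<omega> r = y}"
        "{\<omega>\<in>Reg - A. \<omega> s = x} = {\<omega>\<in>Reg. \<omega> s = x} - {\<omega>\<in>A. \<omega> s = x}" by auto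
      have d1: "measure M ({\<omega>\<in>Reg. \<omega> s = x \<and> \<omega> r = y} - {\<omega>\<in>A. \<omega> s = x \<and> \<omega> r = y}) =
          measure M {\<omega>\<in>Reg. \<omega> s = x \<and> \<omega> r = y} - measure M {\<omega>\<in>A. \<omega> s = x \<and> \<omega> r = y}"
        using AR by (intro M.finite_measure_Diff S1 RG compl) auto
      have d2: "measure M ({\<omega>\<in>Reg. \<omega> s = x} - {\<omega>\<in>A. \<omega> s = x}) =
          measure M {\<omega>\<in>Reg. \<omega> s = x} - measure M {\<omega>\<in>A. \<omega> s = x}"
        using AR by (intro M.finite_measure_Diff S1 RG compl) auto
      show ?case unfolding e d1 d2 R compl(2) by (simp add: left_diff_distrib)
    next
      case (union A)
      have A: "A i \<in> sigma_sets Reg G" for i using union(2) by auto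
      have "(\<lambda>i. measure M {\<omega>\<in>A i. \<omega> s = x \<and> \<omega> r = y}) sums measure M (\<Union>i. {\<omega>\<in>A i. \<omega> s = x \<and> \<omega> r = y})"
        using S1[OF A] union(1) by (intro M.finite_measure_UNION) (auto simp: disjoint_family_on_def, blast)
      moreover have "(\<lambda>i. measure M {\<omega>\<in>A i. \<omega> s = x}) sums measure M (\<Union>i. {\<omega>\<in>A i. \<omega> s = x})"
        using S1[OF A] union(1) by (intro M.finite_measure_UNION) (auto simp: disjoint_family_on_def, blast)
      then have "(\<lambda>i. measure M {\<omega>\<in>A i. \<omega> s = x \<and> \<omega> r = y}) sums (measure M (\<Union>i. {\<omega>\<in>A i. \<omega> s = x}) * p s x r y)"
        using sums_mult2 union(3) by fastforce
      ultimately have "measure M (\<Union>i. {\<omega>\<in>A i. \<omega> s = x \<and> \<omega> r = y}) = measure M (\<Union>i. {\<omega>\<in>A i. \<omega> s = x}) * p s x r y"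
        by (rule sums_unique2)
      moreover have "{\<omega>\<in>\<Union> (range A). \<omega> s = x \<and> \<omega> r = y} = (\<Union>i. {\<omega>\<in>A i. \<omega> s = x \<and> \<omega> r = y})"
        "{\<omega>\<in>\<Union> (range A). \<omega> s = x} = (\<Union>i. {\<omega>\<in>A i. \<omega> s = x})" by auto
      ultimately show ?case by simp
    qed
  qed
  have "markov_chain_with_rates S q t T x0 M (\<lambda>s \<omega>. \<omega> s)"
    unfolding markov_chain_with_rates_def
  proof (intro conjI)
    show "prob_space M" by (rule M.prob_space_axioms)
    show "\<forall>s\<in>{t..T}. (\<lambda>\<omega>. \<omega> s) \<in> measurable M (count_space S)" using X by simp
    show "AE \<omega> in M. \<omega> t = x0" by (rule start)
    show "\<forall>\<omega>\<in>space M. (\<forall>s\<in>{t..<T}. \<forall>\<^sub>F r in at_right s. \<omega> r = \<omega> s) \<and> (\<forall>s\<in>{t<..T}. \<exists>x. \<forall>\<^sub>F r in at_left s. \<omega> r = x)"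
      by (simp add: spM Reg_def regular_def)
    show "\<exists>p. transition_function S q t T p \<and>
        (\<forall>s\<in>{t..T}. \<forall>r\<in>{s..T}. \<forall>x\<in>S. \<forall>y\<in>S.
         \<forall>E \<in> sigma_sets (space M) {(\<lambda>\<omega>. \<omega> u) -` B \<inter> space M | u B. u \<in> {t..s} \<and> B \<subseteq> S}.
           measure M {\<omega>\<in>E. \<omega> s = x \<and> \<omega> r = y} = measure M {\<omega>\<in>E. \<omega> s = x} * p s x r y)"
      using p markov by blast
  qed
  then show ?thesis by blast
qed

end

subsection \<open>Second moments of bounded chains\<close>

text \<open>Any realisation of a chain on any probability space. Only the defining properties are at
  hand, so the results apply to every chain that enters the infimum.\<close>

locale bounded_chain =
  fixes S :: "'s set" and q :: "real \<Rightarrow> 's \<Rightarrow> 's \<Rightarrow> real" and t T :: real and x0 :: 's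
    and M :: "'w measure" and X :: "real \<Rightarrow> 'w \<Rightarrow> 's" and B :: real
  assumes finite_S: "finite S" and tT: "t \<le> T" and x0: "x0 \<in> S"
    and chain: "markov_chain_with_rates S q t T x0 M X"
    and q_meas: "\<And>x z. x \<in> S \<Longrightarrow> z \<in> S \<Longrightarrow> (\<lambda>u. q u x z) \<in> borel_measurable (restrict_space borel {t..T})"
    and q_bound: "\<And>u x z. u \<in> {t..T} \<Longrightarrow> x \<in> S \<Longrightarrow> z \<in> S \<Longrightarrow> \<bar>q u x z\<bar> \<le> B"
begin

sublocale prob_space M
  using chain by (simp add: markov_chain_with_rates_def)

lemma X_measurable: "s \<in> {t..T} \<Longrightarrow> X s \<in> measurable M (count_space S)"
  using chain by (simp add: markov_chain_with_rates_def)

lemma X_in: "s \<in> {t..T} \<Longrightarrow> \<omega> \<in> space M \<Longrightarrow> X s \<omega> \<in> S"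
  using measurable_space[OF X_measurable] by simp

lemma X_right: "\<omega> \<in> space M \<Longrightarrow> s \<in> {t..<T} \<Longrightarrow> \<forall>\<^sub>F r in at_right s. X r \<omega> = X s \<omega>"
  using chain unfolding markov_chain_with_rates_def by blast

lemma X_start: "AE \<omega> in M. X t \<omega> = x0"
  using chain by (simp add: markov_chain_with_rates_def)

text \<open>Projection of the line onto {t..T}; composed with it, the chain is indexed by all real
  times and always has its values in S.\<close>

definition clip :: "real \<Rightarrow> real" where "clip s = max t (min T s)"

lemma clip: "clip s \<in> {t..T}" "s \<in> {t..T} \<Longrightarrow> clip s = s"
  using tT by (auto simp: clip_def max_def min_def)

lemma clip_measurable[measurable]: "clip \<in> borel_measurable borel"
  unfolding clip_def[abs_def] by measurable

text \<open>In a discrete space, right-continuity says that X at time s is the eventual value of X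
  along times tending to s from the right. These times are taken from a grid of mesh 1 / (n + 1), so
  each approximation involves countably many time points and is jointly measurable; the limit is a
  limit inferior of events.\<close>

lemma jointly_measurable: "(\<lambda>p. X (clip (fst p)) (snd p)) \<in> measurable (borel \<Otimes>\<^sub>M M) (count_space S)"
proof -
  let ?N = "borel \<Otimes>\<^sub>M M :: (real \<times> 'w) measure"
  define k where "k n s = nat \<lfloor>(clip s - t) * real (Suc n)\<rfloor>" for n s
  \<comment> \<open>The index j + 1 gives the grid point strictly to the right of the current time,
    at distance at most 1 / (n + 1); cut off at T, it equals T when the current time is T.\<close>
  define a where "a n j = min T (t + (real j + 1) / real (Suc n))" for n j
  have a_in: "a n j \<in> {t..T}" for n j using tT by (auto simp: a_def)
  have km: "(\<lambda>p. k n (fst p)) \<in> measurable ?N (count_space UNIV)" for n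
    unfolding k_def by measurable
  have m: "(\<lambda>p. X (a n (k n (fst p))) (snd p)) \<in> measurable ?N (count_space S)" for n
    by (rule measurable_compose_countable'[where I=UNIV and f="\<lambda>j p. X (a n j) (snd p)" and g="\<lambda>p. k n (fst p)"])
       (use km X_measurable[OF a_in] in auto)
  have bounds: "clip s < t + (real (k n s) + 1) / real (Suc n)" "t + (real (k n s) + 1) / real (Suc n) \<le> clip s + inverse (real (Suc n))" for n s
  proof -
    have nn: "0 \<le> (clip s - t) * real (Suc n)" using clip(1)[of s] by auto
    then have r: "real (k n s) = of_int \<lfloor>(clip s - t) * real (Suc n)\<rfloor>" by (simp add: k_def)
    have "(clip s - t) * real (Suc n) < real (k n s) + 1" unfolding r by linarith
    then have "clip s - t < (real (k n s) + 1) / real (Suc n)" by (simp add: pos_less_divide_eq)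
    then show "clip s < t + (real (k n s) + 1) / real (Suc n)" by linarith
    have "real (k n s) \<le> (clip s - t) * real (Suc n)" unfolding r by linarith
    then have "real (k n s) / real (Suc n) \<le> clip s - t" by (simp add: pos_divide_le_eq)
    then show "t + (real (k n s) + 1) / real (Suc n) \<le> clip s + inverse (real (Suc n))"
      by (simp add: add_divide_distrib inverse_eq_divide)
  qed
  have ev: "\<forall>\<^sub>F n in sequentially. X (a n (k n s)) \<omega> = X (clip s) \<omega>" if \<omega>: "\<omega> \<in> space M" for s \<omega>
  proof -
   have bd: "clip s < t + (real (k n s) + 1) / real (Suc n)"
     "t + (real (k n s) + 1) / real (Suc n) \<le> clip s + inverse (real (Suc n))" for n by (rule bounds)+
   show ?thesis
   proof (cases "clip s < T")
    case True
    then have "\<forall>\<^sub>F r in at_right (clip s). X r \<omega> = X (clip s) \<omega>"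
      using X_right[OF \<omega>, of "clip s"] clip(1)[of s] by auto
    then obtain b where b: "b > clip s" "\<And>r. clip s < r \<Longrightarrow> r < b \<Longrightarrow> X r \<omega> = X (clip s) \<omega>"
      unfolding eventually_at_right_field by blast
    have "\<forall>\<^sub>F n in sequentially. inverse (real (Suc n)) < b - clip s"
      using order_tendstoD(2)[OF LIMSEQ_inverse_real_of_nat, of "b - clip s"] b by simp
    then show ?thesis
    proof eventually_elim
      case (elim n)
      have "clip s < a n (k n s)" "a n (k n s) < b" using bd[of n] elim True unfolding a_def by linarith+
      then show ?case by (rule b(2))
    qed
  next
    case False
    then have "clip s = T" using clip(1)[of s] by simp
    then have "a n (k n s) = clip s" for n using bd(1)[of n] by (simp add: a_def)
    then show ?thesis by simp
   qed
  qed
  show ?thesis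
  proof (rule measurableI)
    show "X (clip (fst p)) (snd p) \<in> space (count_space S)" if "p \<in> space ?N" for p
      using that X_in[OF clip(1)] by (auto simp: space_pair_measure)
    fix A assume "A \<in> sets (count_space S)"
    then have A: "A \<subseteq> S" by simp
    have eq: "(\<lambda>p. X (clip (fst p)) (snd p)) -` A \<inter> space ?N =
      (\<Union>n0. \<Inter>n\<in>{n0..}. (\<lambda>p. X (a n (k n (fst p))) (snd p)) -` A \<inter> space ?N)" (is "?l = ?r")
    proof (rule set_eqI)
      fix p
      show "p \<in> ?l \<longleftrightarrow> p \<in> ?r"
      proof (cases "p \<in> space ?N")
        case True
        then have "snd p \<in> space M" by (auto simp: space_pair_measure)
        from ev[OF this, of "fst p"] obtain n1 where n1: "\<And>n. n \<ge> n1 \<Longrightarrow> X (a n (k n (fst p))) (snd p) = X (clip (fst p)) (snd p)"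
          by (auto simp: eventually_sequentially)
        have "p \<in> ?r \<longleftrightarrow> (\<exists>n0. \<forall>n\<ge>n0. X (a n (k n (fst p))) (snd p) \<in> A)" using True by auto
        also have "\<dots> \<longleftrightarrow> X (clip (fst p)) (snd p) \<in> A"
        proof
          assume "\<exists>n0. \<forall>n\<ge>n0. X (a n (k n (fst p))) (snd p) \<in> A"
          then obtain n0 where n0: "\<And>n. n \<ge> n0 \<Longrightarrow> X (a n (k n (fst p))) (snd p) \<in> A" by blast
          show "X (clip (fst p)) (snd p) \<in> A" using n0[of "max n0 n1"] n1[of "max n0 n1"] by simp
        next
          assume "X (clip (fst p)) (snd p) \<in> A"
          then show "\<exists>n0. \<forall>n\<ge>n0. X (a n (k n (fst p))) (snd p) \<in> A"
            using n1 by (intro exI[of _ n1]) simp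
        qed
        finally show ?thesis using True by auto
      qed auto
    qed
    show "(\<lambda>p. X (clip (fst p)) (snd p)) -` A \<inter> space ?N \<in> sets ?N"
    proof -
      have "(\<lambda>p. X (a n (k n (fst p))) (snd p)) -` A \<inter> space ?N \<in> sets ?N" for n
        using measurable_sets[OF m] A by simp
      then have "(\<Inter>n\<in>{n0..}. (\<lambda>p. X (a n (k n (fst p))) (snd p)) -` A \<inter> space ?N) \<in> sets ?N" for n0
        by (intro sets.countable_INT') blast+
      then show ?thesis unfolding eq by (intro sets.countable_UN) blast
    qed
  qed
qed

lemma jointly_measurable_fun:
  fixes h :: "real \<Rightarrow> 's \<Rightarrow> real"
  assumes h: "\<And>x. x \<in> S \<Longrightarrow> (\<lambda>u. h u x) \<in> borel_measurable (restrict_space borel {t..T})"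
  shows "(\<lambda>p. indicator {t..T} (fst p) * h (fst p) (X (fst p) (snd p))) \<in> borel_measurable (borel \<Otimes>\<^sub>M M)"
proof -
  have "(\<lambda>p. (\<lambda>x p. indicator {t..T} (fst p) * h (fst p) x) (X (clip (fst p)) (snd p)) p) \<in> borel_measurable (borel \<Otimes>\<^sub>M M)"
  proof (rule measurable_compose_countable'[OF _ jointly_measurable])
    fix x assume x: "x \<in> S"
    have [measurable]: "(\<lambda>u. indicator {t..T} u * h u x) \<in> borel_measurable borel"
      using h[OF x] by (simp add: borel_measurable_restrict_space_iff)
    show "(\<lambda>p. indicator {t..T} (fst p) * h (fst p) x) \<in> borel_measurable (borel \<Otimes>\<^sub>M M)"
      using measurable_compose[OF measurable_fst, of "\<lambda>u. indicator {t..T} u * h u x" borel borel M] by simp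
  qed (use finite_S in \<open>auto intro: countable_finite\<close>)
  moreover have "indicator {t..T} (fst p) * h (fst p) (X (clip (fst p)) (snd p)) =
    indicator {t..T} (fst p) * h (fst p) (X (fst p) (snd p))" for p :: "real \<times> 'w"
    using clip(2)[of "fst p"] by (auto simp: indicator_def)
  ultimately show ?thesis by simp
qed

lemma X_fun_measurable: "s \<in> {t..T} \<Longrightarrow> (\<lambda>\<omega>. f (X s \<omega>)) \<in> borel_measurable M" for f :: "'s \<Rightarrow> real"
  using measurable_compose[OF X_measurable, of s f borel] by simp

lemma finite_bound:
  fixes f :: "'s \<Rightarrow> real"
  obtains C where "C \<ge> 0" "\<And>x. x \<in> S \<Longrightarrow> \<bar>f x\<bar> \<le> C"
proof -
  have "\<bar>f x\<bar> \<le> (\<Sum>x\<in>S. \<bar>f x\<bar>)" if "x \<in> S" for x using finite_S that by (intro member_le_sum) auto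
  then show ?thesis by (intro that[of "\<Sum>x\<in>S. \<bar>f x\<bar>"]) (auto intro: sum_nonneg)
qed

lemma X_fun_integrable: "s \<in> {t..T} \<Longrightarrow> integrable M (\<lambda>\<omega>. f (X s \<omega>))" for f :: "'s \<Rightarrow> real"
proof -
  assume s: "s \<in> {t..T}"
  obtain C where C: "\<And>x. x \<in> S \<Longrightarrow> \<bar>f x\<bar> \<le> C" using finite_bound[of f] by blast
  show ?thesis
    by (rule integrable_const_bound[where B=C, OF _ X_fun_measurable[OF s]]) (use C X_in[OF s] in auto)
qed

definition gen :: "real \<Rightarrow> ('s \<Rightarrow> real) \<Rightarrow> 's \<Rightarrow> real" where
  "gen u \<phi> x = (\<Sum>z\<in>S - {x}. q u x z * (\<phi> z - \<phi> x))"

lemma gen_measurable: "x \<in> S \<Longrightarrow> (\<lambda>u. gen u \<phi> x) \<in> borel_measurable (restrict_space borel {t..T})"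
  unfolding gen_def by (intro borel_measurable_sum borel_measurable_times q_meas) auto

lemma gen_bound:
  obtains C where "C \<ge> 0" "\<And>u x. u \<in> {t..T} \<Longrightarrow> x \<in> S \<Longrightarrow> \<bar>gen u \<phi> x\<bar> \<le> C"
proof -
  obtain C where C: "C \<ge> 0" "\<And>x. x \<in> S \<Longrightarrow> \<bar>\<phi> x\<bar> \<le> C" using finite_bound[of \<phi>] by blast
  have B: "B \<ge> 0" using q_bound[of t x0 x0] tT x0 by force
  show ?thesis
  proof (rule that[of "\<Sum>z\<in>S. B * (2 * C)"])
    show "0 \<le> (\<Sum>z\<in>S. B * (2 * C))" using B C by (intro sum_nonneg) auto
    fix u x assume u: "u \<in> {t..T}" and x: "x \<in> S"
    have "\<bar>gen u \<phi> x\<bar> \<le> (\<Sum>z\<in>S - {x}. \<bar>q u x z * (\<phi> z - \<phi> x)\<bar>)" unfolding gen_def by (rule sum_abs)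
    also have "\<dots> \<le> (\<Sum>z\<in>S - {x}. B * (2 * C))"
    proof (rule sum_mono)
      fix z assume "z \<in> S - {x}"
      then have "\<bar>\<phi> z - \<phi> x\<bar> \<le> 2 * C" using C(2)[of z] C(2)[OF x] by auto
      then show "\<bar>q u x z * (\<phi> z - \<phi> x)\<bar> \<le> B * (2 * C)"
        unfolding abs_mult using q_bound[OF u x, of z] \<open>z \<in> S - {x}\<close> B by (intro mult_mono) auto
    qed
    also have "\<dots> \<le> (\<Sum>z\<in>S. B * (2 * C))" using finite_S B C by (intro sum_mono2) auto
    finally show "\<bar>gen u \<phi> x\<bar> \<le> (\<Sum>z\<in>S. B * (2 * C))" .
  qed
qed

section \<open>Dynkin's formula and Fubini's theorem along the chain\<close>

definition mass :: "real \<Rightarrow> 's \<Rightarrow> real" where "mass s x = measure M {\<omega> \<in> space M. X s \<omega> = x}"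

lemma expectation_mass:
  fixes f :: "'s \<Rightarrow> real"
  assumes s: "s \<in> {t..T}"
  shows "expectation (\<lambda>\<omega>. f (X s \<omega>)) = (\<Sum>x\<in>S. mass s x * f x)"
proof -
  have m: "{\<omega> \<in> space M. X s \<omega> = x} \<in> sets M" if "x \<in> S" for x
  proof -
    have "{\<omega> \<in> space M. X s \<omega> = x} = X s -` {x} \<inter> space M" by auto
    then show ?thesis using measurable_sets[OF X_measurable[OF s], of "{x}"] that by simp
  qed
  have "expectation (\<lambda>\<omega>. f (X s \<omega>)) = expectation (\<lambda>\<omega>. \<Sum>x\<in>S. indicator {\<omega> \<in> space M. X s \<omega> = x} \<omega> * f x)"
  proof (rule Bochner_Integration.integral_cong[OF refl])
    fix \<omega> assume \<omega>: "\<omega> \<in> space M"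
    have "(\<Sum>x\<in>S. indicator {\<omega> \<in> space M. X s \<omega> = x} \<omega> * f x) = (\<Sum>x\<in>S. if x = X s \<omega> then f x else 0)"
      using \<omega> by (intro sum.cong) (auto simp: indicator_def)
    then show "f (X s \<omega>) = (\<Sum>x\<in>S. indicator {\<omega> \<in> space M. X s \<omega> = x} \<omega> * f x)"
      using X_in[OF s \<omega>] finite_S by simp
  qed
  also have "\<dots> = (\<Sum>x\<in>S. expectation (\<lambda>\<omega>. indicator {\<omega> \<in> space M. X s \<omega> = x} \<omega> * f x))"
    using m by (intro Bochner_Integration.integral_sum integrable_mult_left integrable_real_indicator)
      (auto simp: emeasure_eq_measure)
  also have "\<dots> = (\<Sum>x\<in>S. mass s x * f x)" using m by (simp add: mass_def)
  finally show ?thesis .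
qed

text \<open>By the Markov property the joint law of X s and X r is \<open>mass\<close> times the
  transition function. Testing the forward equation against \<phi> and moving its operator onto
  \<phi> gives the formula. The weight f (X s) is what the cross terms in
  \<open>second_moment\<close> call for.\<close>

lemma dynkin_two_times:
  assumes s: "s \<in> {t..T}" and r: "r \<in> {s..T}"
  shows "set_integrable lborel {s..r} (\<lambda>v. expectation (\<lambda>\<omega>. f (X s \<omega>) * gen v \<phi> (X v \<omega>)))"
    and "expectation (\<lambda>\<omega>. f (X s \<omega>) * \<phi> (X r \<omega>)) = expectation (\<lambda>\<omega>. f (X s \<omega>) * \<phi> (X s \<omega>)) +
      (LBINT v:{s..r}. expectation (\<lambda>\<omega>. f (X s \<omega>) * gen v \<phi> (X v \<omega>)))"
proof -
  have "\<exists>p. transition_function S q t T p \<and>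
        (\<forall>s\<in>{t..T}. \<forall>r\<in>{s..T}. \<forall>x\<in>S. \<forall>y\<in>S.
         \<forall>E \<in> sigma_sets (space M) {X u -` B \<inter> space M | u B. u \<in> {t..s} \<and> B \<subseteq> S}.
           measure M {\<omega>\<in>E. X s \<omega> = x \<and> X r \<omega> = y} = measure M {\<omega>\<in>E. X s \<omega> = x} * p s x r y)"
    using chain unfolding markov_chain_with_rates_def by (elim conjE)
  then obtain p where p: "transition_function S q t T p"
    and mk: "\<forall>s\<in>{t..T}. \<forall>r\<in>{s..T}. \<forall>x\<in>S. \<forall>y\<in>S.
         \<forall>E \<in> sigma_sets (space M) {X u -` B \<inter> space M | u B. u \<in> {t..s} \<and> B \<subseteq> S}.
           measure M {\<omega>\<in>E. X s \<omega> = x \<and> X r \<omega> = y} = measure M {\<omega>\<in>E. X s \<omega> = x} * p s x r y"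
    by (elim exE conjE)
  \<comment> \<open>The Markov property with E the whole space.\<close>
  have joint: "measure M {\<omega>\<in>space M. X s \<omega> = x \<and> X v \<omega> = y} = mass s x * p s x v y"
    if "v \<in> {s..T}" "x \<in> S" "y \<in> S" for v x y
    unfolding mass_def by (rule mk[rule_format, OF s that sigma_sets_top])
  have two: "expectation (\<lambda>\<omega>. f (X s \<omega>) * h (X v \<omega>)) = (\<Sum>x\<in>S. mass s x * f x * (\<Sum>y\<in>S. p s x v y * h y))"
    if v: "v \<in> {s..T}" for v h
  proof -
    have v': "v \<in> {t..T}" using v s by auto
    have m: "{\<omega> \<in> space M. X s \<omega> = x \<and> X v \<omega> = y} \<in> sets M" if "x \<in> S" "y \<in> S" for x y
    proof -
      have "{\<omega> \<in> space M. X s \<omega> = x \<and> X v \<omega> = y} = (X s -` {x} \<inter> space M) \<inter> (X v -` {y} \<inter> space M)" by auto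
      then show ?thesis
        using measurable_sets[OF X_measurable[OF s], of "{x}"] measurable_sets[OF X_measurable[OF v'], of "{y}"] that by simp
    qed
    let ?I = "\<lambda>x y \<omega>. indicator {\<omega> \<in> space M. X s \<omega> = x \<and> X v \<omega> = y} \<omega> :: real"
    have i: "integrable M (\<lambda>\<omega>. ?I x y \<omega> * (f x * h y))" if "x \<in> S" "y \<in> S" for x y
      using m[OF that] by (intro integrable_mult_left integrable_real_indicator) (auto simp: emeasure_eq_measure)
    have "expectation (\<lambda>\<omega>. f (X s \<omega>) * h (X v \<omega>)) = expectation (\<lambda>\<omega>. \<Sum>x\<in>S. \<Sum>y\<in>S. ?I x y \<omega> * (f x * h y))"
    proof (rule Bochner_Integration.integral_cong[OF refl])
      fix \<omega> assume \<omega>: "\<omega> \<in> space M"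
      have "(\<Sum>x\<in>S. \<Sum>y\<in>S. ?I x y \<omega> * (f x * h y)) = (\<Sum>x\<in>S. if x = X s \<omega> then (\<Sum>y\<in>S. if y = X v \<omega> then f x * h y else 0) else 0)"
      proof (rule sum.cong[OF refl])
        fix x
        have "?I x y \<omega> * (f x * h y) = (if x = X s \<omega> then if y = X v \<omega> then f x * h y else 0 else 0)" for y
          using \<omega> by (simp add: indicator_def)
        then show "(\<Sum>y\<in>S. ?I x y \<omega> * (f x * h y)) = (if x = X s \<omega> then \<Sum>y\<in>S. if y = X v \<omega> then f x * h y else 0 else 0)"
          by simp
      qed
      also have "\<dots> = f (X s \<omega>) * h (X v \<omega>)"
        using X_in[OF s \<omega>] X_in[OF v' \<omega>] finite_S by simp
      finally show "f (X s \<omega>) * h (X v \<omega>) = (\<Sum>x\<in>S. \<Sum>y\<in>S. ?I x y \<omega> * (f x * h y))" by simp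
    qed
    also have "\<dots> = (\<Sum>x\<in>S. \<Sum>y\<in>S. expectation (\<lambda>\<omega>. ?I x y \<omega> * (f x * h y)))"
      using i by (simp add: Bochner_Integration.integral_sum)
    also have "\<dots> = (\<Sum>x\<in>S. \<Sum>y\<in>S. mass s x * p s x v y * (f x * h y))"
      using m joint[OF v] by (intro sum.cong refl) simp
    also have "\<dots> = (\<Sum>x\<in>S. mass s x * f x * (\<Sum>y\<in>S. p s x v y * h y))"
      unfolding sum_distrib_left by (intro sum.cong refl) (simp only: mult_ac)
    finally show ?thesis .
  qed
  let ?a' = "\<lambda>x y u. \<Sum>z\<in>S - {y}. p s x u z * q u z y - p s x u y * q u y z"
  have fw: "set_integrable lborel {s..r} (?a' x y)"
    "p s x r y = (if x = y then 1 else 0) + (LBINT u:{s..r}. ?a' x y u)" if "x \<in> S" "y \<in> S" for x y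
    using p s r that unfolding transition_function_def by auto
  have adj: "(\<Sum>y\<in>S. ?a' x y v * \<phi> y) = (\<Sum>y\<in>S. p s x v y * gen v \<phi> y)" for x v
    unfolding gen_def by (rule generator_adjoint[OF finite_S])
  have i1: "set_integrable lborel {s..r} (\<lambda>v. \<Sum>y\<in>S. p s x v y * gen v \<phi> y)" if x: "x \<in> S" for x
    unfolding adj[symmetric] set_integrable_def scaleR_sum_right
  proof (rule Bochner_Integration.integrable_sum)
    fix y assume y: "y \<in> S"
    show "integrable lborel (\<lambda>v. indicator {s..r} v *\<^sub>R (?a' x y v * \<phi> y))"
      using set_integrable_mult_left[OF fw(1)[OF x y], of "\<phi> y"] by (simp add: set_integrable_def)
  qed
  have one: "(\<Sum>y\<in>S. p s x r y * \<phi> y) = \<phi> x + (LBINT v:{s..r}. \<Sum>y\<in>S. p s x v y * gen v \<phi> y)" if x: "x \<in> S" for x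
  proof -
    have "(\<Sum>y\<in>S. p s x r y * \<phi> y) = (\<Sum>y\<in>S. (if x = y then \<phi> y else 0) + (LBINT u:{s..r}. ?a' x y u * \<phi> y))"
      using fw(2)[OF x] by (intro sum.cong refl) (simp add: distrib_right)
    also have "\<dots> = \<phi> x + (\<Sum>y\<in>S. LBINT u:{s..r}. ?a' x y u * \<phi> y)"
      using x finite_S by (simp add: sum.distrib)
    also have "(\<Sum>y\<in>S. LBINT u:{s..r}. ?a' x y u * \<phi> y) = (LBINT u:{s..r}. \<Sum>y\<in>S. ?a' x y u * \<phi> y)"
      unfolding set_lebesgue_integral_def scaleR_sum_right
      using set_integrable_mult_left[OF fw(1)[OF x]]
      by (intro Bochner_Integration.integral_sum[symmetric]) (simp add: set_integrable_def)
    finally show ?thesis unfolding adj .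
  qed
  have cong: "expectation (\<lambda>\<omega>. f (X s \<omega>) * gen v \<phi> (X v \<omega>)) = (\<Sum>x\<in>S. mass s x * f x * (\<Sum>y\<in>S. p s x v y * gen v \<phi> y))"
    if "v \<in> {s..r}" for v
    using two[of v "gen v \<phi>"] that r by auto
  have i2: "set_integrable lborel {s..r} (\<lambda>v. mass s x * f x * (\<Sum>y\<in>S. p s x v y * gen v \<phi> y))" if "x \<in> S" for x
    by (intro set_integrable_mult_right i1 that)
  have i3: "set_integrable lborel {s..r} (\<lambda>v. \<Sum>x\<in>S. mass s x * f x * (\<Sum>y\<in>S. p s x v y * gen v \<phi> y))"
    using i2 unfolding set_integrable_def scaleR_sum_right by (intro Bochner_Integration.integrable_sum)
  then show "set_integrable lborel {s..r} (\<lambda>v. expectation (\<lambda>\<omega>. f (X s \<omega>) * gen v \<phi> (X v \<omega>)))"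
    by (rule set_integrable_cong[THEN iffD1, rotated -1]) (use cong in auto)
  have "expectation (\<lambda>\<omega>. f (X s \<omega>) * \<phi> (X r \<omega>)) = (\<Sum>x\<in>S. mass s x * f x * (\<phi> x + (LBINT v:{s..r}. \<Sum>y\<in>S. p s x v y * gen v \<phi> y)))"
    using two[of r \<phi>] r one by simp
  also have "\<dots> = (\<Sum>x\<in>S. mass s x * (f x * \<phi> x)) + (\<Sum>x\<in>S. LBINT v:{s..r}. mass s x * f x * (\<Sum>y\<in>S. p s x v y * gen v \<phi> y))"
    by (simp add: distrib_left sum.distrib mult.assoc)
  also have "(\<Sum>x\<in>S. LBINT v:{s..r}. mass s x * f x * (\<Sum>y\<in>S. p s x v y * gen v \<phi> y)) =
     (LBINT v:{s..r}. \<Sum>x\<in>S. mass s x * f x * (\<Sum>y\<in>S. p s x v y * gen v \<phi> y))"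
    unfolding set_lebesgue_integral_def scaleR_sum_right
    using i2 by (intro Bochner_Integration.integral_sum[symmetric]) (simp add: set_integrable_def)
  also have "\<dots> = (LBINT v:{s..r}. expectation (\<lambda>\<omega>. f (X s \<omega>) * gen v \<phi> (X v \<omega>)))"
    using cong by (intro set_lebesgue_integral_cong) auto
  also have "(\<Sum>x\<in>S. mass s x * (f x * \<phi> x)) = expectation (\<lambda>\<omega>. f (X s \<omega>) * \<phi> (X s \<omega>))"
    using expectation_mass[OF s, of "\<lambda>x. f x * \<phi> x"] by simp
  finally show "expectation (\<lambda>\<omega>. f (X s \<omega>) * \<phi> (X r \<omega>)) = expectation (\<lambda>\<omega>. f (X s \<omega>) * \<phi> (X s \<omega>)) +
      (LBINT v:{s..r}. expectation (\<lambda>\<omega>. f (X s \<omega>) * gen v \<phi> (X v \<omega>)))" .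
qed

lemma dynkin:
  assumes r: "r \<in> {t..T}"
  shows "set_integrable lborel {t..r} (\<lambda>v. expectation (\<lambda>\<omega>. gen v \<phi> (X v \<omega>)))"
    and "expectation (\<lambda>\<omega>. \<phi> (X r \<omega>)) = \<phi> x0 + (LBINT v:{t..r}. expectation (\<lambda>\<omega>. gen v \<phi> (X v \<omega>)))"
proof -
  have t: "t \<in> {t..T}" using tT by simp
  note D = dynkin_two_times[OF t r, of "\<lambda>_. 1" \<phi>]
  show "set_integrable lborel {t..r} (\<lambda>v. expectation (\<lambda>\<omega>. gen v \<phi> (X v \<omega>)))" using D(1) by simp
  have "expectation (\<lambda>\<omega>. \<phi> (X t \<omega>)) = expectation (\<lambda>\<omega>. \<phi> x0)"
    using X_start X_fun_measurable[OF t] by (intro integral_cong_AE) auto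
  then show "expectation (\<lambda>\<omega>. \<phi> (X r \<omega>)) = \<phi> x0 + (LBINT v:{t..r}. expectation (\<lambda>\<omega>. gen v \<phi> (X v \<omega>)))"
    using D(2) by (simp add: prob_space)
qed

text \<open>In \<open>second_moment\<close> the weight Z is in turn the value f (X r), the time
  integral Y itself and the integrand at a fixed time; elsewhere it is 1.\<close>

lemma fubini_expectation:
  fixes D :: "real \<Rightarrow> 'w \<Rightarrow> real"
  assumes Dm: "(\<lambda>p. D (fst p) (snd p)) \<in> borel_measurable (borel \<Otimes>\<^sub>M M)"
    and Db: "\<And>u \<omega>. \<omega> \<in> space M \<Longrightarrow> \<bar>D u \<omega>\<bar> \<le> C * indicator {a..b} u"
    and Zm: "Z \<in> borel_measurable M" and Zb: "\<And>\<omega>. \<omega> \<in> space M \<Longrightarrow> \<bar>Z \<omega>\<bar> \<le> K"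
  shows "integrable lborel (\<lambda>u. expectation (\<lambda>\<omega>. Z \<omega> * D u \<omega>))"
    and "expectation (\<lambda>\<omega>. Z \<omega> * (LBINT u. D u \<omega>)) = (LBINT u. expectation (\<lambda>\<omega>. Z \<omega> * D u \<omega>))"
    and "integrable M (\<lambda>\<omega>. Z \<omega> * (LBINT u. D u \<omega>))"
proof -
  interpret P: pair_sigma_finite lborel M by standard
  have [measurable]: "(\<lambda>(u, \<omega>). D u \<omega>) \<in> borel_measurable (lborel \<Otimes>\<^sub>M M)"
    using Dm by (simp add: case_prod_beta)
  note [measurable] = Zm
  have i: "integrable (lborel \<Otimes>\<^sub>M M) (\<lambda>(u, \<omega>). Z \<omega> * D u \<omega>)"
  proof (rule Bochner_Integration.integrable_bound[where f="\<lambda>(u, \<omega>). K * C * indicator {a..b} u"])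
    have "integrable (lborel \<Otimes>\<^sub>M M) (\<lambda>p. indicator {a..b} (fst p) * K * C :: real)"
    proof (rule P.Fubini_integrable)
      show "integrable lborel (\<lambda>u. \<integral>\<omega>. norm (indicator {a..b} (fst (u, \<omega>)) * K * C :: real) \<partial>M)"
        using emeasure_lborel_Icc_eq[of a b] by (simp add: abs_mult prob_space)
    qed auto
    then show "integrable (lborel \<Otimes>\<^sub>M M) (\<lambda>(u, \<omega>). (K * C * indicator {a..b} u))"
      by (simp add: mult_ac case_prod_beta')
    show "AE p in lborel \<Otimes>\<^sub>M M. norm (case p of (u, \<omega>) \<Rightarrow> Z \<omega> * D u \<omega>) \<le> norm (case p of (u, \<omega>) \<Rightarrow> K * C * indicator {a..b} u)"
    proof (rule AE_I2)
      fix p assume p: "p \<in> space (lborel \<Otimes>\<^sub>M M :: (real \<times> 'w) measure)"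
      obtain u \<omega> where p': "p = (u, \<omega>)" by force
      then have \<omega>: "\<omega> \<in> space M" using p by (simp add: space_pair_measure)
      have "\<bar>Z \<omega> * D u \<omega>\<bar> \<le> K * (C * indicator {a..b} u)"
        unfolding abs_mult using Zb[OF \<omega>] Db[OF \<omega>, of u] by (intro mult_mono) auto
      then show "norm (case p of (u, \<omega>) \<Rightarrow> Z \<omega> * D u \<omega>) \<le> norm (case p of (u, \<omega>) \<Rightarrow> K * C * indicator {a..b} u)"
        by (simp add: p' mult.assoc)
    qed
  qed measurable
  show "integrable lborel (\<lambda>u. expectation (\<lambda>\<omega>. Z \<omega> * D u \<omega>))"
    using P.integrable_fst[OF i] by simp
  have "(LBINT u. Z \<omega> * D u \<omega>) = Z \<omega> * (LBINT u. D u \<omega>)" for \<omega> by simp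
  then show "expectation (\<lambda>\<omega>. Z \<omega> * (LBINT u. D u \<omega>)) = (LBINT u. expectation (\<lambda>\<omega>. Z \<omega> * D u \<omega>))"
    using P.Fubini_integral[OF i] by simp
  show "integrable M (\<lambda>\<omega>. Z \<omega> * (LBINT u. D u \<omega>))"
    using P.integrable_snd[OF i] by simp
qed

end

lemma abs_set_integral_Icc_le:
  fixes h :: "real \<Rightarrow> real"
  assumes ab: "a \<le> b" and C: "C \<ge> 0" and h: "\<And>u. u \<in> {a..b} \<Longrightarrow> \<bar>h u\<bar> \<le> C"
  shows "\<bar>LBINT u:{a..b}. h u\<bar> \<le> C * (b - a)"
proof (cases "set_integrable lborel {a..b} h")
  case True
  have i: "set_integrable lborel {a..b} (\<lambda>_. C)"
    by (rule set_integrable_bounded_restrict[where a=a and b=b and B="\<bar>C\<bar>"]) auto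
  have "\<bar>LBINT u:{a..b}. h u\<bar> \<le> (LBINT u:{a..b}. \<bar>h u\<bar>)"
    using set_integral_norm_bound[OF True] by simp
  also have "\<dots> \<le> (LBINT u:{a..b}. C)"
    by (intro set_integral_mono set_integrable_abs True i h)
  also have "\<dots> = C * (b - a)" using ab by (simp add: set_lebesgue_integral_def)
  finally show ?thesis .
next
  \<comment> \<open>A function that is not integrable has integral 0 by convention.\<close>
  case False
  then have "(LBINT u:{a..b}. h u) = 0"
    unfolding set_integrable_def set_lebesgue_integral_def by (rule not_integrable_integral_eq)
  then show ?thesis using ab C by simp
qed

section \<open>Moments of the martingale part\<close>

context bounded_chain
begin

text \<open>Dynkin's martingale of \<phi>. For a coordinate function of the N-agent chain it is the
  amount by which the trajectory violates the integrated mean field equation.\<close>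

definition martingale_part :: "('s \<Rightarrow> real) \<Rightarrow> real \<Rightarrow> 'w \<Rightarrow> real" where
  "martingale_part \<phi> r \<omega> = \<phi> (X r \<omega>) - \<phi> x0 - (LBINT u:{t..r}. gen u \<phi> (X u \<omega>))"

lemma gen_diff_const: "gen u (\<lambda>x. \<phi> x - d) = gen u \<phi>"
  by (simp add: gen_def fun_eq_iff)

lemma path_section_measurable:
  assumes "(\<lambda>p. D (fst p) (snd p)) \<in> borel_measurable (borel \<Otimes>\<^sub>M M)" "\<omega> \<in> space M"
  shows "(\<lambda>u. D u \<omega>) \<in> borel_measurable borel"
  using measurable_compose[OF measurable_Pair2'[OF assms(2), of borel] assms(1)] by simp

text \<open>The martingale part is f (X r) - Y with Y the time integral of D, and its square is
  expanded. E f(X r)^2 is the integral of E gen (f^2), the cross term E f(X r) Y is the integral of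
  E f(X u) D u plus \<tau>, and E Y^2 = 2 \<tau>. So \<tau> cancels, and the integral of E (gen
  (f^2) - 2 f gen f) remains, whose integrand is the expected sum of rate times squared jump,
  bounded by c.\<close>

lemma second_moment:
  assumes r: "r \<in> {t..T}"
    and c: "\<And>u x. u \<in> {t..T} \<Longrightarrow> x \<in> S \<Longrightarrow> (\<Sum>z\<in>S - {x}. q u x z * (\<phi> z - \<phi> x)\<^sup>2) \<le> c"
  shows "integrable M (\<lambda>\<omega>. (martingale_part \<phi> r \<omega>)\<^sup>2)"
    and "expectation (\<lambda>\<omega>. (martingale_part \<phi> r \<omega>)\<^sup>2) \<le> c * (r - t)"
    and "martingale_part \<phi> r \<in> borel_measurable M"
proof -
  \<comment> \<open>Centring at the starting state leaves the generator unchanged and makes the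
    initial term of f^2 vanish.\<close>
  define f where "f x = \<phi> x - \<phi> x0" for x
  have gf: "gen u f = gen u \<phi>" for u unfolding f_def[abs_def] by (rule gen_diff_const)
  obtain C where C: "C \<ge> 0" "\<And>u x. u \<in> {t..T} \<Longrightarrow> x \<in> S \<Longrightarrow> \<bar>gen u \<phi> x\<bar> \<le> C"
    using gen_bound[of \<phi>] by blast
  obtain K where K: "K \<ge> 0" "\<And>x. x \<in> S \<Longrightarrow> \<bar>f x\<bar> \<le> K" using finite_bound[of f] by blast
  define D where "D u \<omega> = indicator {t..r} u * gen u \<phi> (X u \<omega>)" for u \<omega>
  define Y where "Y \<omega> = (LBINT u. D u \<omega>)" for \<omega>
  have Dm: "(\<lambda>p. D (fst p) (snd p)) \<in> borel_measurable (borel \<Otimes>\<^sub>M M)"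
  proof -
    have "(\<lambda>p. indicator {t..r} (fst p) * (indicator {t..T} (fst p) * gen (fst p) \<phi> (X (fst p) (snd p)))) \<in> borel_measurable (borel \<Otimes>\<^sub>M M)"
      using gen_measurable by (intro borel_measurable_times jointly_measurable_fun) measurable
    moreover have "D (fst p) (snd p) = indicator {t..r} (fst p) * (indicator {t..T} (fst p) * gen (fst p) \<phi> (X (fst p) (snd p)))" for p
      using r by (auto simp: D_def indicator_def)
    ultimately show ?thesis by simp
  qed
  have Db: "\<bar>D u \<omega>\<bar> \<le> C * indicator {t..r} u" if "\<omega> \<in> space M" for u \<omega>
    using C(2)[of u "X u \<omega>"] X_in[of u \<omega>] that r by (auto simp: D_def indicator_def)
  note FE = fubini_expectation[OF Dm Db, folded Y_def]
  have Ym: "Y \<in> borel_measurable M"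
    using FE(3)[of "\<lambda>_. 1" 1] by auto
  have Yb: "\<bar>Y \<omega>\<bar> \<le> C * (r - t)" if \<omega>: "\<omega> \<in> space M" for \<omega>
  proof -
    have iC: "integrable lborel (\<lambda>u. C * indicator {t..r} u)"
      using emeasure_lborel_Icc_eq[of t r] by (intro integrable_mult_right integrable_real_indicator) auto
    have i: "integrable lborel (\<lambda>u. D u \<omega>)"
      by (rule Bochner_Integration.integrable_bound[OF iC])
        (use path_section_measurable[OF Dm \<omega>] Db[OF \<omega>] C(1) in \<open>auto simp: abs_mult\<close>)
    have "\<bar>Y \<omega>\<bar> \<le> (LBINT u. \<bar>D u \<omega>\<bar>)" unfolding Y_def by (rule integral_abs_bound)
    also have "\<dots> \<le> (LBINT u. C * indicator {t..r} u)"
      using i iC Db[OF \<omega>] by (intro integral_mono) auto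
    also have "\<dots> = C * (r - t)" using r by simp
    finally show ?thesis .
  qed
  have Du: "(\<lambda>\<omega>. D u \<omega>) \<in> borel_measurable M" for u
    using measurable_compose[OF measurable_Pair1'[of u borel M] Dm] by simp
  have Db': "\<bar>D u \<omega>\<bar> \<le> C" if "\<omega> \<in> space M" for u \<omega>
    using Db[OF that, of u] C(1) by (cases "u \<in> {t..r}") auto
  have fm: "(\<lambda>\<omega>. f (X r \<omega>)) \<in> borel_measurable M" by (rule X_fun_measurable[OF r])
  have fb: "\<bar>f (X r \<omega>)\<bar> \<le> K" if "\<omega> \<in> space M" for \<omega> using K X_in[OF r that] by simp
  define g where "g u v = expectation (\<lambda>\<omega>. D u \<omega> * D v \<omega>)" for u v
  have g_sym: "g u v = g v u" for u v by (simp add: g_def mult.commute)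
  have gI: "integrable (lborel \<Otimes>\<^sub>M lborel) (\<lambda>(u, v). g u v)"
  proof (rule Bochner_Integration.integrable_bound[OF integrable_lborel_prod_mult])
    show "integrable lborel (\<lambda>u. C * indicator {t..r} u)" "integrable lborel (\<lambda>u. C * indicator {t..r} u)"
      using emeasure_lborel_Icc_eq[of t r] by (auto intro!: integrable_mult_right integrable_real_indicator)
    have 1: "(\<lambda>z. (fst (fst z), snd z)) \<in> measurable ((lborel \<Otimes>\<^sub>M lborel) \<Otimes>\<^sub>M M) (borel \<Otimes>\<^sub>M M)"
      and 2: "(\<lambda>z. (snd (fst z), snd z)) \<in> measurable ((lborel \<Otimes>\<^sub>M lborel) \<Otimes>\<^sub>M M) (borel \<Otimes>\<^sub>M M)"
      by measurable
    have "(\<lambda>z. D (fst (fst z)) (snd z) * D (snd (fst z)) (snd z)) \<in> borel_measurable ((lborel \<Otimes>\<^sub>M lborel) \<Otimes>\<^sub>M M)"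
      using measurable_compose[OF 1 Dm] measurable_compose[OF 2 Dm] by (intro borel_measurable_times) simp_all
    then have "(\<lambda>p. expectation (\<lambda>\<omega>. D (fst p) \<omega> * D (snd p) \<omega>)) \<in> borel_measurable (lborel \<Otimes>\<^sub>M lborel)"
      by (intro borel_measurable_lebesgue_integral) (simp add: case_prod_beta')
    then show "(\<lambda>(u, v). g u v) \<in> borel_measurable (lborel \<Otimes>\<^sub>M lborel)"
      by (simp add: g_def case_prod_beta')
    show "AE p in lborel \<Otimes>\<^sub>M lborel. norm (case p of (u, v) \<Rightarrow> g u v) \<le> norm (case p of (u, v) \<Rightarrow> C * indicator {t..r} u * (C * indicator {t..r} v))"
    proof (rule AE_I2)
      fix p :: "real \<times> real"
      obtain u v where p: "p = (u, v)" by force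
      have "\<bar>g u v\<bar> \<le> expectation (\<lambda>\<omega>. \<bar>D u \<omega> * D v \<omega>\<bar>)" unfolding g_def by (rule integral_abs_bound)
      also have "\<dots> \<le> expectation (\<lambda>\<omega>. C * indicator {t..r} u * (C * indicator {t..r} v))"
      proof (rule integral_mono)
        have b: "\<bar>D u \<omega> * D v \<omega>\<bar> \<le> C * indicator {t..r} u * (C * indicator {t..r} v)" if "\<omega> \<in> space M" for \<omega>
          unfolding abs_mult using Db[OF that] C(1) by (intro mult_mono) auto
        then show "\<bar>D u \<omega> * D v \<omega>\<bar> \<le> C * indicator {t..r} u * (C * indicator {t..r} v)" if "\<omega> \<in> space M" for \<omega> using that .
        show "integrable M (\<lambda>\<omega>. \<bar>D u \<omega> * D v \<omega>\<bar>)"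
          by (rule integrable_const_bound[where B="C * indicator {t..r} u * (C * indicator {t..r} v)"])
            (use Du b in auto)
      qed simp
      finally show "norm (case p of (u, v) \<Rightarrow> g u v) \<le> norm (case p of (u, v) \<Rightarrow> C * indicator {t..r} u * (C * indicator {t..r} v))"
        using C(1) by (simp add: p prob_space)
    qed
  qed
  \<comment> \<open>The correlation g of the integrand, integrated over one triangle; by the
    symmetry of g the other triangle gives the same value.\<close>
  define \<tau> where "\<tau> = (LBINT v. LBINT u. indicator {..v} u * g u v)"
  have YY: "expectation (\<lambda>\<omega>. Y \<omega> * Y \<omega>) = 2 * \<tau>"
  proof -
    have "expectation (\<lambda>\<omega>. Y \<omega> * Y \<omega>) = (LBINT u. expectation (\<lambda>\<omega>. Y \<omega> * D u \<omega>))"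
      by (rule FE(2)[OF _ Ym Yb])
    also have "\<dots> = (LBINT u. LBINT v. g u v)"
      using FE(2)[OF _ Du Db'] by (simp add: g_def mult.commute)
    also have "\<dots> = (LBINT u. LBINT v. indicator {..u} v * g u v) + \<tau>"
      unfolding \<tau>_def by (rule lborel_triangle_split[OF gI])
    also have "(LBINT u. LBINT v. indicator {..u} v * g u v) = (LBINT u. LBINT v. indicator {..u} v * g v u)"
      using g_sym by (intro Bochner_Integration.integral_cong refl) simp
    finally show ?thesis by (simp add: \<tau>_def)
  qed
  have hI: "integrable (lborel \<Otimes>\<^sub>M lborel) (\<lambda>(u, v). indicator {u..} v * g u v)"
  proof (rule Bochner_Integration.integrable_bound[OF gI])
    have "(\<lambda>p. (if fst p \<le> snd p then 1 else 0) * (case p of (u, v) \<Rightarrow> g u v)) \<in> borel_measurable (lborel \<Otimes>\<^sub>M lborel)"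
      by (rule borel_measurable_times[OF _ borel_measurable_integrable[OF gI]]) measurable
    moreover have "(\<lambda>(u, v). indicator {u..} v * g u v) = (\<lambda>p. (if fst p \<le> snd p then 1 else 0) * (case p of (u, v) \<Rightarrow> g u v))"
      by (auto simp: fun_eq_iff)
    ultimately show "(\<lambda>(u, v). indicator {u..} v * g u v) \<in> borel_measurable (lborel \<Otimes>\<^sub>M lborel)" by simp
  qed (auto simp: indicator_def)
  have hi: "integrable lborel (\<lambda>u. LBINT v. indicator {u..} v * g u v)"
    using lborel_pair.integrable_fst[OF hI] by simp
  have h\<tau>: "(LBINT u. LBINT v. indicator {u..} v * g u v) = \<tau>"
  proof -
    have "(LBINT u. LBINT v. indicator {u..} v * g u v) = (LBINT v. LBINT u. indicator {u..} v * g u v)"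
      using lborel_pair.Fubini_integral[OF hI] by simp
    also have "\<dots> = \<tau>" unfolding \<tau>_def
      by (intro Bochner_Integration.integral_cong refl) (auto simp: indicator_def)
    finally show ?thesis .
  qed
  \<comment> \<open>Dynkin's formula from u to r, weighted by the integrand at time u; for u outside
    {t..r} all terms vanish.\<close>
  have fD: "expectation (\<lambda>\<omega>. f (X r \<omega>) * D u \<omega>) = expectation (\<lambda>\<omega>. f (X u \<omega>) * D u \<omega>) + (LBINT v. indicator {u..} v * g u v)" for u
  proof (cases "u \<in> {t..r}")
    case True
    then have u: "u \<in> {t..T}" "r \<in> {u..T}" using r by auto
    have "(LBINT v. indicator {u..} v * g u v) = (LBINT v:{u..r}. expectation (\<lambda>\<omega>. gen u \<phi> (X u \<omega>) * gen v f (X v \<omega>)))"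
      unfolding set_lebesgue_integral_def g_def gf D_def using True
      by (intro Bochner_Integration.integral_cong refl) (auto simp: indicator_def)
    then show ?thesis
      using dynkin_two_times(2)[OF u, of "gen u \<phi>" f] True by (simp add: D_def mult.commute)
  next
    case False
    then have "D u \<omega> = 0" for \<omega> by (simp add: D_def)
    then show ?thesis by (simp add: g_def)
  qed
  have iF: "integrable lborel (\<lambda>u. expectation (\<lambda>\<omega>. f (X r \<omega>) * D u \<omega>))"
    by (rule FE(1)[OF _ fm fb])
  have iL: "integrable lborel (\<lambda>u. expectation (\<lambda>\<omega>. f (X u \<omega>) * D u \<omega>))"
    using Bochner_Integration.integrable_diff[OF iF hi] unfolding fD by simp
  have fY: "expectation (\<lambda>\<omega>. f (X r \<omega>) * Y \<omega>) = (LBINT u. expectation (\<lambda>\<omega>. f (X u \<omega>) * D u \<omega>)) + \<tau>"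
  proof -
    have "expectation (\<lambda>\<omega>. f (X r \<omega>) * Y \<omega>) = (LBINT u. expectation (\<lambda>\<omega>. f (X r \<omega>) * D u \<omega>))"
      by (rule FE(2)[OF _ fm fb])
    also have "\<dots> = (LBINT u. expectation (\<lambda>\<omega>. f (X u \<omega>) * D u \<omega>)) + \<tau>"
      unfolding fD Bochner_Integration.integral_add[OF iL hi] h\<tau> ..
    finally show ?thesis .
  qed
  note ff = dynkin[OF r, of "\<lambda>x. (f x)\<^sup>2"]
  have Lset: "(LBINT u. expectation (\<lambda>\<omega>. f (X u \<omega>) * D u \<omega>)) = (LBINT u:{t..r}. expectation (\<lambda>\<omega>. f (X u \<omega>) * gen u \<phi> (X u \<omega>)))"
    unfolding set_lebesgue_integral_def D_def
    by (intro Bochner_Integration.integral_cong refl) (auto simp: indicator_def)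
  have iL': "set_integrable lborel {t..r} (\<lambda>u. expectation (\<lambda>\<omega>. f (X u \<omega>) * gen u \<phi> (X u \<omega>)))"
    using iL unfolding set_integrable_def D_def
    by (rule Bochner_Integration.integrable_cong[THEN iffD1, rotated 2]) (auto simp: indicator_def)
  have Z: "martingale_part \<phi> r \<omega> = f (X r \<omega>) - Y \<omega>" for \<omega>
    by (simp add: martingale_part_def f_def Y_def D_def set_lebesgue_integral_def)
  then show Zm: "martingale_part \<phi> r \<in> borel_measurable M"
    using fm Ym by (simp add: borel_measurable_diff cong: measurable_cong)
  have i1: "integrable M (\<lambda>\<omega>. (f (X r \<omega>))\<^sup>2)" by (rule X_fun_integrable[OF r])
  have i2: "integrable M (\<lambda>\<omega>. f (X r \<omega>) * Y \<omega>)" by (rule FE(3)[OF _ fm fb])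
  have i3: "integrable M (\<lambda>\<omega>. Y \<omega> * Y \<omega>)" by (rule FE(3)[OF _ Ym Yb])
  have Z2: "(martingale_part \<phi> r \<omega>)\<^sup>2 = (f (X r \<omega>))\<^sup>2 - 2 * (f (X r \<omega>) * Y \<omega>) + Y \<omega> * Y \<omega>" for \<omega>
    unfolding Z by (simp add: power2_eq_square algebra_simps)
  show "integrable M (\<lambda>\<omega>. (martingale_part \<phi> r \<omega>)\<^sup>2)"
    unfolding Z2 using i1 i2 i3 by simp
  have "expectation (\<lambda>\<omega>. (martingale_part \<phi> r \<omega>)\<^sup>2) =
    expectation (\<lambda>\<omega>. (f (X r \<omega>))\<^sup>2) - 2 * expectation (\<lambda>\<omega>. f (X r \<omega>) * Y \<omega>) + expectation (\<lambda>\<omega>. Y \<omega> * Y \<omega>)"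
    unfolding Z2 using i1 i2 i3 by simp
  also have "\<dots> = (LBINT v:{t..r}. expectation (\<lambda>\<omega>. gen v (\<lambda>x. (f x)\<^sup>2) (X v \<omega>))) -
      2 * (LBINT u:{t..r}. expectation (\<lambda>\<omega>. f (X u \<omega>) * gen u \<phi> (X u \<omega>)))"
    unfolding fY YY Lset ff(2) by (simp add: f_def)
  also have "\<dots> = (LBINT v:{t..r}. expectation (\<lambda>\<omega>. gen v (\<lambda>x. (f x)\<^sup>2) (X v \<omega>)) -
      2 * expectation (\<lambda>\<omega>. f (X v \<omega>) * gen v \<phi> (X v \<omega>)))"
    using set_integral_diff(2)[OF ff(1) set_integrable_mult_right[OF iL'], of 2] by simp
  also have "\<dots> \<le> (LBINT v:{t..r}. c)"
  proof (rule set_integral_mono)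
    show "set_integrable lborel {t..r} (\<lambda>v. expectation (\<lambda>\<omega>. gen v (\<lambda>x. (f x)\<^sup>2) (X v \<omega>)) -
      2 * expectation (\<lambda>\<omega>. f (X v \<omega>) * gen v \<phi> (X v \<omega>)))"
      by (intro set_integral_diff(1) ff(1) set_integrable_mult_right iL')
    show "set_integrable lborel {t..r} (\<lambda>v. c)"
      by (rule set_integrable_bounded_restrict[where a=t and b=r and B="\<bar>c\<bar>"]) auto
    fix v assume "v \<in> {t..r}"
    then have v: "v \<in> {t..T}" using r by auto
    have "expectation (\<lambda>\<omega>. gen v (\<lambda>x. (f x)\<^sup>2) (X v \<omega>)) - 2 * expectation (\<lambda>\<omega>. f (X v \<omega>) * gen v \<phi> (X v \<omega>))
      = expectation (\<lambda>\<omega>. gen v (\<lambda>x. (f x)\<^sup>2) (X v \<omega>) - 2 * (f (X v \<omega>) * gen v \<phi> (X v \<omega>)))"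
      using X_fun_integrable[OF v, of "gen v (\<lambda>x. (f x)\<^sup>2)"] X_fun_integrable[OF v, of "\<lambda>x. f x * gen v \<phi> x"] by simp
    also have "\<dots> \<le> expectation (\<lambda>\<omega>. c)"
    proof (rule integral_mono)
      show "integrable M (\<lambda>\<omega>. gen v (\<lambda>x. (f x)\<^sup>2) (X v \<omega>) - 2 * (f (X v \<omega>) * gen v \<phi> (X v \<omega>)))"
        by (rule X_fun_integrable[OF v, of "\<lambda>x. gen v (\<lambda>x. (f x)\<^sup>2) x - 2 * (f x * gen v \<phi> x)"])
      fix \<omega> assume \<omega>: "\<omega> \<in> space M"
      \<comment> \<open>The carre du champ: b^2 - a^2 - 2 a (b - a) = (b - a)^2 for a jump that
        changes f from a to b.\<close>
      have "gen v (\<lambda>x. (f x)\<^sup>2) x - 2 * (f x * gen v \<phi> x) = (\<Sum>z\<in>S - {x}. q v x z * (\<phi> z - \<phi> x)\<^sup>2)" for x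
        unfolding gen_def sum_distrib_left sum_subtractf[symmetric]
        by (intro sum.cong refl) (simp add: f_def power2_eq_square algebra_simps)
      then show "gen v (\<lambda>x. (f x)\<^sup>2) (X v \<omega>) - 2 * (f (X v \<omega>) * gen v \<phi> (X v \<omega>)) \<le> c"
        using c[OF v X_in[OF v \<omega>]] by simp
    qed simp
    finally show "expectation (\<lambda>\<omega>. gen v (\<lambda>x. (f x)\<^sup>2) (X v \<omega>)) - 2 * expectation (\<lambda>\<omega>. f (X v \<omega>) * gen v \<phi> (X v \<omega>)) \<le> c"
      by (simp add: prob_space)
  qed
  also have "\<dots> = c * (r - t)"
    using r by (simp add: set_lebesgue_integral_def)
  finally show "expectation (\<lambda>\<omega>. (martingale_part \<phi> r \<omega>)\<^sup>2) \<le> c * (r - t)" .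
qed

text \<open>The inequality 2 |z| \<le> \<delta> + z^2 / \<delta>, which is (|z| - \<delta>)^2 \<ge>
  0, passes from the second moment to the first absolute moment. The later choice of \<delta>
  balances the two terms.\<close>

lemma expectation_abs_martingale_le:
  assumes r: "r \<in> {t..T}" and \<delta>: "\<delta> > 0"
    and c: "\<And>u x. u \<in> {t..T} \<Longrightarrow> x \<in> S \<Longrightarrow> (\<Sum>z\<in>S - {x}. q u x z * (\<phi> z - \<phi> x)\<^sup>2) \<le> c"
  shows "integrable M (\<lambda>\<omega>. \<bar>martingale_part \<phi> r \<omega>\<bar>)"
    and "expectation (\<lambda>\<omega>. \<bar>martingale_part \<phi> r \<omega>\<bar>) \<le> (\<delta> + c * (r - t) / \<delta>) / 2"
proof -
  let ?Z = "martingale_part \<phi> r"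
  note SM = second_moment[OF r c]
  have b: "\<bar>z\<bar> \<le> (\<delta> + z\<^sup>2 / \<delta>) / 2" for z
  proof -
    have "0 \<le> (\<bar>z\<bar> - \<delta>)\<^sup>2" by simp
    also have "(\<bar>z\<bar> - \<delta>)\<^sup>2 = z\<^sup>2 - 2 * \<delta> * \<bar>z\<bar> + \<delta> * \<delta>"
      by (simp add: power2_eq_square algebra_simps)
    finally have "2 * \<delta> * \<bar>z\<bar> \<le> \<delta> * \<delta> + z\<^sup>2" by simp
    then show ?thesis using \<delta> by (simp add: field_simps power2_eq_square)
  qed
  have i: "integrable M (\<lambda>\<omega>. (\<delta> + (?Z \<omega>)\<^sup>2 / \<delta>) / 2)" using SM(1) by simp
  show I: "integrable M (\<lambda>\<omega>. \<bar>?Z \<omega>\<bar>)"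
    by (rule Bochner_Integration.integrable_bound[OF i]) (use SM(3) b \<delta> in auto)
  have "expectation (\<lambda>\<omega>. \<bar>?Z \<omega>\<bar>) \<le> expectation (\<lambda>\<omega>. (\<delta> + (?Z \<omega>)\<^sup>2 / \<delta>) / 2)"
    using b by (intro integral_mono I i)
  also have "\<dots> = (\<delta> + expectation (\<lambda>\<omega>. (?Z \<omega>)\<^sup>2) / \<delta>) / 2" using SM(1) by (simp add: prob_space)
  also have "\<dots> \<le> (\<delta> + c * (r - t) / \<delta>) / 2"
    using SM(2) \<delta> by (intro divide_right_mono add_left_mono) auto
  finally show "expectation (\<lambda>\<omega>. \<bar>?Z \<omega>\<bar>) \<le> (\<delta> + c * (r - t) / \<delta>) / 2" .
qed

text \<open>Joint measurability for Fubini's theorem. The variable upper limit of the integral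
  becomes a factor of the integrand, and then the measurability of integrals depending on a
  parameter applies.\<close>

lemma martingale_part_measurable:
  "(\<lambda>p. indicator {t..T} (fst p) * martingale_part \<phi> (fst p) (snd p)) \<in> borel_measurable (borel \<Otimes>\<^sub>M M)"
proof -
  let ?G = "\<lambda>u \<omega>. indicator {t..T} u * gen u \<phi> (X u \<omega>)"
  have Gm: "(\<lambda>p. ?G (fst p) (snd p)) \<in> borel_measurable (borel \<Otimes>\<^sub>M M)"
    by (rule jointly_measurable_fun[OF gen_measurable])
  have 1: "(\<lambda>z. (snd z, snd (fst z))) \<in> measurable ((borel \<Otimes>\<^sub>M M) \<Otimes>\<^sub>M lborel) (borel \<Otimes>\<^sub>M M)" by measurable
  have "(\<lambda>z. (if snd z \<le> fst (fst z) then 1 else 0) * ?G (snd z) (snd (fst z))) \<in> borel_measurable ((borel \<Otimes>\<^sub>M M) \<Otimes>\<^sub>M lborel)"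
  proof (rule borel_measurable_times)
    show "(\<lambda>z. ?G (snd z) (snd (fst z))) \<in> borel_measurable ((borel \<Otimes>\<^sub>M M) \<Otimes>\<^sub>M lborel)"
      using measurable_compose[OF 1 Gm] by simp
  qed measurable
  then have a1: "(\<lambda>p. LBINT u. (if u \<le> fst p then 1 else 0) * ?G u (snd p)) \<in> borel_measurable (borel \<Otimes>\<^sub>M M)"
    by (intro lborel.borel_measurable_lebesgue_integral) (simp add: case_prod_beta')
  have a2: "(\<lambda>p. indicator {t..T} (fst p) * (\<phi> (X (fst p) (snd p)) - \<phi> x0)) \<in> borel_measurable (borel \<Otimes>\<^sub>M M)"
    by (rule jointly_measurable_fun) simp
  have "(\<lambda>p. indicator {t..T} (fst p) * (\<phi> (X (fst p) (snd p)) - \<phi> x0) -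
     indicator {t..T} (fst p) * (LBINT u. (if u \<le> fst p then 1 else 0) * ?G u (snd p))) \<in> borel_measurable (borel \<Otimes>\<^sub>M M)"
    by (rule borel_measurable_diff[OF a2 borel_measurable_times[OF _ a1]]) measurable
  moreover have "indicator {t..T} r * martingale_part \<phi> r \<omega> = indicator {t..T} r * (\<phi> (X r \<omega>) - \<phi> x0) -
     indicator {t..T} r * (LBINT u. (if u \<le> r then 1 else 0) * ?G u \<omega>)" for r \<omega>
  proof (cases "r \<in> {t..T}")
    case True
    then have "(LBINT u. (if u \<le> r then 1 else 0) * ?G u \<omega>) = (LBINT u:{t..r}. gen u \<phi> (X u \<omega>))"
      unfolding set_lebesgue_integral_def
      by (intro Bochner_Integration.integral_cong refl) (auto simp: indicator_def)
    with True show ?thesis by (simp add: martingale_part_def)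
  qed simp
  ultimately show ?thesis by simp
qed

lemma martingale_part_bound:
  obtains C where "C \<ge> 0" "\<And>r \<omega>. r \<in> {t..T} \<Longrightarrow> \<omega> \<in> space M \<Longrightarrow> \<bar>martingale_part \<phi> r \<omega>\<bar> \<le> C"
proof -
  obtain C where C: "C \<ge> 0" "\<And>u x. u \<in> {t..T} \<Longrightarrow> x \<in> S \<Longrightarrow> \<bar>gen u \<phi> x\<bar> \<le> C"
    using gen_bound[of \<phi>] by blast
  obtain K where K: "K \<ge> 0" "\<And>x. x \<in> S \<Longrightarrow> \<bar>\<phi> x\<bar> \<le> K" using finite_bound[of \<phi>] by blast
  show ?thesis
  proof (rule that[of "K + K + C * (T - t)"])
    show "0 \<le> K + K + C * (T - t)" using K C tT by simp
    fix r \<omega> assume r: "r \<in> {t..T}" and \<omega>: "\<omega> \<in> space M"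
    have "\<bar>LBINT u:{t..r}. gen u \<phi> (X u \<omega>)\<bar> \<le> C * (r - t)"
      using r C X_in[OF _ \<omega>] by (intro abs_set_integral_Icc_le) auto
    also have "\<dots> \<le> C * (T - t)" using r C by (intro mult_left_mono) auto
    finally show "\<bar>martingale_part \<phi> r \<omega>\<bar> \<le> K + K + C * (T - t)"
      using K(2)[OF X_in[OF r \<omega>]] K(2)[OF x0] unfolding martingale_part_def by linarith
  qed
qed

text \<open>Fubini's theorem and the bound at single times, with r - t enlarged to T - t.\<close>

lemma expectation_integral_martingale_le:
  assumes \<delta>: "\<delta> > 0"
    and c: "\<And>u x. u \<in> {t..T} \<Longrightarrow> x \<in> S \<Longrightarrow> (\<Sum>z\<in>S - {x}. q u x z * (\<phi> z - \<phi> x)\<^sup>2) \<le> c" and c0: "c \<ge> 0"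
  shows "integrable M (\<lambda>\<omega>. LBINT s:{t..T}. \<bar>martingale_part \<phi> s \<omega>\<bar>)"
    and "expectation (\<lambda>\<omega>. LBINT s:{t..T}. \<bar>martingale_part \<phi> s \<omega>\<bar>) \<le> (\<delta> + c * (T - t) / \<delta>) / 2 * (T - t)"
proof -
  obtain C where C: "C \<ge> 0" "\<And>r \<omega>. r \<in> {t..T} \<Longrightarrow> \<omega> \<in> space M \<Longrightarrow> \<bar>martingale_part \<phi> r \<omega>\<bar> \<le> C"
    using martingale_part_bound[of \<phi>] by blast
  define D where "D s \<omega> = indicator {t..T} s * \<bar>martingale_part \<phi> s \<omega>\<bar>" for s \<omega>
  have Dm: "(\<lambda>p. D (fst p) (snd p)) \<in> borel_measurable (borel \<Otimes>\<^sub>M M)"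
    using borel_measurable_abs[OF martingale_part_measurable[of \<phi>]] by (simp add: D_def abs_mult)
  have Db: "\<bar>D u \<omega>\<bar> \<le> C * indicator {t..T} u" if "\<omega> \<in> space M" for u \<omega>
    using C(2)[OF _ that] by (auto simp: D_def indicator_def)
  note FE = fubini_expectation[OF Dm Db, of "\<lambda>_. 1" 1]
  have D: "(LBINT s. D s \<omega>) = (LBINT s:{t..T}. \<bar>martingale_part \<phi> s \<omega>\<bar>)" for \<omega>
    by (simp add: D_def set_lebesgue_integral_def)
  show "integrable M (\<lambda>\<omega>. LBINT s:{t..T}. \<bar>martingale_part \<phi> s \<omega>\<bar>)"
    using FE(3) by (simp add: D)
  have "expectation (\<lambda>\<omega>. LBINT s:{t..T}. \<bar>martingale_part \<phi> s \<omega>\<bar>) = (LBINT s. expectation (\<lambda>\<omega>. D s \<omega>))"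
    using FE(2) by (simp add: D)
  also have "\<dots> = (LBINT s:{t..T}. expectation (\<lambda>\<omega>. \<bar>martingale_part \<phi> s \<omega>\<bar>))"
    unfolding set_lebesgue_integral_def D_def by simp
  also have "\<dots> \<le> \<bar>\<dots>\<bar>" by simp
  also have "\<dots> \<le> (\<delta> + c * (T - t) / \<delta>) / 2 * (T - t)"
  proof (rule abs_set_integral_Icc_le[OF tT])
    show "0 \<le> (\<delta> + c * (T - t) / \<delta>) / 2" using \<delta> c0 tT by simp
    fix s assume s: "s \<in> {t..T}"
    have "\<bar>expectation (\<lambda>\<omega>. \<bar>martingale_part \<phi> s \<omega>\<bar>)\<bar> = expectation (\<lambda>\<omega>. \<bar>martingale_part \<phi> s \<omega>\<bar>)"
      by simp
    also have "\<dots> \<le> (\<delta> + c * (s - t) / \<delta>) / 2" by (rule expectation_abs_martingale_le(2)[OF s \<delta> c])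
    also have "\<dots> \<le> (\<delta> + c * (T - t) / \<delta>) / 2"
      using s \<delta> c0 by (intro divide_right_mono add_left_mono mult_left_mono) auto
    finally show "\<bar>expectation (\<lambda>\<omega>. \<bar>martingale_part \<phi> s \<omega>\<bar>)\<bar> \<le> (\<delta> + c * (T - t) / \<delta>) / 2" .
  qed
  finally show "expectation (\<lambda>\<omega>. LBINT s:{t..T}. \<bar>martingale_part \<phi> s \<omega>\<bar>) \<le> (\<delta> + c * (T - t) / \<delta>) / 2 * (T - t)" .
qed

end

subsection \<open>The mean field control problem\<close>

text \<open>The existential constants of \<open>assumption_A\<close> become two parameters, K for
  bounds and L for Lipschitz constants in the state. Later constants are explicit expressions in
  them and in T and the dimension, hence independent of N, of the initial data and of the
  control.\<close>

locale mean_field =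
  fixes T :: real and A :: "'a::metric_space set"
    and Q :: "'d::finite \<Rightarrow> 'd \<Rightarrow> real \<Rightarrow> 'a \<Rightarrow> real ^ 'd \<Rightarrow> real"
    and f :: "'d \<Rightarrow> real \<Rightarrow> 'a \<Rightarrow> real ^ 'd \<Rightarrow> real"
    and g :: "'d \<Rightarrow> real ^ 'd \<Rightarrow> real"
    and K L :: real
  assumes T_pos: "T > 0" and A_compact: "compact A" and A_ne: "A \<noteq> {}"
    and K_pos: "K > 0" and L_pos: "L > 0"
    and Q_nonneg: "\<And>i j t a m. t \<in> {0..T} \<Longrightarrow> a \<in> A \<Longrightarrow> m \<in> prob_simplex \<Longrightarrow> 0 \<le> Q i j t a m"
    and Q_le: "\<And>i j t a m. t \<in> {0..T} \<Longrightarrow> a \<in> A \<Longrightarrow> m \<in> prob_simplex \<Longrightarrow> Q i j t a m \<le> K"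
    and Q_cont: "\<And>i j. continuous_on ({0..T} \<times> A \<times> prob_simplex) (\<lambda>(t, a, m). Q i j t a m)"
    and Q_lip: "\<And>i j t a m p. t \<in> {0..T} \<Longrightarrow> a \<in> A \<Longrightarrow> m \<in> prob_simplex \<Longrightarrow> p \<in> prob_simplex \<Longrightarrow>
      \<bar>Q i j t a m - Q i j t a p\<bar> \<le> L * norm (m - p)"
    and F_cont: "continuous_on ({0..T} \<times> tuples A \<times> prob_simplex) (\<lambda>(t, a, m). total_running_cost f t a m)"
    and F_lip: "\<And>t a m p. t \<in> {0..T} \<Longrightarrow> a \<in> tuples A \<Longrightarrow> m \<in> prob_simplex \<Longrightarrow> p \<in> prob_simplex \<Longrightarrow>
      \<bar>total_running_cost f t a m - total_running_cost f t a p\<bar> \<le> L * norm (m - p)"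
    and F_le: "\<And>t a m. t \<in> {0..T} \<Longrightarrow> a \<in> tuples A \<Longrightarrow> m \<in> prob_simplex \<Longrightarrow> \<bar>total_running_cost f t a m\<bar> \<le> K"
    and G_lip: "\<And>m p. m \<in> prob_simplex \<Longrightarrow> p \<in> prob_simplex \<Longrightarrow>
      \<bar>total_terminal_cost g m - total_terminal_cost g p\<bar> \<le> L * norm (m - p)"
    and G_le: "\<And>m. m \<in> prob_simplex \<Longrightarrow> \<bar>total_terminal_cost g m\<bar> \<le> K"
begin

text \<open>Q is continuous only relative to a compact set, so its arguments are combined into a map
  to the restricted Borel space; that this map is measurable rests on
  \<open>borel_measurable_Pair_compact\<close>.\<close>

lemma Q_comp_measurable:
  assumes "\<tau> \<in> borel_measurable N" "\<And>x. x \<in> space N \<Longrightarrow> \<tau> x \<in> {0..T}"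
    and "a \<in> borel_measurable N" "\<And>x. x \<in> space N \<Longrightarrow> a x \<in> A"
    and "\<mu> \<in> borel_measurable N" "\<And>x. x \<in> space N \<Longrightarrow> \<mu> x \<in> prob_simplex"
  shows "(\<lambda>x. Q i j (\<tau> x) (a x) (\<mu> x)) \<in> borel_measurable N"
proof -
  have "(\<lambda>x. (a x, \<mu> x)) \<in> borel_measurable N"
    by (rule borel_measurable_Pair_compact[OF A_compact _ _ compact_prob_simplex]) (use assms in auto)
  then have "(\<lambda>x. (\<tau> x, (a x, \<mu> x))) \<in> borel_measurable N"
    by (intro borel_measurable_Pair_compact[OF compact_Icc[of 0 T] _ _ compact_Times[OF A_compact compact_prob_simplex]])
       (use assms in auto)
  then have "(\<lambda>x. (\<tau> x, (a x, \<mu> x))) \<in> measurable N (restrict_space borel ({0..T} \<times> A \<times> prob_simplex))"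
    using assms by (intro measurable_restrict_space2) auto
  from measurable_compose[OF this borel_measurable_continuous_on_restrict[OF Q_cont]]
  show ?thesis by simp
qed

lemma F_comp_measurable:
  assumes "\<tau> \<in> borel_measurable N" "\<And>x. x \<in> space N \<Longrightarrow> \<tau> x \<in> {0..T}"
    and "a \<in> borel_measurable N" "\<And>x. x \<in> space N \<Longrightarrow> a x \<in> tuples A"
    and "\<mu> \<in> borel_measurable N" "\<And>x. x \<in> space N \<Longrightarrow> \<mu> x \<in> prob_simplex"
  shows "(\<lambda>x. total_running_cost f (\<tau> x) (a x) (\<mu> x)) \<in> borel_measurable N"
proof -
  have "(\<lambda>x. (a x, \<mu> x)) \<in> borel_measurable N"
    by (rule borel_measurable_Pair_compact[OF compact_tuples[OF A_compact] _ _ compact_prob_simplex]) (use assms in auto)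
  then have "(\<lambda>x. (\<tau> x, (a x, \<mu> x))) \<in> borel_measurable N"
    by (intro borel_measurable_Pair_compact[OF compact_Icc[of 0 T] _ _ compact_Times[OF compact_tuples[OF A_compact] compact_prob_simplex]])
       (use assms in auto)
  then have "(\<lambda>x. (\<tau> x, (a x, \<mu> x))) \<in> measurable N (restrict_space borel ({0..T} \<times> tuples A \<times> prob_simplex))"
    using assms by (intro measurable_restrict_space2) auto
  from measurable_compose[OF this borel_measurable_continuous_on_restrict[OF F_cont]]
  show ?thesis by simp
qed

definition d :: real where "d = real CARD('d)"

lemma d_ge_1: "d \<ge> 1"
  unfolding d_def using zero_less_card_finite[where 'a='d] by linarith

text \<open>The drift is estimated component by component, which this norm suits; by
  \<open>norm_le_l1\<close> it also dominates the Euclidean norm in the Lipschitz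
  conditions.\<close>

definition l1 :: "real ^ 'd \<Rightarrow> real" where "l1 v = (\<Sum>i\<in>UNIV. \<bar>v $ i\<bar>)"

lemma l1_nonneg: "0 \<le> l1 v" by (simp add: l1_def sum_nonneg)

lemma norm_le_l1: "norm v \<le> l1 v" unfolding l1_def by (rule norm_le_l1_cart)

lemma nth_le_l1: "\<bar>v $ i\<bar> \<le> l1 v"
  unfolding l1_def by (rule member_le_sum) auto

lemma simplex_nth: "m \<in> prob_simplex \<Longrightarrow> 0 \<le> m $ i \<and> m $ i \<le> 1" for m :: "real ^ 'd"
  using member_le_sum[of i UNIV "\<lambda>i. m $ i"] by (auto simp: prob_simplex_def)

lemma tuples_nth: "a \<in> tuples A \<Longrightarrow> a $ i \<in> A"
  by (simp add: tuples_def)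

text \<open>The change of the mass meets a rate of at most K, and the change of the rate meets a
  mass of at most one.\<close>

lemma rate_diff_le:
  assumes s: "s \<in> {0..T}" and a: "a \<in> A" and m: "m \<in> prob_simplex" and p: "p \<in> prob_simplex"
  shows "\<bar>m $ k * Q i j s a m - p $ k * Q i j s a p\<bar> \<le> (K + L) * l1 (m - p)"
proof -
  have "m $ k * Q i j s a m - p $ k * Q i j s a p = (m - p) $ k * Q i j s a m + p $ k * (Q i j s a m - Q i j s a p)"
    by (simp add: algebra_simps)
  then have "\<bar>m $ k * Q i j s a m - p $ k * Q i j s a p\<bar> \<le> \<bar>(m - p) $ k\<bar> * \<bar>Q i j s a m\<bar> + \<bar>p $ k\<bar> * \<bar>Q i j s a m - Q i j s a p\<bar>"
    by (metis abs_mult abs_triangle_ineq)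
  also have "\<dots> \<le> l1 (m - p) * K + 1 * (L * l1 (m - p))"
  proof (intro add_mono mult_mono)
    show "\<bar>(m - p) $ k\<bar> \<le> l1 (m - p)" by (rule nth_le_l1)
    show "\<bar>Q i j s a m\<bar> \<le> K" using Q_nonneg[OF s a m] Q_le[OF s a m] by simp
    show "\<bar>p $ k\<bar> \<le> 1" using simplex_nth[OF p, of k] by simp
    show "\<bar>Q i j s a m - Q i j s a p\<bar> \<le> L * l1 (m - p)"
      using order_trans[OF Q_lip[OF s a m p] mult_left_mono[OF norm_le_l1[of "m - p"], of L]] L_pos by simp
  qed (auto simp: l1_nonneg)
  finally show ?thesis by (simp add: algebra_simps)
qed

text \<open>A component of the drift is a sum over d indices of a difference of two products, each
  Lipschitz with constant K + L by \<open>rate_diff_le\<close>.\<close>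

definition drift_lip :: real where "drift_lip = 2 * d * (K + L)"

lemma drift_lip_pos: "drift_lip > 0"
  using d_ge_1 K_pos L_pos by (simp add: drift_lip_def)

lemma drift_diff_le:
  assumes s: "s \<in> {0..T}" and a: "a \<in> tuples A" and m: "m \<in> prob_simplex" and p: "p \<in> prob_simplex"
  shows "\<bar>mf_drift Q s a m i - mf_drift Q s a p i\<bar> \<le> drift_lip * l1 (m - p)"
proof -
  have "\<bar>mf_drift Q s a m i - mf_drift Q s a p i\<bar> =
    \<bar>\<Sum>j\<in>UNIV. (m $ j * Q j i s (a $ j) m - p $ j * Q j i s (a $ j) p) - (m $ i * Q i j s (a $ i) m - p $ i * Q i j s (a $ i) p)\<bar>"
    unfolding mf_drift_def sum_subtractf[symmetric] by (intro arg_cong[where f=abs] sum.cong refl) simp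
  also have "\<dots> \<le> (\<Sum>j\<in>UNIV. \<bar>(m $ j * Q j i s (a $ j) m - p $ j * Q j i s (a $ j) p) - (m $ i * Q i j s (a $ i) m - p $ i * Q i j s (a $ i) p)\<bar>)"
    by (rule sum_abs)
  also have "\<dots> \<le> (\<Sum>j\<in>(UNIV :: 'd set). (K + L) * l1 (m - p) + (K + L) * l1 (m - p))"
    by (intro sum_mono order_trans[OF abs_triangle_ineq4] add_mono rate_diff_le s m p tuples_nth[OF a])
  also have "\<dots> = drift_lip * l1 (m - p)" by (simp add: drift_lip_def d_def)
  finally show ?thesis .
qed

lemma sum_mf_drift: "(\<Sum>i\<in>UNIV. mf_drift Q s a m i) = 0"
proof -
  have "(\<Sum>i\<in>UNIV. mf_drift Q s a m i) = (\<Sum>i\<in>UNIV. \<Sum>j\<in>UNIV. m $ j * Q j i s (a $ j) m) - (\<Sum>i\<in>UNIV. \<Sum>j\<in>UNIV. m $ i * Q i j s (a $ i) m)"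
    by (simp add: mf_drift_def sum_subtractf)
  also have "(\<Sum>i\<in>UNIV. \<Sum>j\<in>UNIV. m $ j * Q j i s (a $ j) m) = (\<Sum>i\<in>UNIV. \<Sum>j\<in>UNIV. m $ i * Q i j s (a $ i) m)"
    by (rule sum.swap)
  finally show ?thesis by simp
qed

text \<open>The inflow is nonnegative, and mass leaves i at rate at most K towards each of d
  indices. This is the lower bound that \<open>simplex_flow\<close> requires, with k = d *
  K.\<close>

lemma mf_drift_ge:
  assumes s: "s \<in> {0..T}" and a: "a \<in> tuples A" and m: "m \<in> prob_simplex"
  shows "- (d * K) * m $ i \<le> mf_drift Q s a m i"
proof -
  have "- (d * K) * m $ i = (\<Sum>j\<in>(UNIV :: 'd set). - (m $ i * K))" by (simp add: d_def)
  also have "\<dots> \<le> mf_drift Q s a m i" unfolding mf_drift_def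
  proof (rule sum_mono)
    fix j
    have "0 \<le> m $ j * Q j i s (a $ j) m" using simplex_nth[OF m, of j] Q_nonneg[OF s tuples_nth[OF a] m] by simp
    moreover have "m $ i * Q i j s (a $ i) m \<le> m $ i * K"
      using simplex_nth[OF m, of i] Q_le[OF s tuples_nth[OF a] m] by (intro mult_left_mono) auto
    ultimately show "- (m $ i * K) \<le> m $ j * Q j i s (a $ j) m - m $ i * Q i j s (a $ i) m" by simp
  qed
  finally show ?thesis .
qed

lemma abs_mf_drift_le:
  assumes s: "s \<in> {0..T}" and a: "a \<in> tuples A" and m: "m \<in> prob_simplex"
  shows "\<bar>mf_drift Q s a m i\<bar> \<le> 2 * d * K"
proof -
  have b: "\<bar>m $ k * Q k' j s (a $ l) m\<bar> \<le> 1 * K" for k k' j l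
    unfolding abs_mult using simplex_nth[OF m, of k] Q_nonneg[OF s tuples_nth[OF a] m, of k' j l] Q_le[OF s tuples_nth[OF a] m, of k' j l]
    by (intro mult_mono) auto
  have "\<bar>mf_drift Q s a m i\<bar> \<le> (\<Sum>j\<in>UNIV. \<bar>m $ j * Q j i s (a $ j) m - m $ i * Q i j s (a $ i) m\<bar>)"
    unfolding mf_drift_def by (rule sum_abs)
  also have "\<dots> \<le> (\<Sum>j\<in>(UNIV :: 'd set). 1 * K + 1 * K)"
    by (intro sum_mono order_trans[OF abs_triangle_ineq4] add_mono b)
  finally show ?thesis by (simp add: d_def)
qed

text \<open>A control as seen by the problem started at time t, whereas \<open>mf_controls\<close>
  concerns all of {0..T}.\<close>

definition control_on :: "real \<Rightarrow> (real \<Rightarrow> 'a ^ 'd) \<Rightarrow> bool" where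
  "control_on t \<alpha> \<longleftrightarrow> \<alpha> \<in> borel_measurable (restrict_space borel {t..T}) \<and> (\<forall>s\<in>{t..T}. \<alpha> s \<in> tuples A)"

lemma mf_controls_control_on:
  assumes \<alpha>: "\<alpha> \<in> mf_controls T A" and t: "t \<in> {0..T}"
  shows "control_on t \<alpha>"
proof -
  have v: "\<alpha> s \<in> tuples A" if "s \<in> {0..T}" for s
    using measurable_space[OF \<alpha>[unfolded mf_controls_def], of s] that by (simp add: space_restrict_space)
  have "\<alpha> \<in> borel_measurable (restrict_space borel {0..T})"
    using \<alpha> unfolding mf_controls_def by (simp add: measurable_restrict_space2_iff)
  then have "\<alpha> \<in> borel_measurable (restrict_space borel {t..T})"
    by (rule measurable_restrict_Icc_later[OF _ t])
  then show ?thesis using v t by (auto simp: control_on_def)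
qed

lemma vec_nth_measurable: "(\<lambda>v. v $ i) \<in> borel_measurable (borel :: ('b::metric_space ^ 'd) measure)"
  by (intro borel_measurable_continuous_onI continuous_intros)

lemma restrict_id_measurable: "(\<lambda>s. s) \<in> borel_measurable (restrict_space borel {t..T})"
  by (rule measurable_restrict_space1) simp

lemma drift_measurable:
  assumes \<alpha>: "control_on t \<alpha>" and t: "t \<in> {0..T}"
    and \<mu>: "\<mu> \<in> borel_measurable (restrict_space borel {t..T})" "\<And>s. s \<in> {t..T} \<Longrightarrow> \<mu> s \<in> prob_simplex"
  shows "(\<lambda>s. mf_drift Q s (\<alpha> s) (\<mu> s) i) \<in> borel_measurable (restrict_space borel {t..T})"
proof -
  have "(\<lambda>s. Q k j s (\<alpha> s $ k) (\<mu> s)) \<in> borel_measurable (restrict_space borel {t..T})" for k j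
  proof (rule Q_comp_measurable[OF restrict_id_measurable])
    show "(\<lambda>s. \<alpha> s $ k) \<in> borel_measurable (restrict_space borel {t..T})"
      using \<alpha> measurable_compose[OF _ vec_nth_measurable] by (auto simp: control_on_def)
  qed (use \<alpha> \<mu> t in \<open>auto simp: control_on_def space_restrict_space tuples_def\<close>)
  moreover have "(\<lambda>s. \<mu> s $ k) \<in> borel_measurable (restrict_space borel {t..T})" for k
    using measurable_compose[OF \<mu>(1) vec_nth_measurable] .
  ultimately show ?thesis unfolding mf_drift_def
    by (intro borel_measurable_sum borel_measurable_diff borel_measurable_times)
qed

lemma drift_integrable:
  assumes "control_on t \<alpha>" and "t \<in> {0..T}" and "s \<le> T"
    and "\<mu> \<in> borel_measurable (restrict_space borel {t..T})" "\<And>s. s \<in> {t..T} \<Longrightarrow> \<mu> s \<in> prob_simplex"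
  shows "set_integrable lborel {t..s} (\<lambda>u. mf_drift Q u (\<alpha> u) (\<mu> u) i)"
  by (rule set_integrable_bounded_restrict[OF drift_measurable, where B="2 * d * K"])
    (use assms in \<open>auto intro!: abs_mf_drift_le simp: control_on_def\<close>)

text \<open>The equation is a flow on the probability vectors indexed by the components. Summing the
  bound for one component over all d of them gives the l1 Lipschitz constant d *
  \<open>drift_lip\<close>.\<close>

lemma mf_solution_exists:
  assumes \<alpha>: "control_on t \<alpha>" and t: "t \<in> {0..T}" and m: "m \<in> prob_simplex"
  shows "\<exists>\<mu>. mf_solution T Q t m \<alpha> \<mu>"
proof -
  define b where "b u p y = mf_drift Q u (\<alpha> u) (\<chi> i. p i) y" for u p y
  have pv: "(\<chi> i. p i) \<in> prob_simplex \<longleftrightarrow> p \<in> prob_vectors UNIV" for p :: "'d \<Rightarrow> real"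
    by (simp add: prob_simplex_def prob_vectors_def)
  have \<alpha>s: "\<alpha> u \<in> tuples A" "u \<in> {0..T}" if "u \<in> {t..T}" for u using \<alpha> t that by (auto simp: control_on_def)
  interpret simplex_flow UNIV t T "\<lambda>i. m $ i" b "d * K" "d * drift_lip"
  proof
    show "finite (UNIV :: 'd set)" "t \<le> T" using t by auto
    show "(\<lambda>i. m $ i) \<in> prob_vectors UNIV" using m by (simp add: flip: pv)
    show "0 < d * K" "0 \<le> d * drift_lip" using d_ge_1 K_pos drift_lip_pos by auto
    show "(\<Sum>y\<in>UNIV. b u p y) = 0" for u p by (simp add: b_def sum_mf_drift)
    show "- (d * K) * p y \<le> b u p y" if "u \<in> {t..T}" "p \<in> prob_vectors UNIV" for u p y
      using mf_drift_ge[OF \<alpha>s(2)[OF that(1)] \<alpha>s(1)[OF that(1)], of "\<chi> i. p i" y] that by (simp add: b_def pv)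
    show "(\<Sum>y\<in>UNIV. \<bar>b u p y - b u p' y\<bar>) \<le> d * drift_lip * (\<Sum>y\<in>UNIV. \<bar>p y - p' y\<bar>)"
      if u: "u \<in> {t..T}" and p: "p \<in> prob_vectors UNIV" "p' \<in> prob_vectors UNIV" for u p p'
    proof -
      have "(\<Sum>y\<in>UNIV. \<bar>b u p y - b u p' y\<bar>) \<le> (\<Sum>y\<in>(UNIV :: 'd set). drift_lip * l1 ((\<chi> i. p i) - (\<chi> i. p' i)))"
        unfolding b_def using p by (intro sum_mono drift_diff_le \<alpha>s u) (auto simp: pv)
      then show ?thesis by (simp add: d_def l1_def mult_ac)
    qed
    show "(\<lambda>u. b u (\<mu> u) y) \<in> borel_measurable (restrict_space borel {t..T})"
      if \<mu>: "\<And>z. z \<in> UNIV \<Longrightarrow> (\<lambda>u. \<mu> u z) \<in> borel_measurable (restrict_space borel {t..T})"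
        "\<And>u. u \<in> {t..T} \<Longrightarrow> \<mu> u \<in> prob_vectors UNIV" for \<mu> y
      unfolding b_def
    proof (rule drift_measurable[OF \<alpha> t])
      show "(\<lambda>u. \<chi> i. \<mu> u i) \<in> borel_measurable (restrict_space borel {t..T})"
        by (rule borel_measurable_vec_compact[where K="{0..1}"])
          (use \<mu> prob_vectors_le_1[OF finite_class.finite_UNIV \<mu>(2)] in \<open>auto simp: space_restrict_space prob_vectors_def\<close>)
    qed (use \<mu> in \<open>auto simp: pv\<close>)
  qed
  have "mf_solution T Q t m \<alpha> (\<lambda>s. \<chi> i. flow s i)"
    unfolding mf_solution_def using flow_solution by (auto simp: pv b_def)
  then show ?thesis by blast
qed

lemma mf_solution_measurable:
  assumes \<mu>: "mf_solution T Q t m \<alpha> \<mu>" and t: "t \<le> T"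
  shows "\<mu> \<in> borel_measurable (restrict_space borel {t..T})"
proof -
  have "(\<lambda>s. \<mu> s $ i) \<in> borel_measurable (restrict_space borel {t..T})" for i
  proof -
    have "set_integrable lborel {t..T} (\<lambda>u. mf_drift Q u (\<alpha> u) (\<mu> u) i)"
      using \<mu> t unfolding mf_solution_def by auto
    from restrict_measurable_indefinite_integral[OF this]
    have "(\<lambda>s. m $ i + (LBINT u:{t..s}. mf_drift Q u (\<alpha> u) (\<mu> u) i)) \<in> borel_measurable (restrict_space borel {t..T})"
      by (rule borel_measurable_add[OF borel_measurable_const])
    then show ?thesis
      by (rule measurable_cong[THEN iffD1, rotated]) (use \<mu> in \<open>auto simp: mf_solution_def space_restrict_space\<close>)
  qed
  moreover have "\<mu> s $ i \<in> {0..1}" if "s \<in> {t..T}" for s i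
    using simplex_nth[of "\<mu> s" i] \<mu> that by (simp add: mf_solution_def)
  ultimately have "(\<lambda>s. \<chi> i. \<mu> s $ i) \<in> borel_measurable (restrict_space borel {t..T})"
    by (intro borel_measurable_vec_compact[where K="{0..1}"]) (simp_all add: space_restrict_space)
  then show ?thesis by simp
qed

section \<open>Costs along paths and their stability\<close>

lemma F_integrable:
  assumes \<alpha>: "control_on t \<alpha>" and t: "t \<in> {0..T}"
    and x: "x \<in> borel_measurable (restrict_space borel {t..T})" "\<And>s. s \<in> {t..T} \<Longrightarrow> x s \<in> prob_simplex"
  shows "set_integrable lborel {t..T} (\<lambda>s. total_running_cost f s (\<alpha> s) (x s))"
proof (rule set_integrable_bounded_restrict[where a=t and b=T and B=K])
  show "(\<lambda>s. total_running_cost f s (\<alpha> s) (x s)) \<in> borel_measurable (restrict_space borel {t..T})"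
    by (rule F_comp_measurable[OF restrict_id_measurable])
      (use \<alpha> x t in \<open>auto simp: control_on_def space_restrict_space\<close>)
qed (use \<alpha> x t in \<open>auto intro!: F_le simp: control_on_def\<close>)

definition defect :: "real \<Rightarrow> real ^ 'd \<Rightarrow> (real \<Rightarrow> 'a ^ 'd) \<Rightarrow> (real \<Rightarrow> real ^ 'd) \<Rightarrow> real \<Rightarrow> real" where
  "defect t m \<alpha> x s = (\<Sum>i\<in>UNIV. \<bar>x s $ i - m $ i - (LBINT u:{t..s}. mf_drift Q u (\<alpha> u) (x u) i)\<bar>)"

text \<open>The sum of two weights, so as to dominate both. L is the weight of the defect at time T,
  through the terminal cost. The other term is the weight of its time integral: the integrated
  distance to the solution enters with L through the running cost and with L * d *
  \<open>drift_lip\<close> through the terminal cost, and \<open>gronwall_average\<close> bounds it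
  with the factor 2 exp (...).\<close>

definition stab :: real where
  "stab = L + L * (1 + d * drift_lip) * (2 * exp (2 * (d * drift_lip) * T))"

lemma stab_pos: "stab > 0"
  unfolding stab_def using L_pos drift_lip_pos d_ge_1 by (intro add_pos_nonneg) auto

definition mf_cost :: "real \<Rightarrow> (real \<Rightarrow> 'a ^ 'd) \<Rightarrow> (real \<Rightarrow> real ^ 'd) \<Rightarrow> real" where
  "mf_cost t \<alpha> \<mu> = (LBINT s:{t..T}. total_running_cost f s (\<alpha> s) (\<mu> s)) + total_terminal_cost g (\<mu> T)"

text \<open>A path that solves the mean field equation up to a defect has almost the cost of the exact
  solution with the same control. Applied to the trajectories of the \<open>N\<close>-agent system, whose
  defect is the martingale part, this proves both inequalities of the theorem.\<close>

lemma mf_cost_stability: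
  assumes \<alpha>: "control_on t \<alpha>" and t: "t \<in> {0..T}" and \<mu>: "mf_solution T Q t m \<alpha> \<mu>"
    and x: "x \<in> borel_measurable (restrict_space borel {t..T})" "\<And>s. s \<in> {t..T} \<Longrightarrow> x s \<in> prob_simplex"
  shows "\<bar>mf_cost t \<alpha> x - mf_cost t \<alpha> \<mu>\<bar>
    \<le> stab * (defect t m \<alpha> x T + (LBINT s:{t..T}. defect t m \<alpha> x s))"
proof -
  define \<Lambda> where "\<Lambda> = d * drift_lip"
  have \<Lambda>: "\<Lambda> > 0" using d_ge_1 drift_lip_pos by (simp add: \<Lambda>_def)
  have tT: "t \<le> T" using t by simp
  define e where "e = defect t m \<alpha> x"
  define D where "D s = l1 (x s - \<mu> s)" for s
  have \<mu>m: "\<mu> \<in> borel_measurable (restrict_space borel {t..T})" by (rule mf_solution_measurable[OF \<mu> tT])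
  have \<mu>s: "\<mu> s \<in> prob_simplex" if "s \<in> {t..T}" for s using \<mu> that by (simp add: mf_solution_def)
  have nth_m: "(\<lambda>s. y s $ i) \<in> borel_measurable (restrict_space borel {t..T})"
    if "y \<in> borel_measurable (restrict_space borel {t..T})" for y :: "real \<Rightarrow> real ^ 'd" and i
    using measurable_compose[OF that vec_nth_measurable] .
  have D_int: "set_integrable lborel {t..T} D"
  proof (rule set_integrable_bounded_restrict[where a=t and b=T and B=d])
    show "D \<in> borel_measurable (restrict_space borel {t..T})"
      unfolding D_def[abs_def] l1_def
      using nth_m[OF x(1)] nth_m[OF \<mu>m] by (intro borel_measurable_sum borel_measurable_abs) simp
    show "\<bar>D s\<bar> \<le> d" if s: "s \<in> {t..T}" for s
    proof -
      have "l1 (x s - \<mu> s) \<le> (\<Sum>i\<in>(UNIV :: 'd set). 1)"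
        unfolding l1_def
      proof (rule sum_mono)
        fix i show "\<bar>(x s - \<mu> s) $ i\<bar> \<le> 1"
          using simplex_nth[OF x(2)[OF s], of i] simplex_nth[OF \<mu>s[OF s], of i]
          unfolding vector_minus_component by linarith
      qed
      then show ?thesis using l1_nonneg[of "x s - \<mu> s"] by (simp add: D_def d_def)
    qed
  qed auto
  have drx: "set_integrable lborel {t..s} (\<lambda>u. mf_drift Q u (\<alpha> u) (x u) i)" if "s \<le> T" for s i
    by (rule drift_integrable[OF \<alpha> t that x])
  have dr\<mu>: "set_integrable lborel {t..s} (\<lambda>u. mf_drift Q u (\<alpha> u) (\<mu> u) i)" if "s \<le> T" for s i
    by (rule drift_integrable[OF \<alpha> t that \<mu>m \<mu>s])
  have e_nn: "0 \<le> e s" for s by (simp add: e_def defect_def sum_nonneg)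
  have e_int: "set_integrable lborel {t..T} e"
  proof (rule set_integrable_bounded_restrict[where a=t and b=T and B="\<Sum>i\<in>(UNIV :: 'd set). (2 + \<bar>m $ i\<bar>) + 2 * d * K * (T - t)"])
    show "e \<in> borel_measurable (restrict_space borel {t..T})"
      unfolding e_def defect_def[abs_def]
      using nth_m[OF x(1)] restrict_measurable_indefinite_integral[OF drx[OF order_refl]]
      by (intro borel_measurable_sum borel_measurable_abs borel_measurable_diff borel_measurable_const)
    show "\<bar>e s\<bar> \<le> (\<Sum>i\<in>(UNIV :: 'd set). (2 + \<bar>m $ i\<bar>) + 2 * d * K * (T - t))" if s: "s \<in> {t..T}" for s
    proof -
      have "e s \<le> (\<Sum>i\<in>(UNIV :: 'd set). (2 + \<bar>m $ i\<bar>) + 2 * d * K * (T - t))"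
        unfolding e_def defect_def
      proof (rule sum_mono)
        fix i
        have "\<bar>LBINT u:{t..s}. mf_drift Q u (\<alpha> u) (x u) i\<bar> \<le> 2 * d * K * (s - t)"
          using s t K_pos d_ge_1 \<alpha> x(2) by (intro abs_set_integral_Icc_le abs_mf_drift_le) (auto simp: control_on_def)
        also have "\<dots> \<le> 2 * d * K * (T - t)" using s K_pos d_ge_1 by (intro mult_left_mono) auto
        finally show "\<bar>x s $ i - m $ i - (LBINT u:{t..s}. mf_drift Q u (\<alpha> u) (x u) i)\<bar> \<le> (2 + \<bar>m $ i\<bar>) + 2 * d * K * (T - t)"
          using simplex_nth[OF x(2)[OF s], of i] by linarith
      qed
      then show ?thesis using e_nn by simp
    qed
  qed auto
  \<comment> \<open>The distance to the solution is at most the defect plus the difference of the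
    two drift integrals; summing over the components turns \<open>drift_lip\<close> into
    \<Lambda>.\<close>
  have le: "D s \<le> e s + \<Lambda> * (LBINT u:{t..s}. D u)" if s: "s \<in> {t..T}" for s
  proof -
    have sT: "s \<le> T" using s by simp
    have Ds: "set_integrable lborel {t..s} D" using set_integrable_Icc_subset[OF D_int] s by simp
    have "D s \<le> (\<Sum>i\<in>UNIV. \<bar>x s $ i - m $ i - (LBINT u:{t..s}. mf_drift Q u (\<alpha> u) (x u) i)\<bar> + drift_lip * (LBINT u:{t..s}. D u))"
      unfolding D_def[of s] l1_def
    proof (rule sum_mono)
      fix i
      let ?I = "LBINT u:{t..s}. mf_drift Q u (\<alpha> u) (x u) i" and ?J = "LBINT u:{t..s}. mf_drift Q u (\<alpha> u) (\<mu> u) i"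
      have "?I - ?J = (LBINT u:{t..s}. mf_drift Q u (\<alpha> u) (x u) i - mf_drift Q u (\<alpha> u) (\<mu> u) i)"
        using set_integral_diff(2)[OF drx[OF sT] dr\<mu>[OF sT]] by simp
      also have "\<bar>\<dots>\<bar> \<le> (LBINT u:{t..s}. \<bar>mf_drift Q u (\<alpha> u) (x u) i - mf_drift Q u (\<alpha> u) (\<mu> u) i\<bar>)"
        using set_integral_norm_bound[OF set_integral_diff(1)[OF drx[OF sT] dr\<mu>[OF sT]]] by simp
      also have "\<dots> \<le> (LBINT u:{t..s}. drift_lip * D u)"
      proof (rule set_integral_mono)
        show "set_integrable lborel {t..s} (\<lambda>u. \<bar>mf_drift Q u (\<alpha> u) (x u) i - mf_drift Q u (\<alpha> u) (\<mu> u) i\<bar>)"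
          by (intro set_integrable_abs set_integral_diff(1) drx dr\<mu> sT)
        show "set_integrable lborel {t..s} (\<lambda>u. drift_lip * D u)" by (intro set_integrable_mult_right Ds)
        show "\<bar>mf_drift Q u (\<alpha> u) (x u) i - mf_drift Q u (\<alpha> u) (\<mu> u) i\<bar> \<le> drift_lip * D u" if "u \<in> {t..s}" for u
          unfolding D_def using that s t \<alpha> by (intro drift_diff_le x \<mu>s) (auto simp: control_on_def)
      qed
      finally have IJ: "\<bar>?I - ?J\<bar> \<le> drift_lip * (LBINT u:{t..s}. D u)" by simp
      have "\<mu> s $ i = m $ i + ?J" using \<mu> s by (simp add: mf_solution_def)
      then have "(x s - \<mu> s) $ i = (x s $ i - m $ i - ?I) + (?I - ?J)" by simp
      then show "\<bar>(x s - \<mu> s) $ i\<bar> \<le> \<bar>x s $ i - m $ i - ?I\<bar> + drift_lip * (LBINT u:{t..s}. D u)"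
        using IJ abs_triangle_ineq[of "x s $ i - m $ i - ?I" "?I - ?J"] by linarith
    qed
    then show ?thesis by (simp add: sum.distrib e_def defect_def \<Lambda>_def d_def)
  qed
  let ?ID = "LBINT u:{t..T}. D u" and ?IE = "LBINT u:{t..T}. e u"
  have IE_nn: "0 \<le> ?IE" using e_nn unfolding set_lebesgue_integral_def
    by (intro Bochner_Integration.integral_nonneg) simp
  have ID_nn: "0 \<le> ?ID" unfolding set_lebesgue_integral_def D_def
    by (intro Bochner_Integration.integral_nonneg) (simp add: l1_nonneg)
  have ID: "?ID \<le> 2 * exp (2 * \<Lambda> * T) * ?IE"
  proof -
    have "?ID \<le> 2 * exp (2 * \<Lambda> * (T - t)) * ?IE"
      by (rule gronwall_average[OF tT \<Lambda> D_int e_int _ _ le]) (auto simp: D_def l1_nonneg e_nn)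
    also have "\<dots> \<le> 2 * exp (2 * \<Lambda> * T) * ?IE"
      using t \<Lambda> by (intro mult_right_mono IE_nn) auto
    finally show ?thesis .
  qed
  \<comment> \<open>The averaged Gronwall estimate does not bound the distance at a single time, so
    the distance at T is taken from the integral inequality itself.\<close>
  have DT: "D T \<le> e T + \<Lambda> * ?ID" using le[of T] tT by simp
  have Fx: "set_integrable lborel {t..T} (\<lambda>s. total_running_cost f s (\<alpha> s) (x s))" by (rule F_integrable[OF \<alpha> t x])
  have F\<mu>: "set_integrable lborel {t..T} (\<lambda>s. total_running_cost f s (\<alpha> s) (\<mu> s))" by (rule F_integrable[OF \<alpha> t \<mu>m \<mu>s])
  have "\<bar>(LBINT s:{t..T}. total_running_cost f s (\<alpha> s) (x s)) - (LBINT s:{t..T}. total_running_cost f s (\<alpha> s) (\<mu> s))\<bar>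
     = \<bar>LBINT s:{t..T}. total_running_cost f s (\<alpha> s) (x s) - total_running_cost f s (\<alpha> s) (\<mu> s)\<bar>"
    using set_integral_diff(2)[OF Fx F\<mu>] by simp
  also have "\<dots> \<le> (LBINT s:{t..T}. \<bar>total_running_cost f s (\<alpha> s) (x s) - total_running_cost f s (\<alpha> s) (\<mu> s)\<bar>)"
    using set_integral_norm_bound[OF set_integral_diff(1)[OF Fx F\<mu>]] by simp
  also have "\<dots> \<le> (LBINT s:{t..T}. L * D s)"
  proof (rule set_integral_mono)
    show "set_integrable lborel {t..T} (\<lambda>s. \<bar>total_running_cost f s (\<alpha> s) (x s) - total_running_cost f s (\<alpha> s) (\<mu> s)\<bar>)"
      by (intro set_integrable_abs set_integral_diff(1) Fx F\<mu>)
    show "set_integrable lborel {t..T} (\<lambda>s. L * D s)" by (intro set_integrable_mult_right D_int)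
    fix s assume s: "s \<in> {t..T}"
    have "\<bar>total_running_cost f s (\<alpha> s) (x s) - total_running_cost f s (\<alpha> s) (\<mu> s)\<bar> \<le> L * norm (x s - \<mu> s)"
      using s t \<alpha> x \<mu>s by (intro F_lip) (auto simp: control_on_def)
    also have "\<dots> \<le> L * D s" unfolding D_def using L_pos norm_le_l1 by (intro mult_left_mono) auto
    finally show "\<bar>total_running_cost f s (\<alpha> s) (x s) - total_running_cost f s (\<alpha> s) (\<mu> s)\<bar> \<le> L * D s" .
  qed
  finally have 1: "\<bar>(LBINT s:{t..T}. total_running_cost f s (\<alpha> s) (x s)) - (LBINT s:{t..T}. total_running_cost f s (\<alpha> s) (\<mu> s))\<bar> \<le> L * ?ID"
    by simp
  have 2: "\<bar>total_terminal_cost g (x T) - total_terminal_cost g (\<mu> T)\<bar> \<le> L * D T"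
  proof -
    have "\<bar>total_terminal_cost g (x T) - total_terminal_cost g (\<mu> T)\<bar> \<le> L * norm (x T - \<mu> T)"
      using tT by (intro G_lip x \<mu>s) auto
    also have "\<dots> \<le> L * D T" unfolding D_def using L_pos norm_le_l1 by (intro mult_left_mono) auto
    finally show ?thesis .
  qed
  have "\<bar>mf_cost t \<alpha> x - mf_cost t \<alpha> \<mu>\<bar> \<le> L * ?ID + L * D T" unfolding mf_cost_def using 1 2 by linarith
  also have "\<dots> \<le> L * ?ID + L * (e T + \<Lambda> * ?ID)" using DT L_pos by (intro add_left_mono mult_left_mono) auto
  also have "\<dots> = L * e T + L * (1 + \<Lambda>) * ?ID" by (simp add: algebra_simps)
  also have "\<dots> \<le> L * e T + L * (1 + \<Lambda>) * (2 * exp (2 * \<Lambda> * T) * ?IE)"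
    using ID L_pos \<Lambda> by (intro add_left_mono mult_left_mono) auto
  also have "\<dots> \<le> stab * e T + stab * ?IE"
  proof (rule add_mono)
    have "0 \<le> L * (1 + \<Lambda>) * (2 * exp (2 * \<Lambda> * T))" using L_pos \<Lambda> by simp
    then show "L * e T \<le> stab * e T" "L * (1 + \<Lambda>) * (2 * exp (2 * \<Lambda> * T) * ?IE) \<le> stab * ?IE"
      using L_pos e_nn IE_nn unfolding stab_def \<Lambda>_def mult.assoc[symmetric] by (intro mult_right_mono; simp add: mult.assoc)+
  qed
  finally show ?thesis by (simp add: e_def distrib_left)
qed

section \<open>The mean field value as an infimum of real numbers\<close>

lemma mf_value_eq: "mf_value T A Q f g t m = Inf {mf_cost t \<alpha> \<mu> | \<alpha> \<mu>. \<alpha> \<in> mf_controls T A \<and> mf_solution T Q t m \<alpha> \<mu>}"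
  by (simp add: mf_value_def mf_cost_def)

text \<open>A lower bound for all costs, so that \<open>Inf\<close> on the reals is their actual
  infimum.\<close>

lemma mf_cost_ge:
  assumes t: "t \<in> {0..T}" and \<alpha>: "\<alpha> \<in> mf_controls T A" and \<mu>: "mf_solution T Q t m \<alpha> \<mu>"
  shows "- (K * T + K) \<le> mf_cost t \<alpha> \<mu>"
proof -
  have \<mu>s: "\<mu> s \<in> prob_simplex" if "s \<in> {t..T}" for s using \<mu> that by (simp add: mf_solution_def)
  have "\<bar>LBINT s:{t..T}. total_running_cost f s (\<alpha> s) (\<mu> s)\<bar> \<le> K * (T - t)"
    using t K_pos mf_controls_control_on[OF \<alpha> t] \<mu>s
    by (intro abs_set_integral_Icc_le F_le) (auto simp: control_on_def)
  also have "\<dots> \<le> K * T" using t K_pos by (intro mult_left_mono) auto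
  finally show ?thesis using G_le[OF \<mu>s[of T]] t unfolding mf_cost_def by auto
qed

lemma mf_value_le:
  assumes "t \<in> {0..T}" "\<alpha> \<in> mf_controls T A" "mf_solution T Q t m \<alpha> \<mu>"
  shows "mf_value T A Q f g t m \<le> mf_cost t \<alpha> \<mu>"
  unfolding mf_value_eq using assms mf_cost_ge[OF assms(1)]
  by (intro cInf_lower bdd_belowI[of _ "- (K * T + K)"]) auto

text \<open>A constant control and its solution show that the set of costs is not empty, so its
  infimum is approached.\<close>

lemma mf_value_approx:
  assumes t: "t \<in> {0..T}" and m: "m \<in> prob_simplex" and \<epsilon>: "\<epsilon> > 0"
  obtains \<alpha> \<mu> where "\<alpha> \<in> mf_controls T A" "mf_solution T Q t m \<alpha> \<mu>" "mf_cost t \<alpha> \<mu> < mf_value T A Q f g t m + \<epsilon>"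
proof -
  obtain a0 where "a0 \<in> A" using A_ne by blast
  then have c: "(\<lambda>_. \<chi> i. a0) \<in> mf_controls T A"
    unfolding mf_controls_def by (intro measurable_const) (simp add: space_restrict_space tuples_def)
  obtain \<mu>0 where "mf_solution T Q t m (\<lambda>_. \<chi> i. a0) \<mu>0"
    using mf_solution_exists[OF mf_controls_control_on[OF c t] t m] by blast
  then have "{mf_cost t \<alpha> \<mu> | \<alpha> \<mu>. \<alpha> \<in> mf_controls T A \<and> mf_solution T Q t m \<alpha> \<mu>} \<noteq> {}" using c by blast
  from cInf_lessD[OF this, folded mf_value_eq, of "mf_value T A Q f g t m + \<epsilon>"] show ?thesis
    using \<epsilon> that by auto
qed

end

subsection \<open>The \<open>N\<close>-agent optimization\<close>

text \<open>Only the rates on {t..T} enter. This lets the agents' rates be set to zero outside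
  {0..T}, as the construction of the chain asks for bounds and measurability at all real
  times.\<close>

lemma transition_function_cong:
  assumes q: "\<And>u x z. u \<in> {t..T} \<Longrightarrow> x \<in> S \<Longrightarrow> z \<in> S \<Longrightarrow> q u x z = q' u x z"
    and p: "transition_function S q t T p"
  shows "transition_function S q' t T p"
proof -
  let ?h = "\<lambda>q s x y u. \<Sum>z\<in>S - {y}. p s x u z * q u z y - p s x u y * q u y z"
  have e: "?h q s x y u = ?h q' s x y u" if "s \<in> {t..T}" "r \<in> {s..T}" "u \<in> {s..r}" "y \<in> S" for s r x y u
    using that by (intro sum.cong refl) (simp add: q)
  show ?thesis unfolding transition_function_def
  proof (intro ballI)
    fix s r x assume sr: "s \<in> {t..T}" "r \<in> {s..T}" and x: "x \<in> S"
    from p[unfolded transition_function_def, rule_format, OF sr x]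
    have "(\<forall>y\<in>S. 0 \<le> p s x r y) \<and> (\<Sum>y\<in>S. p s x r y) = 1"
      and P: "\<forall>y\<in>S. set_integrable lborel {s..r} (?h q s x y) \<and>
        p s x r y = (if x = y then 1 else 0) + (LBINT u:{s..r}. ?h q s x y u)" by blast+
    moreover have "set_integrable lborel {s..r} (?h q' s x y) \<and>
        p s x r y = (if x = y then 1 else 0) + (LBINT u:{s..r}. ?h q' s x y u)" if y: "y \<in> S" for y
    proof -
      have "set_integrable lborel {s..r} (?h q s x y) = set_integrable lborel {s..r} (?h q' s x y)"
        by (rule set_integrable_cong) (use e[OF sr _ y] in auto)
      moreover have "(LBINT u:{s..r}. ?h q s x y u) = (LBINT u:{s..r}. ?h q' s x y u)"
        by (rule set_lebesgue_integral_cong) (use e[OF sr _ y] in auto)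
      ultimately show ?thesis using P y by simp
    qed
    ultimately show "(\<forall>y\<in>S. 0 \<le> p s x r y) \<and> (\<Sum>y\<in>S. p s x r y) = 1 \<and> (\<forall>y\<in>S.
        set_integrable lborel {s..r} (?h q' s x y) \<and>
        p s x r y = (if x = y then 1 else 0) + (LBINT u:{s..r}. ?h q' s x y u))" by blast
  qed
qed

lemma markov_chain_with_rates_cong:
  assumes q: "\<And>u x z. u \<in> {t..T} \<Longrightarrow> x \<in> S \<Longrightarrow> z \<in> S \<Longrightarrow> q u x z = q' u x z"
    and M: "markov_chain_with_rates S q t T x0 M X"
  shows "markov_chain_with_rates S q' t T x0 M X"
proof -
  let ?P = "\<lambda>p. \<forall>s\<in>{t..T}. \<forall>r\<in>{s..T}. \<forall>x\<in>S. \<forall>y\<in>S.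
         \<forall>E \<in> sigma_sets (space M) {X u -` B \<inter> space M | u B. u \<in> {t..s} \<and> B \<subseteq> S}.
           measure M {\<omega>\<in>E. X s \<omega> = x \<and> X r \<omega> = y} = measure M {\<omega>\<in>E. X s \<omega> = x} * p s x r y"
  have "\<exists>p. transition_function S q t T p \<and> ?P p"
    using M unfolding markov_chain_with_rates_def by (elim conjE)
  then obtain p where p: "transition_function S q t T p" "?P p" by (elim exE conjE)
  have "transition_function S q' t T p" by (rule transition_function_cong[OF q p(1)])
  then have "\<exists>p. transition_function S q' t T p \<and> ?P p" using p(2) by (intro exI conjI)
  then show ?thesis
    using M unfolding markov_chain_with_rates_def by (elim conjE) (intro conjI)
qed

lemma finite_simplex_grid:
  assumes N: "N \<ge> 1"
  shows "finite (simplex_grid N :: (real ^ 'd::finite) set)"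
proof (rule finite_subset)
  show "finite ((\<lambda>k. \<chi> i. real (k i) / real N) ` (Pi\<^sub>E (UNIV::'d set) (\<lambda>_. {0..N})))"
    by (intro finite_imageI finite_PiE) auto
  show "(simplex_grid N :: (real ^ 'd) set) \<subseteq> (\<lambda>k. \<chi> i. real (k i) / real N) ` (Pi\<^sub>E (UNIV::'d set) (\<lambda>_. {0..N}))"
  proof
    fix m :: "real ^ 'd" assume m: "m \<in> simplex_grid N"
    then have "\<forall>i. \<exists>k::nat. m $ i = real k / real N" by (simp add: simplex_grid_def)
    from choice[OF this] obtain k :: "'d \<Rightarrow> nat" where k: "\<And>i. m $ i = real (k i) / real N" by blast
    have "k i \<le> N" for i
    proof -
      have "m $ i \<le> 1" using m member_le_sum[of i UNIV "\<lambda>i. m $ i"] by (auto simp: simplex_grid_def prob_simplex_def)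
      then show ?thesis using k[of i] N by (simp add: field_simps)
    qed
    then show "m \<in> (\<lambda>k. \<chi> i. real (k i) / real N) ` (Pi\<^sub>E (UNIV::'d set) (\<lambda>_. {0..N}))"
      by (intro image_eqI[where x=k]) (auto simp: vec_eq_iff k)
  qed
qed

definition jump_target :: "nat \<Rightarrow> real ^ 'd \<Rightarrow> 'd::finite \<Rightarrow> 'd \<Rightarrow> real ^ 'd" where
  "jump_target N x i j = x + (1 / real N) *\<^sub>R (axis j 1 - axis i 1)"

lemma jump_target_nth:
  "jump_target N x i j $ k = x $ k + ((if k = j then 1 else 0) - (if k = i then 1 else 0)) / real N"
  by (simp add: jump_target_def axis_def)

text \<open>A nonzero coordinate of a grid point is at least 1 / N, so one agent can leave it
  without making it negative.\<close>

lemma jump_target_in_grid: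
  assumes x: "x \<in> simplex_grid N" and i: "x $ i \<noteq> 0"
  shows "jump_target N x i j \<in> simplex_grid N"
proof -
  have N: "N \<noteq> 0"
  proof
    assume "N = 0"
    moreover obtain k :: nat where "x $ i = real k / real N" using x by (auto simp: simplex_grid_def)
    ultimately show False using i by simp
  qed
  have x0: "\<And>k. 0 \<le> x $ k" "(\<Sum>k\<in>UNIV. x $ k) = 1" "\<And>k. \<exists>n::nat. x $ k = real n / real N"
    using x by (auto simp: simplex_grid_def prob_simplex_def)
  have n: "\<exists>n::nat. jump_target N x i j $ k = real n / real N" for k
  proof -
    obtain n :: nat where n: "x $ k = real n / real N" using x0(3) by blast
    show ?thesis
    proof (cases "k = i \<and> k \<noteq> j")
      case True
      then have "n \<ge> 1" using n i by (cases n) auto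
      then have "jump_target N x i j $ k = real (n - 1) / real N"
        using True n by (auto simp: jump_target_nth of_nat_diff diff_divide_distrib)
      then show ?thesis by blast
    next
      case no_loss: False
      show ?thesis
      proof (cases "k = j \<and> k \<noteq> i")
        case True
        then have "jump_target N x i j $ k = real (Suc n) / real N"
          using n by (auto simp: jump_target_nth add_divide_distrib)
        then show ?thesis by blast
      next
        case False
        then have "(k = j) = (k = i)" using no_loss by blast
        then have "jump_target N x i j $ k = real n / real N"
          unfolding jump_target_nth n by simp
        then show ?thesis by blast
      qed
    qed
  qed
  then have "0 \<le> jump_target N x i j $ k" for k by (metis divide_nonneg_nonneg of_nat_0_le_iff)
  moreover have "(\<Sum>k\<in>UNIV. jump_target N x i j $ k) = 1"
    by (simp add: jump_target_nth sum.distrib x0(2) flip: sum_divide_distrib) (simp add: sum_subtractf)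
  ultimately show ?thesis using n by (simp add: simplex_grid_def prob_simplex_def)
qed

text \<open>Reindexing by the pairs (i, j), each of which contributes to one target only. That
  target differs from x because i \<noteq> j, and it can lie outside the grid only if x has no mass
  in i, in which case the rate is zero.\<close>

lemma sum_agent_jump_rate:
  fixes h :: "real ^ 'd::finite \<Rightarrow> real"
  assumes N: "N \<ge> 1" and x: "x \<in> simplex_grid N"
  shows "(\<Sum>z\<in>simplex_grid N - {x}. agent_jump_rate N Q \<alpha> s x z * h z) =
    (\<Sum>p\<in>{p. fst p \<noteq> snd p}. real N * x $ fst p * Q (fst p) (snd p) s (\<alpha> s (fst p) x) x * h (jump_target N x (fst p) (snd p)))"
proof -
  let ?S = "simplex_grid N - {x}" and ?P = "{p :: 'd \<times> 'd. fst p \<noteq> snd p}"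
  let ?c = "\<lambda>p. real N * x $ fst p * Q (fst p) (snd p) s (\<alpha> s (fst p) x) x"
  let ?y = "\<lambda>p. jump_target N x (fst p) (snd p)"
  have fin: "finite ?S" using finite_simplex_grid[OF N] by blast
  have r: "agent_jump_rate N Q \<alpha> s x z = (\<Sum>p\<in>?P. if z = ?y p then ?c p else 0)" for z
  proof -
    have "agent_jump_rate N Q \<alpha> s x z = sum ?c {p \<in> ?P. z = ?y p}"
      unfolding agent_jump_rate_def jump_target_def by (intro sum.cong) auto
    also have "\<dots> = (\<Sum>p\<in>?P. if z = ?y p then ?c p else 0)" by (rule sum.inter_filter) simp
    finally show ?thesis .
  qed
  have "(\<Sum>z\<in>?S. agent_jump_rate N Q \<alpha> s x z * h z) = (\<Sum>z\<in>?S. \<Sum>p\<in>?P. if z = ?y p then ?c p * h z else 0)"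
    unfolding r sum_distrib_right by (intro sum.cong refl) auto
  also have "\<dots> = (\<Sum>p\<in>?P. \<Sum>z\<in>?S. if z = ?y p then ?c p * h z else 0)" by (rule sum.swap)
  also have "\<dots> = (\<Sum>p\<in>?P. ?c p * h (?y p))"
  proof (rule sum.cong[OF refl])
    fix p assume p: "p \<in> ?P"
    have "?y p \<in> ?S \<or> ?c p = 0"
    proof (cases "x $ fst p = 0")
      case False
      have "?y p $ snd p \<noteq> x $ snd p" using p N by (simp add: jump_target_nth)
      then show ?thesis using jump_target_in_grid[OF x False, of "snd p"] by auto
    qed simp
    then show "(\<Sum>z\<in>?S. if z = ?y p then ?c p * h z else 0) = ?c p * h (?y p)"
      using fin by auto
  qed
  finally show ?thesis .
qed

context mean_field
begin

lemma feedback_in: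
  assumes "\<alpha> \<in> feedback_controls N T A" "s \<in> {0..T}" "m \<in> simplex_grid N"
  shows "\<alpha> s i m \<in> A"
  using measurable_space[OF assms(1)[unfolded feedback_controls_def mem_Collect_eq], of "(s, i, m)"] assms(2,3)
  by (simp add: space_pair_measure space_restrict_space)

lemma feedback_comp_measurable:
  assumes \<alpha>: "\<alpha> \<in> feedback_controls N T A"
    and x: "x \<in> measurable (restrict_space borel {0..T}) (count_space (simplex_grid N))"
  shows "(\<lambda>s. \<alpha> s i (x s)) \<in> borel_measurable (restrict_space borel {0..T})"
proof -
  have "(\<lambda>s. (s, i, x s)) \<in> measurable (restrict_space borel {0..T})
    (restrict_space borel {0..T} \<Otimes>\<^sub>M count_space UNIV \<Otimes>\<^sub>M count_space (simplex_grid N))"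
    using x by (intro measurable_Pair) auto
  from measurable_compose[OF this \<alpha>[unfolded feedback_controls_def mem_Collect_eq]]
  show ?thesis by (simp add: measurable_restrict_space2_iff)
qed

lemma grid_subset: "m \<in> simplex_grid N \<Longrightarrow> m \<in> prob_simplex"
  by (simp add: simplex_grid_def)

text \<open>A crude bound: at most d * d pairs, each with rate at most N * K. It grows with N, but
  it serves only the construction and integrability and does not enter
  \<open>rate_const\<close>.\<close>

definition rate_bound :: "nat \<Rightarrow> real" where "rate_bound N = d * d * (real N * K)"

lemma jump_term_bounds:
  assumes \<alpha>: "\<alpha> \<in> feedback_controls N T A" and s: "s \<in> {0..T}" and x: "x \<in> simplex_grid N"
  shows "0 \<le> x $ k * Q i j s (\<alpha> s l x) x" "x $ k * Q i j s (\<alpha> s l x) x \<le> K"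
proof -
  note b = simplex_nth[OF grid_subset[OF x], of k] Q_nonneg[OF s feedback_in[OF \<alpha> s x] grid_subset[OF x], of i j l]
    Q_le[OF s feedback_in[OF \<alpha> s x] grid_subset[OF x], of i j l]
  show "0 \<le> x $ k * Q i j s (\<alpha> s l x) x" using b by simp
  have "x $ k * Q i j s (\<alpha> s l x) x \<le> 1 * K" using b by (intro mult_mono) auto
  then show "x $ k * Q i j s (\<alpha> s l x) x \<le> K" by simp
qed

lemma card_pairs: "real (card (UNIV :: ('d \<times> 'd) set)) = d * d"
  by (simp add: d_def card_cartesian_product flip: UNIV_Times_UNIV)

lemma agent_jump_rate_bounds:
  assumes \<alpha>: "\<alpha> \<in> feedback_controls N T A" and s: "s \<in> {0..T}" and x: "x \<in> simplex_grid N"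
  shows "0 \<le> agent_jump_rate N Q \<alpha> s x z" "agent_jump_rate N Q \<alpha> s x z \<le> rate_bound N"
proof -
  let ?P = "{(i, j). i \<noteq> j \<and> z = x + (1 / real N) *\<^sub>R (axis j 1 - axis i 1)}"
  have b: "0 \<le> real N * x $ i * Q i j s (\<alpha> s i x) x" "real N * x $ i * Q i j s (\<alpha> s i x) x \<le> real N * K" for i j
    using jump_term_bounds[OF \<alpha> s x, of i i j i] mult_left_mono[of "x $ i * Q i j s (\<alpha> s i x) x" K "real N"]
    by (auto simp: mult.assoc)
  show "0 \<le> agent_jump_rate N Q \<alpha> s x z"
    unfolding agent_jump_rate_def using b by (intro sum_nonneg) auto
  have "agent_jump_rate N Q \<alpha> s x z \<le> (\<Sum>p\<in>?P. real N * K)"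
    unfolding agent_jump_rate_def using b by (intro sum_mono) auto
  also have "\<dots> \<le> (\<Sum>p\<in>(UNIV :: ('d \<times> 'd) set). real N * K)"
    using K_pos by (intro sum_mono2) auto
  also have "\<dots> = rate_bound N" using card_pairs by (simp add: rate_bound_def)
  finally show "agent_jump_rate N Q \<alpha> s x z \<le> rate_bound N" .
qed

lemma agent_jump_rate_measurable:
  assumes \<alpha>: "\<alpha> \<in> feedback_controls N T A" and x: "x \<in> simplex_grid N"
  shows "(\<lambda>u. agent_jump_rate N Q \<alpha> u x z) \<in> borel_measurable (restrict_space borel {0..T})"
proof -
  have "(\<lambda>u. Q i j u (\<alpha> u i x) x) \<in> borel_measurable (restrict_space borel {0..T})" for i j
    by (rule Q_comp_measurable[OF restrict_id_measurable])
      (use feedback_comp_measurable[OF \<alpha>, of "\<lambda>_. x"] x feedback_in[OF \<alpha>] grid_subset[OF x] in \<open>auto simp: space_restrict_space\<close>)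
  then show ?thesis unfolding agent_jump_rate_def case_prod_beta
    by (intro borel_measurable_sum borel_measurable_times borel_measurable_const)
qed

lemma sum_pairs:
  fixes F :: "'d \<Rightarrow> 'd \<Rightarrow> real"
  assumes "\<And>i. F i i = 0"
  shows "(\<Sum>p\<in>{p. fst p \<noteq> snd p}. F (fst p) (snd p)) = (\<Sum>i\<in>UNIV. \<Sum>j\<in>UNIV. F i j)"
proof -
  have "(\<Sum>p\<in>{p. fst p \<noteq> snd p}. F (fst p) (snd p)) = (\<Sum>p\<in>UNIV. F (fst p) (snd p))"
    using assms by (intro sum.mono_neutral_left) auto
  also have "\<dots> = (\<Sum>i\<in>UNIV. \<Sum>j\<in>UNIV. F i j)"
    by (simp add: sum.cartesian_product case_prod_beta flip: UNIV_Times_UNIV)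
  finally show ?thesis .
qed

text \<open>The factor N of the rate and the jump size 1 / N cancel, so the drift is exactly that of
  the mean field equation, without discretisation error. Hence the defect of a trajectory consists
  of its martingale part alone.\<close>

lemma agent_drift:
  assumes N: "N \<ge> 1" and x: "x \<in> simplex_grid N"
  shows "(\<Sum>z\<in>simplex_grid N - {x}. agent_jump_rate N Q \<alpha> s x z * (z $ i - x $ i)) = mf_drift Q s (\<chi> i. \<alpha> s i x) x i"
proof -
  let ?r = "\<lambda>k j. x $ k * Q k j s (\<alpha> s k x) x"
  have "(\<Sum>z\<in>simplex_grid N - {x}. agent_jump_rate N Q \<alpha> s x z * (z $ i - x $ i)) =
    (\<Sum>p\<in>{p. fst p \<noteq> snd p}. (\<lambda>k j. ?r k j * ((if i = j then 1 else 0) - (if i = k then 1 else 0))) (fst p) (snd p))"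
    unfolding sum_agent_jump_rate[OF N x, where h="\<lambda>z. z $ i - x $ i"] using N
    by (intro sum.cong refl) (simp add: jump_target_nth)
  also have "\<dots> = (\<Sum>k\<in>UNIV. \<Sum>j\<in>UNIV. ?r k j * ((if i = j then 1 else 0) - (if i = k then 1 else 0)))"
    by (rule sum_pairs) simp
  also have "\<dots> = (\<Sum>k\<in>UNIV. \<Sum>j\<in>UNIV. (if i = j then ?r k j else 0)) - (\<Sum>k\<in>UNIV. \<Sum>j\<in>UNIV. (if i = k then ?r k j else 0))"
    unfolding sum_subtractf[symmetric] by (intro sum.cong refl) simp
  also have "(\<Sum>k\<in>UNIV. \<Sum>j\<in>UNIV. (if i = j then ?r k j else 0)) = (\<Sum>k\<in>UNIV. ?r k i)" by simp
  also have "(\<Sum>k\<in>UNIV. \<Sum>j\<in>UNIV. (if i = k then ?r k j else 0)) = (\<Sum>j\<in>UNIV. ?r i j)"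
    by (subst sum.swap) simp
  finally show ?thesis by (simp add: mf_drift_def sum_subtractf)
qed

text \<open>At most d * d pairs, each with rate at most N * K, and the squared jump of a coordinate
  is at most 1 / N^2.\<close>

lemma agent_quadratic_variation:
  assumes N: "N \<ge> 1" and x: "x \<in> simplex_grid N" and s: "s \<in> {0..T}" and \<alpha>: "\<alpha> \<in> feedback_controls N T A"
  shows "(\<Sum>z\<in>simplex_grid N - {x}. agent_jump_rate N Q \<alpha> s x z * (z $ i - x $ i)\<^sup>2) \<le> d * d * K / real N"
proof -
  let ?r = "\<lambda>p. x $ fst p * Q (fst p) (snd p) s (\<alpha> s (fst p) x) x"
  have "(\<Sum>z\<in>simplex_grid N - {x}. agent_jump_rate N Q \<alpha> s x z * (z $ i - x $ i)\<^sup>2) =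
    (\<Sum>p\<in>{p. fst p \<noteq> snd p}. ?r p * (real N * (jump_target N x (fst p) (snd p) $ i - x $ i)\<^sup>2))"
    unfolding sum_agent_jump_rate[OF N x, where h="\<lambda>z. (z $ i - x $ i)\<^sup>2"]
    by (intro sum.cong refl) simp
  also have "\<dots> \<le> (\<Sum>p\<in>{p :: 'd \<times> 'd. fst p \<noteq> snd p}. K * (1 / real N))"
  proof (intro sum_mono mult_mono)
    fix p :: "'d \<times> 'd"
    show "?r p \<le> K" by (rule jump_term_bounds(2)[OF \<alpha> s x])
    have "(jump_target N x (fst p) (snd p) $ i - x $ i)\<^sup>2 \<le> (1 / real N)\<^sup>2"
      by (auto simp: jump_target_nth power_divide)
    then have "real N * (jump_target N x (fst p) (snd p) $ i - x $ i)\<^sup>2 \<le> real N * (1 / real N)\<^sup>2"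
      by (rule mult_left_mono) simp
    then show "real N * (jump_target N x (fst p) (snd p) $ i - x $ i)\<^sup>2 \<le> 1 / real N"
      using N by (simp add: power2_eq_square)
  qed (use K_pos in auto)
  also have "\<dots> \<le> (\<Sum>p\<in>(UNIV :: ('d \<times> 'd) set). K * (1 / real N))"
    using K_pos by (intro sum_mono2) auto
  also have "\<dots> = d * d * K / real N" using card_pairs by simp
  finally show ?thesis .
qed

text \<open>\<open>stab\<close> times the bound for the expected \<open>noise\<close>: each of the d
  coordinates contributes (1 + d * d * K * T) / 2 from time T and T times as much from the time
  integral, up to the factor 1 / sqrt N.\<close>

definition rate_const :: real where
  "rate_const = stab * (d * ((1 + d * d * K * T) / 2 * (1 + T)))"

end

locale agent_chain = mean_field T A Q f g K L
  for T :: real and A :: "'a::metric_space set"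
    and Q :: "'d::finite \<Rightarrow> 'd \<Rightarrow> real \<Rightarrow> 'a \<Rightarrow> real ^ 'd \<Rightarrow> real" and f g and K L :: real +
  fixes N :: nat and t :: real and m :: "real ^ 'd" and \<alpha> and M :: "'w measure" and X
  assumes N: "N \<ge> 1" and t: "t \<in> {0..T}" and m: "m \<in> simplex_grid N" and \<alpha>: "\<alpha> \<in> feedback_controls N T A"
    and chain: "markov_chain_with_rates (simplex_grid N) (agent_jump_rate N Q \<alpha>) t T m M X"
begin

sublocale C: bounded_chain "simplex_grid N" "agent_jump_rate N Q \<alpha>" t T m M X "rate_bound N"
proof
  show "finite (simplex_grid N :: (real ^ 'd) set)" by (rule finite_simplex_grid[OF N])
  show "t \<le> T" using t by simp
  show "m \<in> simplex_grid N" by (rule m)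
  show "markov_chain_with_rates (simplex_grid N) (agent_jump_rate N Q \<alpha>) t T m M X" by (rule chain)
  show "(\<lambda>u. agent_jump_rate N Q \<alpha> u x z) \<in> borel_measurable (restrict_space borel {t..T})"
    if "x \<in> simplex_grid N" for x z
    by (rule measurable_restrict_Icc_later[OF agent_jump_rate_measurable[OF \<alpha> that] t])
  show "\<bar>agent_jump_rate N Q \<alpha> u x z\<bar> \<le> rate_bound N" if "u \<in> {t..T}" "x \<in> simplex_grid N" for u x z
    using agent_jump_rate_bounds[OF \<alpha> _ that(2), of u z] that t by auto
qed

definition path_cost :: "'w \<Rightarrow> real" where
  "path_cost \<omega> = (LBINT s:{t..T}. total_running_cost f s (\<chi> i. \<alpha> s i (X s \<omega>)) (X s \<omega>)) + total_terminal_cost g (X T \<omega>)"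

text \<open>The quantity on the right-hand side of \<open>mf_cost_stability\<close>, written with
  the coordinate martingales so that its expectation can be estimated term by term.\<close>

definition noise :: "'w \<Rightarrow> real" where
  "noise \<omega> = (\<Sum>i\<in>UNIV. \<bar>C.martingale_part (\<lambda>x. x $ i) T \<omega>\<bar> + (LBINT s:{t..T}. \<bar>C.martingale_part (\<lambda>x. x $ i) s \<omega>\<bar>))"

lemma agent_cost_eq: "agent_cost T f g t \<alpha> M X = C.expectation path_cost"
  by (simp add: agent_cost_def path_cost_def[abs_def] total_running_cost_def total_terminal_cost_def)

lemma tT: "t \<le> T" using t by simp

lemma X_simplex: "s \<in> {t..T} \<Longrightarrow> \<omega> \<in> space M \<Longrightarrow> X s \<omega> \<in> prob_simplex"
  using C.X_in grid_subset by blast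

lemma path_cost_integrable: "integrable M path_cost"
proof -
  define h where "h s x = total_running_cost f s (\<chi> i. \<alpha> s i x) x" for s x
  define D where "D s \<omega> = indicator {t..T} s * h s (X s \<omega>)" for s \<omega>
  have hm: "(\<lambda>u. h u x) \<in> borel_measurable (restrict_space borel {t..T})" if x: "x \<in> simplex_grid N" for x
    unfolding h_def
  proof (rule F_comp_measurable[OF restrict_id_measurable])
    have "(\<lambda>s. \<chi> i. \<alpha> s i x) \<in> borel_measurable (restrict_space borel {0..T})"
      using feedback_comp_measurable[OF \<alpha>, of "\<lambda>_. x"] x feedback_in[OF \<alpha>]
      by (intro borel_measurable_vec_compact[OF A_compact]) (auto simp: space_restrict_space)
    then show "(\<lambda>s. \<chi> i. \<alpha> s i x) \<in> borel_measurable (restrict_space borel {t..T})"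
      by (rule measurable_restrict_Icc_later[OF _ t])
  qed (use t x feedback_in[OF \<alpha>] grid_subset[OF x] in \<open>auto simp: space_restrict_space tuples_def\<close>)
  have Dm: "(\<lambda>p. D (fst p) (snd p)) \<in> borel_measurable (borel \<Otimes>\<^sub>M M)"
    unfolding D_def by (rule C.jointly_measurable_fun[OF hm])
  have Db: "\<bar>D u \<omega>\<bar> \<le> K * indicator {t..T} u" if \<omega>: "\<omega> \<in> space M" for u \<omega>
  proof (cases "u \<in> {t..T}")
    case True
    then have "\<bar>h u (X u \<omega>)\<bar> \<le> K" unfolding h_def
      using t \<omega> C.X_in[OF True \<omega>] feedback_in[OF \<alpha>] by (intro F_le X_simplex) (auto simp: tuples_def)
    then show ?thesis using True by (simp add: D_def)
  qed (simp add: D_def)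
  have "integrable M (\<lambda>\<omega>. LBINT u. D u \<omega>)"
    using C.fubini_expectation(3)[OF Dm Db, of "\<lambda>_. 1" 1] by simp
  moreover have "integrable M (\<lambda>\<omega>. total_terminal_cost g (X T \<omega>))"
    by (rule C.X_fun_integrable) (use tT in simp)
  ultimately show ?thesis
    unfolding path_cost_def[abs_def] set_lebesgue_integral_def D_def h_def by simp
qed

lemma noise_expectation:
  shows "integrable M noise" and "stab * C.expectation noise \<le> rate_const / sqrt (real N)"
proof -
  \<comment> \<open>As ?c is of order 1 / N, this choice makes both ?\<delta> and ?c / ?\<delta> of
    order 1 / sqrt N.\<close>
  let ?\<delta> = "1 / sqrt (real N)" and ?c = "d * d * K / real N"
  have \<delta>: "?\<delta> > 0" using N by simp
  have c: "(\<Sum>z\<in>simplex_grid N - {x}. agent_jump_rate N Q \<alpha> u x z * (z $ i - x $ i)\<^sup>2) \<le> ?c"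
    if "u \<in> {t..T}" "x \<in> simplex_grid N" for u x i
    using agent_quadratic_variation[OF N that(2) _ \<alpha>, of u i] that t by simp
  have c0: "0 \<le> ?c" using d_ge_1 K_pos by simp
  have TT: "T \<in> {t..T}" using tT by simp
  note E1 = C.expectation_abs_martingale_le[OF TT \<delta> c]
  note E2 = C.expectation_integral_martingale_le[OF \<delta> c c0]
  show "integrable M noise"
    unfolding noise_def[abs_def] using E1(1) E2(1)
    by (intro Bochner_Integration.integrable_sum Bochner_Integration.integrable_add)
  have b: "(?\<delta> + ?c * (T - t) / ?\<delta>) / 2 \<le> (1 + d * d * K * T) / 2 / sqrt (real N)"
  proof -
    have e: "?c * (T - t) / ?\<delta> = d * d * K * (T - t) / sqrt (real N)"
      using N by (simp add: field_simps real_sqrt_mult_self)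
    have "d * d * K * (T - t) \<le> d * d * K * T" using t d_ge_1 K_pos by (intro mult_left_mono) auto
    then have "d * d * K * (T - t) / sqrt (real N) \<le> d * d * K * T / sqrt (real N)" by (intro divide_right_mono) auto
    then have "(?\<delta> + d * d * K * (T - t) / sqrt (real N)) / 2 \<le> (?\<delta> + d * d * K * T / sqrt (real N)) / 2"
      by (rule divide_right_mono[OF add_left_mono]) simp
    also have "\<dots> = (1 + d * d * K * T) / 2 / sqrt (real N)" by (simp add: add_divide_distrib)
    finally show ?thesis unfolding e .
  qed
  let ?b = "(1 + d * d * K * T) / 2 / sqrt (real N)"
  have b0: "0 \<le> ?b" using d_ge_1 K_pos T_pos by simp
  have "C.expectation noise = (\<Sum>i\<in>UNIV. C.expectation (\<lambda>\<omega>. \<bar>C.martingale_part (\<lambda>x. x $ i) T \<omega>\<bar>) +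
      C.expectation (\<lambda>\<omega>. LBINT s:{t..T}. \<bar>C.martingale_part (\<lambda>x. x $ i) s \<omega>\<bar>))"
    unfolding noise_def[abs_def] using E1(1) E2(1) by (simp add: Bochner_Integration.integral_sum)
  also have "\<dots> \<le> (\<Sum>i\<in>(UNIV :: 'd set). ?b + ?b * T)"
  proof (intro sum_mono add_mono)
    fix i
    show "C.expectation (\<lambda>\<omega>. \<bar>C.martingale_part (\<lambda>x. x $ i) T \<omega>\<bar>) \<le> ?b"
      using E1(2)[of i] b by linarith
    have "C.expectation (\<lambda>\<omega>. LBINT s:{t..T}. \<bar>C.martingale_part (\<lambda>x. x $ i) s \<omega>\<bar>) \<le> (?\<delta> + ?c * (T - t) / ?\<delta>) / 2 * (T - t)"
      by (rule E2(2))
    also have "\<dots> \<le> ?b * T" using b b0 t by (intro mult_mono) auto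
    finally show "C.expectation (\<lambda>\<omega>. LBINT s:{t..T}. \<bar>C.martingale_part (\<lambda>x. x $ i) s \<omega>\<bar>) \<le> ?b * T" .
  qed
  also have "\<dots> = d * ((1 + d * d * K * T) / 2 * (1 + T)) / sqrt (real N)"
    by (simp add: d_def algebra_simps add_divide_distrib)
  finally show "stab * C.expectation noise \<le> rate_const / sqrt (real N)"
    unfolding rate_const_def using stab_pos mult_left_mono[of "C.expectation noise" _ stab]
    by (metis less_imp_le times_divide_eq_right)
qed

lemma path_measurable:
  assumes \<omega>: "\<omega> \<in> space M"
  shows "(\<lambda>s. X (C.clip s) \<omega>) \<in> measurable borel (count_space (simplex_grid N))"
  using measurable_compose[OF measurable_Pair2'[OF \<omega>, of borel] C.jointly_measurable] by simp

text \<open>For a fixed trajectory, \<open>agent_drift\<close> identifies the defect with the l1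
  size of the coordinate martingales, and stability applies. The control \<beta> is tied to the
  feedback control along this trajectory alone, which covers both a frozen feedback control and a
  control that ignores the state.\<close>

lemma path_cost_near:
  assumes \<omega>: "\<omega> \<in> space M" and \<beta>: "control_on t \<beta>" and \<beta>\<alpha>: "\<And>s i. s \<in> {t..T} \<Longrightarrow> \<beta> s $ i = \<alpha> s i (X s \<omega>)"
    and \<mu>: "mf_solution T Q t m \<beta> \<mu>"
  shows "\<bar>path_cost \<omega> - mf_cost t \<beta> \<mu>\<bar> \<le> stab * noise \<omega>"
proof -
  let ?x = "\<lambda>s. X s \<omega>"
  have \<beta>': "\<beta> s = (\<chi> i. \<alpha> s i (X s \<omega>))" if "s \<in> {t..T}" for s using \<beta>\<alpha>[OF that] by (simp add: vec_eq_iff)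
  have xm: "?x \<in> borel_measurable (restrict_space borel {t..T})"
  proof -
    have "(\<lambda>s. X (C.clip s) \<omega>) \<in> borel_measurable (restrict_space borel {t..T})"
      using measurable_compose[OF path_measurable[OF \<omega>], of "\<lambda>x. x" borel] by (intro measurable_restrict_space1) simp
    then show ?thesis
      by (rule measurable_cong[THEN iffD1, rotated]) (simp add: space_restrict_space C.clip(2))
  qed
  have cost: "path_cost \<omega> = mf_cost t \<beta> ?x"
    unfolding path_cost_def mf_cost_def using \<beta>' by (intro arg_cong2[where f="(+)"] set_lebesgue_integral_cong) auto
  have mp: "C.martingale_part (\<lambda>x. x $ i) s \<omega> = X s \<omega> $ i - m $ i - (LBINT u:{t..s}. mf_drift Q u (\<beta> u) (X u \<omega>) i)"
    if s: "s \<in> {t..T}" for s i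
  proof -
    have "C.gen u (\<lambda>x. x $ i) (X u \<omega>) = mf_drift Q u (\<beta> u) (X u \<omega>) i" if "u \<in> {t..s}" for u
    proof -
      have u: "u \<in> {t..T}" using that s by auto
      show ?thesis unfolding C.gen_def \<beta>'[OF u] by (rule agent_drift[OF N C.X_in[OF u \<omega>]])
    qed
    then have "(LBINT u:{t..s}. C.gen u (\<lambda>x. x $ i) (X u \<omega>)) = (LBINT u:{t..s}. mf_drift Q u (\<beta> u) (X u \<omega>) i)"
      by (intro set_lebesgue_integral_cong) auto
    then show ?thesis by (simp add: C.martingale_part_def)
  qed
  have de: "defect t m \<beta> ?x s = (\<Sum>i\<in>UNIV. \<bar>C.martingale_part (\<lambda>x. x $ i) s \<omega>\<bar>)" if "s \<in> {t..T}" for s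
    unfolding defect_def using mp[OF that] by simp
  have mi: "set_integrable lborel {t..T} (\<lambda>s. \<bar>C.martingale_part (\<lambda>x. x $ i) s \<omega>\<bar>)" for i
  proof -
    obtain C where C: "\<And>r \<omega>. r \<in> {t..T} \<Longrightarrow> \<omega> \<in> space M \<Longrightarrow> \<bar>C.martingale_part (\<lambda>x. x $ i) r \<omega>\<bar> \<le> C"
      using C.martingale_part_bound by blast
    have "set_integrable lborel {t..T} (\<lambda>s. C.martingale_part (\<lambda>x. x $ i) s \<omega>)"
    proof (rule set_integrable_bounded)
      show "set_borel_measurable lborel {t..T} (\<lambda>s. C.martingale_part (\<lambda>x. x $ i) s \<omega>)"
        using C.path_section_measurable[OF C.martingale_part_measurable[of "\<lambda>x. x $ i"] \<omega>]
        by (simp add: set_borel_measurable_def)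
    qed (use C \<omega> in auto)
    then show ?thesis by (rule set_integrable_abs)
  qed
  have "(LBINT s:{t..T}. defect t m \<beta> ?x s) = (LBINT s:{t..T}. \<Sum>i\<in>UNIV. \<bar>C.martingale_part (\<lambda>x. x $ i) s \<omega>\<bar>)"
    using de by (intro set_lebesgue_integral_cong) auto
  also have "\<dots> = (\<Sum>i\<in>UNIV. LBINT s:{t..T}. \<bar>C.martingale_part (\<lambda>x. x $ i) s \<omega>\<bar>)"
    unfolding set_lebesgue_integral_def scaleR_sum_right
    using mi by (intro Bochner_Integration.integral_sum) (auto simp: set_integrable_def)
  finally have "defect t m \<beta> ?x T + (LBINT s:{t..T}. defect t m \<beta> ?x s) = noise \<omega>"
    using de[of T] tT by (simp add: noise_def sum.distrib)
  then show ?thesis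
    using mf_cost_stability[OF \<beta> t \<mu> xm X_simplex[OF _ \<omega>]] by (simp add: cost)
qed

text \<open>Freezing \<open>\<omega>\<close> turns a feedback control into an open-loop control of the mean field problem.\<close>

lemma frozen_control:
  assumes \<omega>: "\<omega> \<in> space M"
  shows "(\<lambda>s. \<chi> i. \<alpha> s i (X (C.clip s) \<omega>)) \<in> mf_controls T A"
proof -
  have x: "(\<lambda>s. X (C.clip s) \<omega>) \<in> measurable (restrict_space borel {0..T}) (count_space (simplex_grid N))"
    by (rule measurable_restrict_space1[OF path_measurable[OF \<omega>]])
  have v: "\<alpha> s i (X (C.clip s) \<omega>) \<in> A" if "s \<in> {0..T}" for s i
    by (rule feedback_in[OF \<alpha> that C.X_in[OF C.clip(1) \<omega>]])
  have "(\<lambda>s. \<chi> i. \<alpha> s i (X (C.clip s) \<omega>)) \<in> borel_measurable (restrict_space borel {0..T})"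
    using feedback_comp_measurable[OF \<alpha> x] v
    by (intro borel_measurable_vec_compact[OF A_compact]) (auto simp: space_restrict_space)
  then show ?thesis unfolding mf_controls_def
    using v by (intro measurable_restrict_space2) (auto simp: space_restrict_space tuples_def)
qed

lemma agent_cost_ge: "mf_value T A Q f g t m - rate_const / sqrt (real N) \<le> agent_cost T f g t \<alpha> M X"
proof -
  have p: "mf_value T A Q f g t m - stab * noise \<omega> \<le> path_cost \<omega>" if \<omega>: "\<omega> \<in> space M" for \<omega>
  proof -
    let ?\<beta> = "\<lambda>s. \<chi> i. \<alpha> s i (X (C.clip s) \<omega>)"
    have c: "control_on t ?\<beta>" by (rule mf_controls_control_on[OF frozen_control[OF \<omega>] t])
    obtain \<mu> where \<mu>: "mf_solution T Q t m ?\<beta> \<mu>" using mf_solution_exists[OF c t grid_subset[OF m]] by blast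
    have "mf_value T A Q f g t m \<le> mf_cost t ?\<beta> \<mu>" by (rule mf_value_le[OF t frozen_control[OF \<omega>] \<mu>])
    moreover have "\<bar>path_cost \<omega> - mf_cost t ?\<beta> \<mu>\<bar> \<le> stab * noise \<omega>"
      by (rule path_cost_near[OF \<omega> c _ \<mu>]) (simp add: C.clip(2))
    ultimately show ?thesis by linarith
  qed
  have "mf_value T A Q f g t m - stab * C.expectation noise = C.expectation (\<lambda>\<omega>. mf_value T A Q f g t m - stab * noise \<omega>)"
    using noise_expectation(1) by (simp add: C.prob_space)
  also have "\<dots> \<le> C.expectation path_cost"
    using noise_expectation(1) path_cost_integrable p by (intro integral_mono) auto
  finally show ?thesis using noise_expectation(2) unfolding agent_cost_eq by linarith
qed

text \<open>A control that ignores the state is the same along all trajectories, so a single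
  solution \<mu> serves for every \<omega>.\<close>

lemma agent_cost_le:
  assumes \<beta>: "control_on t \<beta>" and \<beta>\<alpha>: "\<And>s i x. \<alpha> s i x = \<beta> s $ i" and \<mu>: "mf_solution T Q t m \<beta> \<mu>"
  shows "agent_cost T f g t \<alpha> M X \<le> mf_cost t \<beta> \<mu> + rate_const / sqrt (real N)"
proof -
  have p: "path_cost \<omega> \<le> mf_cost t \<beta> \<mu> + stab * noise \<omega>" if \<omega>: "\<omega> \<in> space M" for \<omega>
    using path_cost_near[OF \<omega> \<beta> _ \<mu>] \<beta>\<alpha> by fastforce
  have "C.expectation path_cost \<le> C.expectation (\<lambda>\<omega>. mf_cost t \<beta> \<mu> + stab * noise \<omega>)"
    using noise_expectation(1) path_cost_integrable p by (intro integral_mono) auto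
  also have "\<dots> = mf_cost t \<beta> \<mu> + stab * C.expectation noise"
    using noise_expectation(1) by (simp add: C.prob_space)
  finally show ?thesis using noise_expectation(2) unfolding agent_cost_eq by linarith
qed

end

section \<open>Comparison of the two value functions\<close>

context mean_field
begin

lemma open_loop_feedback:
  fixes \<alpha> :: "real \<Rightarrow> 'a ^ 'd"
  assumes "\<alpha> \<in> mf_controls T A"
  shows "(\<lambda>s i x. \<alpha> s $ i) \<in> feedback_controls N T A"
proof -
  let ?N = "restrict_space borel {0..T} \<Otimes>\<^sub>M count_space UNIV \<Otimes>\<^sub>M count_space (simplex_grid N) :: (real \<times> 'd \<times> (real ^ 'd)) measure"
  have v: "\<alpha> s $ i \<in> A" if "s \<in> {0..T}" for s i
  proof -
    have "\<alpha> s \<in> tuples A"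
      using measurable_space[OF assms[unfolded mf_controls_def], of s] that by (simp add: space_restrict_space)
    then show ?thesis by (rule tuples_nth)
  qed
  have \<alpha>: "\<alpha> \<in> borel_measurable (restrict_space borel {0..T})"
    using assms unfolding mf_controls_def by (simp add: measurable_restrict_space2_iff)
  have "(\<lambda>p. \<alpha> (fst p) $ fst (snd p)) \<in> borel_measurable ?N"
  proof (rule measurable_compose_countable'[where I=UNIV and f="\<lambda>i p. \<alpha> (fst p) $ i" and g="\<lambda>p. fst (snd p)"])
    fix i
    show "(\<lambda>p. \<alpha> (fst p) $ i) \<in> borel_measurable ?N"
      by (rule measurable_compose[OF measurable_fst measurable_compose[OF \<alpha> vec_nth_measurable]])
  qed (auto intro: countable_finite)
  then have "(\<lambda>p. \<alpha> (fst p) $ fst (snd p)) \<in> measurable ?N (restrict_space borel A)"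
    using v by (intro measurable_restrict_space2) (auto simp: space_pair_measure space_restrict_space)
  then show ?thesis by (simp add: feedback_controls_def case_prod_beta')
qed

lemma agent_chain_exists:
  assumes N: "N \<ge> 1" and t: "t \<in> {0..T}" and m: "m \<in> simplex_grid N" and \<alpha>: "\<alpha> \<in> feedback_controls N T A"
  shows "\<exists>M :: (real \<Rightarrow> real ^ 'd) measure.
    markov_chain_with_rates (simplex_grid N) (agent_jump_rate N Q \<alpha>) t T m M (\<lambda>s \<omega>. \<omega> s)"
proof -
  let ?S = "simplex_grid N :: (real ^ 'd) set"
  \<comment> \<open>\<open>jump_rates\<close> asks for rates that are bounded and measurable on the
    whole line, hence the cut-off.\<close>
  let ?q = "\<lambda>u x z. indicator {0..T} u * agent_jump_rate N Q \<alpha> u x z"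
  have B: "rate_bound N > 0" using d_ge_1 K_pos N by (simp add: rate_bound_def)
  interpret jump_rates ?S ?q "rate_bound N"
  proof
    show "finite ?S" by (rule finite_simplex_grid[OF N])
    show "?S \<noteq> {}" using m by blast
    show "0 < rate_bound N" by (rule B)
    fix u x z assume x: "x \<in> ?S"
    show "0 \<le> ?q u x z" "?q u x z \<le> rate_bound N"
      using agent_jump_rate_bounds[OF \<alpha> _ x, of u z] B by (auto simp: indicator_def)
  next
    fix x z assume x: "x \<in> ?S"
    show "(\<lambda>u. ?q u x z) \<in> borel_measurable borel"
      using agent_jump_rate_measurable[OF \<alpha> x, of z] by (simp add: borel_measurable_restrict_space_iff)
  qed
  obtain M :: "(real \<Rightarrow> real ^ 'd) measure" where "markov_chain_with_rates ?S ?q t T m M (\<lambda>s \<omega>. \<omega> s)"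
    using markov_chain_exists[OF m, of t T] t by auto
  then have "markov_chain_with_rates ?S (agent_jump_rate N Q \<alpha>) t T m M (\<lambda>s \<omega>. \<omega> s)"
    by (rule markov_chain_with_rates_cong[rotated]) (use t in auto)
  then show ?thesis by blast
qed

text \<open>The lower bound for all realisations also makes J bounded below. A realisation of an
  almost optimal open-loop control makes J nonempty and gives the upper bound.\<close>

lemma agent_value_close:
  assumes N: "N \<ge> 1" and t: "t \<in> {0..T}" and m: "m \<in> simplex_grid N"
  shows "\<bar>agent_value N T A Q f g t m - mf_value T A Q f g t m\<bar> \<le> rate_const / sqrt (real N)"
proof -
  let ?V = "mf_value T A Q f g t m" and ?r = "rate_const / sqrt (real N)"
  define J where "J = {agent_cost T f g t \<alpha> M (\<lambda>s \<omega>. \<omega> s) | \<alpha> (M :: (real \<Rightarrow> real ^ 'd) measure).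
       \<alpha> \<in> feedback_controls N T A \<and>
       markov_chain_with_rates (simplex_grid N) (agent_jump_rate N Q \<alpha>) t T m M (\<lambda>s \<omega>. \<omega> s)}"
  have V: "agent_value N T A Q f g t m = Inf J" by (simp add: agent_value_def J_def)
  have ge: "?V - ?r \<le> c" if "c \<in> J" for c
  proof -
    obtain \<alpha> and M :: "(real \<Rightarrow> real ^ 'd) measure" where c: "c = agent_cost T f g t \<alpha> M (\<lambda>s \<omega>. \<omega> s)"
      and \<alpha>: "\<alpha> \<in> feedback_controls N T A"
      and M: "markov_chain_with_rates (simplex_grid N) (agent_jump_rate N Q \<alpha>) t T m M (\<lambda>s \<omega>. \<omega> s)"
      using \<open>c \<in> J\<close> by (auto simp: J_def)
    interpret agent_chain T A Q f g K L N t m \<alpha> M "\<lambda>s \<omega>. \<omega> s"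
      by unfold_locales (rule N t m \<alpha> M)+
    show ?thesis unfolding c by (rule agent_cost_ge)
  qed
  have ex: "\<exists>c\<in>J. c \<le> ?V + ?r + \<epsilon>" if \<epsilon>: "\<epsilon> > 0" for \<epsilon>
  proof -
    obtain \<beta> \<mu> where \<beta>: "\<beta> \<in> mf_controls T A" and \<mu>: "mf_solution T Q t m \<beta> \<mu>" and c: "mf_cost t \<beta> \<mu> < ?V + \<epsilon>"
      using mf_value_approx[OF t grid_subset[OF m] \<epsilon>] by blast
    let ?\<alpha> = "\<lambda>s i x. \<beta> s $ i"
    have \<alpha>: "?\<alpha> \<in> feedback_controls N T A" by (rule open_loop_feedback[OF \<beta>])
    obtain M :: "(real \<Rightarrow> real ^ 'd) measure" where
      M: "markov_chain_with_rates (simplex_grid N) (agent_jump_rate N Q ?\<alpha>) t T m M (\<lambda>s \<omega>. \<omega> s)"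
      using agent_chain_exists[OF N t m \<alpha>] by blast
    interpret agent_chain T A Q f g K L N t m ?\<alpha> M "\<lambda>s \<omega>. \<omega> s"
      by unfold_locales (rule N t m \<alpha> M)+
    have "agent_cost T f g t ?\<alpha> M (\<lambda>s \<omega>. \<omega> s) \<le> mf_cost t \<beta> \<mu> + ?r"
      by (rule agent_cost_le[OF mf_controls_control_on[OF \<beta> t] refl \<mu>])
    moreover have "agent_cost T f g t ?\<alpha> M (\<lambda>s \<omega>. \<omega> s) \<in> J" using \<alpha> M by (auto simp: J_def)
    ultimately show ?thesis using c by (intro bexI) auto
  qed
  have bdd: "bdd_below J" using ge by (rule bdd_belowI)
  have ne: "J \<noteq> {}" using ex[of 1] by auto
  have "?V - ?r \<le> Inf J" using ne ge by (rule cInf_greatest)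
  moreover have "Inf J \<le> ?V + ?r"
  proof (rule field_le_epsilon)
    fix \<epsilon> :: real assume "\<epsilon> > 0"
    then obtain c where "c \<in> J" "c \<le> ?V + ?r + \<epsilon>" using ex by blast
    then show "Inf J \<le> ?V + ?r + \<epsilon>" using cInf_lower[OF _ bdd] by fastforce
  qed
  ultimately show ?thesis unfolding V by linarith
qed

end

text \<open>Continuity on compact sets bounds the rates and the running cost; the terminal cost is
  Lipschitz, hence continuous and bounded as well. The Lipschitz conditions in time and state are
  used at equal times.\<close>

lemma assumption_A_mean_field:
  fixes Q :: "'d::finite \<Rightarrow> 'd \<Rightarrow> real \<Rightarrow> 'a::metric_space \<Rightarrow> real ^ 'd \<Rightarrow> real"
  assumes T: "T > 0" and A_ne: "A \<noteq> {}"
    and Q_nonneg: "\<And>i j t a m. t \<in> {0..T} \<Longrightarrow> a \<in> A \<Longrightarrow> m \<in> prob_simplex \<Longrightarrow> Q i j t a m \<ge> 0"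
    and asm: "assumption_A T A Q f g"
  shows "\<exists>K L. mean_field T A Q f g K L"
proof -
  have A: "compact A" using asm unfolding assumption_A_def by (elim conjE)
  have "\<forall>i j. continuous_on ({0..T} \<times> A \<times> prob_simplex) (\<lambda>(t, a, m). Q i j t a m)"
    using asm unfolding assumption_A_def by (elim conjE)
  then have Qc: "\<And>i j. continuous_on ({0..T} \<times> A \<times> prob_simplex) (\<lambda>(t, a, m). Q i j t a m)" by blast
  have Fc: "continuous_on ({0..T} \<times> tuples A \<times> prob_simplex) (\<lambda>(t, a, m). total_running_cost f t a m)"
    using asm unfolding assumption_A_def by (elim conjE)
  have "\<exists>C. \<forall>i j. \<forall>t\<in>{0..T}. \<forall>s\<in>{0..T}. \<forall>a\<in>A. \<forall>m\<in>prob_simplex. \<forall>p\<in>prob_simplex.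
      \<bar>Q i j t a m - Q i j s a p\<bar> \<le> C * (\<bar>t - s\<bar> + norm (m - p))"
    using asm unfolding assumption_A_def by (elim conjE)
  then obtain C1 where C1: "\<forall>i j. \<forall>t\<in>{0..T}. \<forall>s\<in>{0..T}. \<forall>a\<in>A. \<forall>m\<in>prob_simplex. \<forall>p\<in>prob_simplex.
      \<bar>Q i j t a m - Q i j s a p\<bar> \<le> C1 * (\<bar>t - s\<bar> + norm (m - p))" by (elim exE)
  have "\<exists>C. \<forall>t\<in>{0..T}. \<forall>s\<in>{0..T}. \<forall>a\<in>tuples A. \<forall>m\<in>prob_simplex. \<forall>p\<in>prob_simplex.
      \<bar>total_running_cost f t a m - total_running_cost f s a p\<bar> \<le> C * (\<bar>t - s\<bar> + norm (m - p))"
    using asm unfolding assumption_A_def by (elim conjE)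
  then obtain C2 where C2: "\<forall>t\<in>{0..T}. \<forall>s\<in>{0..T}. \<forall>a\<in>tuples A. \<forall>m\<in>prob_simplex. \<forall>p\<in>prob_simplex.
      \<bar>total_running_cost f t a m - total_running_cost f s a p\<bar> \<le> C2 * (\<bar>t - s\<bar> + norm (m - p))" by (elim exE)
  have "\<exists>C. \<forall>m\<in>prob_simplex. \<forall>p\<in>prob_simplex.
      \<bar>total_terminal_cost g m - total_terminal_cost g p\<bar> \<le> C * norm (m - p)"
    using asm unfolding assumption_A_def by (elim conjE)
  then obtain C3 where C3: "\<forall>m\<in>prob_simplex. \<forall>p\<in>prob_simplex.
      \<bar>total_terminal_cost g m - total_terminal_cost g p\<bar> \<le> C3 * norm (m - p)" by (elim exE)
  \<comment> \<open>The three constants come without a sign condition, hence the absolute values;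
    the 1 makes L positive.\<close>
  define L where "L = 1 + \<bar>C1\<bar> + \<bar>C2\<bar> + \<bar>C3\<bar>"
  have L: "C * norm v \<le> L * norm v" if "C \<in> {C1, C2, C3}" for C and v :: "real ^ 'd"
    using that by (intro mult_right_mono) (auto simp: L_def)
  have Qb: "\<exists>B. \<forall>t\<in>{0..T}. \<forall>a\<in>A. \<forall>m\<in>prob_simplex. Q i j t a m \<le> B" for i j
  proof -
    have "compact ((\<lambda>(t, a, m). Q i j t a m) ` ({0..T} \<times> A \<times> prob_simplex))"
      by (intro compact_continuous_image Qc compact_Times A compact_Icc compact_prob_simplex)
    then have "bdd_above ((\<lambda>(t, a, m). Q i j t a m) ` ({0..T} \<times> A \<times> prob_simplex))"
      by (intro bounded_imp_bdd_above compact_imp_bounded)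
    then show ?thesis by (auto simp: bdd_above_def)
  qed
  then have "\<forall>p. \<exists>B. \<forall>t\<in>{0..T}. \<forall>a\<in>A. \<forall>m\<in>prob_simplex. Q (fst p) (snd p) t a m \<le> B" by blast
  from choice[OF this] obtain B0 where B0: "\<forall>p. \<forall>t\<in>{0..T}. \<forall>a\<in>A. \<forall>m\<in>prob_simplex. Q (fst p) (snd p) t a m \<le> B0 p" by (elim exE)
  define B where "B i j = B0 (i, j)" for i j
  have B: "Q i j t a m \<le> B i j" if "t \<in> {0..T}" "a \<in> A" "m \<in> prob_simplex" for i j t a m
    using B0[rule_format, OF that, of "(i, j)"] by (simp add: B_def)
  have "compact ((\<lambda>(t, a, m). total_running_cost f t a m) ` ({0..T} \<times> tuples A \<times> prob_simplex))"
    by (intro compact_continuous_image Fc compact_Times compact_tuples A compact_Icc compact_prob_simplex)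
  then have "bounded ((\<lambda>(t, a, m). total_running_cost f t a m) ` ({0..T} \<times> tuples A \<times> prob_simplex))"
    by (rule compact_imp_bounded)
  then obtain B2 where B2: "\<And>t a m. t \<in> {0..T} \<Longrightarrow> a \<in> tuples A \<Longrightarrow> m \<in> prob_simplex \<Longrightarrow> \<bar>total_running_cost f t a m\<bar> \<le> B2"
    unfolding bounded_iff by fastforce
  have "continuous_on prob_simplex (total_terminal_cost g)"
  proof (rule lipschitz_on_continuous_on, rule lipschitz_onI)
    show "dist (total_terminal_cost g m) (total_terminal_cost g p) \<le> L * dist m p" if "m \<in> prob_simplex" "p \<in> prob_simplex" for m p
      using order_trans[OF C3[rule_format, OF that] L] by (simp add: dist_norm)
  qed (simp add: L_def)
  from compact_imp_bounded[OF compact_continuous_image[OF this compact_prob_simplex]]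
  obtain B3 where B3: "\<And>m. m \<in> prob_simplex \<Longrightarrow> \<bar>total_terminal_cost g m\<bar> \<le> B3"
    unfolding bounded_iff by fastforce
  define K where "K = 1 + (\<Sum>i\<in>UNIV. \<Sum>j\<in>UNIV. \<bar>B i j\<bar>) + \<bar>B2\<bar> + \<bar>B3\<bar>"
  have S0: "0 \<le> (\<Sum>i\<in>UNIV. \<Sum>j\<in>UNIV. \<bar>B i j\<bar>)" by (intro sum_nonneg) auto
  have BK: "B i j \<le> K" for i j
  proof -
    have "\<bar>B i j\<bar> \<le> (\<Sum>j\<in>UNIV. \<bar>B i j\<bar>)" by (intro member_le_sum) auto
    also have "\<dots> \<le> (\<Sum>i\<in>UNIV. \<Sum>j\<in>UNIV. \<bar>B i j\<bar>)"
      by (intro member_le_sum[of i UNIV "\<lambda>i. \<Sum>j\<in>UNIV. \<bar>B i j\<bar>"]) (auto intro: sum_nonneg)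
    finally show ?thesis unfolding K_def by linarith
  qed
  have "mean_field T A Q f g K L"
  proof
    show "T > 0" "compact A" "A \<noteq> {}" by fact+
    show "K > 0" using S0 by (simp add: K_def add_pos_nonneg)
    show "L > 0" by (simp add: L_def add_pos_nonneg)
    show "\<bar>Q i j t a m - Q i j t a p\<bar> \<le> L * norm (m - p)"
      if "t \<in> {0..T}" "a \<in> A" "m \<in> prob_simplex" "p \<in> prob_simplex" for i j t a m p
      using C1[rule_format, OF that(1,1,2,3,4), of i j] L[of C1 "m - p"] by simp
    show "\<bar>total_running_cost f t a m - total_running_cost f t a p\<bar> \<le> L * norm (m - p)"
      if "t \<in> {0..T}" "a \<in> tuples A" "m \<in> prob_simplex" "p \<in> prob_simplex" for t a m p
      using C2[rule_format, OF that(1,1,2,3,4)] L[of C2 "m - p"] by simp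
    show "\<bar>total_terminal_cost g m - total_terminal_cost g p\<bar> \<le> L * norm (m - p)"
      if "m \<in> prob_simplex" "p \<in> prob_simplex" for m p
      using C3[rule_format, OF that] L[of C3 "m - p"] by simp
    show "Q i j t a m \<le> K" if "t \<in> {0..T}" "a \<in> A" "m \<in> prob_simplex" for i j t a m
      using B[OF that] BK by (rule order_trans)
    show "\<bar>total_running_cost f t a m\<bar> \<le> K" if "t \<in> {0..T}" "a \<in> tuples A" "m \<in> prob_simplex" for t a m
      using B2[OF that] S0 unfolding K_def by linarith
    show "\<bar>total_terminal_cost g m\<bar> \<le> K" if "m \<in> prob_simplex" for m
      using B3[OF that] S0 unfolding K_def by linarith
  qed (fact Q_nonneg Qc Fc)+
  then show ?thesis by blast
qed

text \<open>Without actions there are no controls of either kind, so both values are the infimum of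
  the empty set.\<close>

lemma values_empty_action_space:
  fixes Q :: "'d::finite \<Rightarrow> 'd \<Rightarrow> real \<Rightarrow> 'a::metric_space \<Rightarrow> real ^ 'd \<Rightarrow> real" and m :: "real ^ 'd"
  assumes "t \<in> {0..T}" "m \<in> simplex_grid N"
  shows "agent_value N T {} Q f g t m = mf_value T {} Q f g t m"
proof -
  have "\<alpha> \<notin> feedback_controls N T {}" for \<alpha> :: "real \<Rightarrow> 'd \<Rightarrow> real ^ 'd \<Rightarrow> 'a"
  proof
    assume "\<alpha> \<in> feedback_controls N T {}"
    from measurable_space[OF this[unfolded feedback_controls_def mem_Collect_eq], of "(t, undefined, m)"] assms
    show False by (simp add: space_pair_measure space_restrict_space)
  qed
  moreover have "\<alpha> \<notin> mf_controls T {}" for \<alpha> :: "real \<Rightarrow> 'a ^ 'd"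
  proof
    assume "\<alpha> \<in> mf_controls T {}"
    from measurable_space[OF this[unfolded mf_controls_def], of t] assms
    show False by (simp add: space_restrict_space tuples_def)
  qed
  ultimately show ?thesis by (simp add: agent_value_def mf_value_def)
qed

theorem theorem10:
  fixes T :: real
    and A :: "'a::metric_space set"
    and Q :: "'d::finite \<Rightarrow> 'd \<Rightarrow> real \<Rightarrow> 'a \<Rightarrow> real ^ 'd \<Rightarrow> real"
    and f :: "'d \<Rightarrow> real \<Rightarrow> 'a \<Rightarrow> real ^ 'd \<Rightarrow> real"
    and g :: "'d \<Rightarrow> real ^ 'd \<Rightarrow> real"
  assumes "CARD('d) \<ge> 2"
    and "T > 0"
    and "\<And>i j t a m. t \<in> {0..T} \<Longrightarrow> a \<in> A \<Longrightarrow> m \<in> prob_simplex \<Longrightarrow> Q i j t a m \<ge> 0"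
    and "assumption_A T A Q f g"
  shows "\<exists>C. \<forall>N\<ge>1. \<forall>t\<in>{0..T}. \<forall>m\<in>simplex_grid N.
           \<bar>agent_value N T A Q f g t m - mf_value T A Q f g t m\<bar> \<le> C / sqrt (real N)"
proof (cases "A = {}")
  case True
  then show ?thesis by (intro exI[of _ 0]) (simp add: values_empty_action_space)
next
  case False
  then obtain K L where "mean_field T A Q f g K L"
    using assumption_A_mean_field[of T A Q f g] assms by blast
  then interpret mean_field T A Q f g K L .
  show ?thesis using agent_value_close by blast
qed

end
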